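(* Let $\alpha,\beta\in\widehat{\Gamma}$ be characters of $\Gamma$, and let $s^\beta$ be an analytic function on $\mathbb{D}$ which is character-automorphic with character $\beta$, i.e. $s^\beta\circ\gamma=\beta(\gamma)s^\beta$ for all $\gamma\in\Gamma$. Then $s^\beta$ is a Schur multiplier, i.e. multiplication by $s^\beta$ is a contraction from $\mathcal{H}_2^{\overline{\beta}\alpha}(\mathbb{D})$ into $\mathcal{H}_2^{\alpha}(\mathbb{D})$, if and only if there exists a $\mathbb{C}^{2\times 2}$-matrix valued Schur function $\Sigma=\begin{pmatrix}\Sigma_{11}&\Sigma_{12}\\ \Sigma_{21}&\Sigma_{22}\end{pmatrix}$ (analytic on $\mathbb{D}$ with contractive values) such that $$s^\beta(z)=\frac{A^\alpha(z)}{A^{\overline{\beta}\alpha}(z)}\;\frac{\Sigma_{12}(\sigma(z))}{1-S_{\overline{\beta}\alpha}(z)\,\Sigma_{22}(\sigma(z))},$$ $$S_\alpha(z)=\Sigma_{11}(\sigma(z))+\frac{\Sigma_{12}(\sigma(z))\,S_{\overline{\beta}\alpha}(z)\,\Sigma_{21}(\sigma(z))}{1-S_{\overline{\beta}\alpha}(z)\,\Sigma_{22}(\sigma(z))},$$ where both equalities are understood literally for $z\in\Omega_+$ (where $\sigma(z)\in\mathbb{D}$) and by analytic (meromorphic) extension on the rest of $\mathbb{D}$.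
   Context: Setting. $\mathbb{D}$ is the open unit disk, and $w^*$ denotes the complex conjugate of a number $w$. $\Gamma$ is a Fuchsian group (a properly discontinuous group of Möbius transformations, each mapping $\mathbb{D}$, the unit circle $\mathbb{T}$ and $\mathbb{C}\setminus\overline{\mathbb{D}}$ onto themselves), of convergence type ($\sum_{\gamma\in\Gamma}(1-|\gamma(z)|^2)<\infty$ for $z\in\mathbb{D}$), without elliptic and parabolic elements, and of Widom type. $\widehat{\Gamma}$ is the group of unimodular characters of $\Gamma$; $\overline{\beta}$ is the conjugate (inverse) character of $\beta$. The Green's function of $\Gamma$ with respect to $0$ is the Blaschke product $$b(z)=b_0(z)=\prod_{\gamma\in\Gamma}\frac{\gamma(0)-z}{1-\overline{\gamma(0)}z}\,\frac{|\gamma(0)|}{\gamma(0)}$$ (with the usual convention for Blaschke products that a factor with $\gamma(0)=0$ is $z$). Widom type means that $b'$ is of bounded characteristic. $\mu\in\widehat{\Gamma}$ is the character of $b$: $b\circ\gamma=\mu(\gamma)b$ for all $\gamma\in\Gamma$. Hardy spaces. For $\alpha\in\widehat{\Gamma}$, $\mathcal{H}_2^\alpha(\mathbb{D})=\{f\in\mathcal{H}_2(\mathbb{D}) : f\circ\gamma=\alpha(\gamma)f\ \ \forall\gamma\in\Gamma\}$, with the norm of the classical Hardy space $\mathcal{H}_2(\mathbb{D})$. It has a reproducing kernel $k^\alpha(z,\omega)$, and $k^\alpha(\xi,\xi)>0$ for all $\xi\in\mathbb{D}$. Covering map. $E$ is a set associated to $\Gamma$ such that $\overline{\mathbb{C}}\setminus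 E$ is equivalent to the Riemann surface $\mathbb{D}/\Gamma$, and $\mathfrak{z}:\mathbb{D}\to\overline{\mathbb{C}}\setminus E$ is a universal covering map with $\mathfrak{z}\circ\gamma=\mathfrak{z}$ for all $\gamma\in\Gamma$, with $\mathfrak{z}(z_1)=\mathfrak{z}(z_2)$ implying $z_1=\gamma(z_2)$ for some $\gamma\in\Gamma$, and normalized so that $(\mathfrak{z}b)(0)$ is real and positive (so $\mathfrak{z}(0)=\infty$). The triple $(\Gamma,E,\mathfrak{z})$ is such that, for every $\alpha\in\widehat{\Gamma}$, the reproducing kernel has the form (a known result, taken as given) $$k^\alpha(z,\omega)=c(\alpha)\,\frac{\frac{k^{\alpha\mu}(z,0)}{b(z)}\,k^\alpha(\omega,0)^*-\left(\frac{k^{\alpha\mu}(\omega,0)}{b(\omega)}\right)^{*}k^\alpha(z,0)}{\mathfrak{z}(z)-\mathfrak{z}(\omega)^*},\qquad c(\alpha)=\frac{(\mathfrak{z}b)(0)}{k^{\alpha\mu}(0,0)}>0 .$$ Notation. $\Omega_+=\{z\in\mathbb{D} : \operatorname{Im}\mathfrak{z}(z)>0\}$, $\ \sigma(z)=\dfrac{1+i\mathfrak{z}(z)}{1-i\mathfrak{z}(z)}$ (so $|\sigma(z)|<1$ for $z\in\Omega_+$), and for every $\alpha\in\widehat{\Gamma}$ $$A^\alpha(z)=\sqrt{\tfrac{c(\alpha)}{2}}\left(\frac{k^{\alpha\mu}(z,0)}{b(z)}+i\,k^\alpha(z,0)\right),\qquad B^\alpha(z)=\sqrt{\tfrac{c(\alpha)}{2}}\left(\frac{k^{\alpha\mu}(z,0)}{b(z)}-i\,k^\alpha(z,0)\right),$$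 and $S_\alpha(z)=B^\alpha(z)/A^\alpha(z)$. The functions $A^{\overline{\beta}\alpha}$ and $S_{\overline{\beta}\alpha}$ are those obtained with the character $\overline{\beta}\alpha$ in place of $\alpha$. *)

theory Defs
  imports "HOL-Complex_Analysis.Complex_Analysis" "HOL-Algebra.Bij"
begin

abbreviation disc :: "complex set" ("\<bbbD>")
  where "\<bbbD> \<equiv> ball 0 1"

section \<open>Fuchsian groups on the disc\<close>

text \<open>
  A Moebius transformation preserving the disc is represented by its restriction to \<open>\<bbbD>\<close>
  (a member of \<^const>\<open>Bij\<close> \<open>\<bbbD>\<close>, extensional outside \<open>\<bbbD>\<close>), because totalised division makes
  the formula \<open>(a z + b) / (c z + d)\<close> on all of \<open>\<complex>\<close> incompatible with composition. A Moebius
  transformation mapping \<open>\<bbbD>\<close> onto itself is determined by this restriction and automatically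
  maps the unit circle and the exterior domain (with \<open>\<infinity>\<close>) onto themselves.
\<close>

definition moebius_coeffs ::
    "complex \<Rightarrow> complex \<Rightarrow> complex \<Rightarrow> complex \<Rightarrow> (complex \<Rightarrow> complex) \<Rightarrow> bool"
  where "moebius_coeffs a b c d \<gamma> \<longleftrightarrow> a * d - b * c \<noteq> 0 \<and>
           (\<forall>z\<in>\<bbbD>. c * z + d \<noteq> 0 \<and> \<gamma> z = (a * z + b) / (c * z + d))"

definition fuchsian_group :: "(complex \<Rightarrow> complex) set \<Rightarrow> bool"
  where "fuchsian_group \<Gamma> \<longleftrightarrow>
           subgroup \<Gamma> (BijGroup \<bbbD>) \<and>
           (\<forall>\<gamma>\<in>\<Gamma>. \<exists>a b c d. moebius_coeffs a b c d \<gamma>) \<and>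
           (\<forall>K. compact K \<and> K \<subseteq> \<bbbD> \<longrightarrow> finite {\<gamma>\<in>\<Gamma>. \<gamma> ` K \<inter> K \<noteq> {}})"

definition elliptic :: "(complex \<Rightarrow> complex) \<Rightarrow> bool"
  where "elliptic \<gamma> \<longleftrightarrow> \<gamma> \<noteq> \<one>\<^bsub>BijGroup \<bbbD>\<^esub> \<and> (\<exists>z\<in>\<bbbD>. \<gamma> z = z)"

text \<open>
  A Moebius transformation is parabolic if it has exactly one fixed point in the Riemann sphere.
  For one that preserves the disc this fixed point lies on the unit circle, whereas the identity,
  elliptic and hyperbolic ones have respectively infinitely many, none and two fixed points there.
\<close>

definition parabolic :: "(complex \<Rightarrow> complex) \<Rightarrow> bool"
  where "parabolic \<gamma> \<longleftrightarrow> (\<exists>a b c d. moebius_coeffs a b c d \<gamma> \<and>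
           (\<exists>!z. cmod z = 1 \<and> a * z + b = z * (c * z + d)))"

definition convergence_type :: "(complex \<Rightarrow> complex) set \<Rightarrow> bool"
  where "convergence_type \<Gamma> \<longleftrightarrow> (\<forall>z\<in>\<bbbD>. (\<lambda>\<gamma>. 1 - (cmod (\<gamma> z))\<^sup>2) summable_on \<Gamma>)"

definition unit_circle_group :: "complex monoid"
  where "unit_circle_group = \<lparr>carrier = sphere 0 1, monoid.mult = (*), one = 1\<rparr>"

definition characters :: "(complex \<Rightarrow> complex) set \<Rightarrow> ((complex \<Rightarrow> complex) \<Rightarrow> complex) set"
  where "characters \<Gamma> = hom ((BijGroup \<bbbD>)\<lparr>carrier := \<Gamma>\<rparr>) unit_circle_group"

definition character_automorphic ::
    "(complex \<Rightarrow> complex) set \<Rightarrow> ((complex \<Rightarrow> complex) \<Rightarrow> complex) \<Rightarrow> (complex \<Rightarrow> complex) \<Rightarrow> bool"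
  where "character_automorphic \<Gamma> \<alpha> f \<longleftrightarrow> (\<forall>\<gamma>\<in>\<Gamma>. \<forall>z\<in>\<bbbD>. f (\<gamma> z) = \<alpha> \<gamma> * f z)"

definition blaschke_factor :: "complex \<Rightarrow> complex \<Rightarrow> complex"
  where "blaschke_factor a z =
           (if a = 0 then z else (a - z) / (1 - cnj a * z) * (of_real (cmod a) / a))"

text \<open>The product over \<open>\<Gamma>\<close> is unordered: the limit of the finite partial products.\<close>

definition green_function :: "(complex \<Rightarrow> complex) set \<Rightarrow> complex \<Rightarrow> complex"
  where "green_function \<Gamma> z =
           Lim (finite_subsets_at_top \<Gamma>) (\<lambda>F. \<Prod>\<gamma>\<in>F. blaschke_factor (\<gamma> 0) z)"

definition circle_mean :: "(complex \<Rightarrow> 'a::real_normed_vector) \<Rightarrow> real \<Rightarrow> 'a"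
  where "circle_mean g r = (1 / (2 * pi)) *\<^sub>R integral {0..2 * pi} (\<lambda>t. g (of_real r * cis t))"

text \<open>
  For a holomorphic function the Nevanlinna characteristic is the circle mean of
  \<open>log\<^sup>+ |f|\<close> (there are no poles to count).
\<close>

definition bounded_characteristic :: "(complex \<Rightarrow> complex) \<Rightarrow> bool"
  where "bounded_characteristic f \<longleftrightarrow> f holomorphic_on \<bbbD> \<and>
           bdd_above (circle_mean (\<lambda>z. ln (max 1 (cmod (f z)))) ` {0..<1})"

definition widom_type :: "(complex \<Rightarrow> complex) set \<Rightarrow> bool"
  where "widom_type \<Gamma> \<longleftrightarrow> bounded_characteristic (deriv (green_function \<Gamma>))"

section \<open>Hardy spaces of character-automorphic functions\<close>

definition hardy2 :: "(complex \<Rightarrow> complex) set"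
  where "hardy2 = {f. f holomorphic_on \<bbbD> \<and>
           bdd_above (circle_mean (\<lambda>z. (cmod (f z))\<^sup>2) ` {0..<1})}"

definition hardy2_norm :: "(complex \<Rightarrow> complex) \<Rightarrow> real"
  where "hardy2_norm f = sqrt (SUP r\<in>{0..<1}. circle_mean (\<lambda>z. (cmod (f z))\<^sup>2) r)"

definition hardy2_inner :: "(complex \<Rightarrow> complex) \<Rightarrow> (complex \<Rightarrow> complex) \<Rightarrow> complex"
  where "hardy2_inner f g = Lim (at_left 1) (circle_mean (\<lambda>z. f z * cnj (g z)))"

definition automorphic_hardy2 ::
    "(complex \<Rightarrow> complex) set \<Rightarrow> ((complex \<Rightarrow> complex) \<Rightarrow> complex) \<Rightarrow> (complex \<Rightarrow> complex) set"
  where "automorphic_hardy2 \<Gamma> \<alpha> = {f \<in> hardy2. character_automorphic \<Gamma> \<alpha> f}"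

definition reproducing_kernel :: "(complex \<Rightarrow> complex) set \<Rightarrow> (complex \<Rightarrow> complex \<Rightarrow> complex) \<Rightarrow> bool"
  where "reproducing_kernel H k \<longleftrightarrow> (\<forall>\<omega>\<in>\<bbbD>. (\<lambda>z. k z \<omega>) \<in> H \<and>
           (\<forall>f\<in>H. hardy2_inner f (\<lambda>z. k z \<omega>) = f \<omega>))"

definition contractive_multiplier ::
    "(complex \<Rightarrow> complex) \<Rightarrow> (complex \<Rightarrow> complex) set \<Rightarrow> (complex \<Rightarrow> complex) set \<Rightarrow> bool"
  where "contractive_multiplier s H H' \<longleftrightarrow>
           (\<forall>f\<in>H. (\<lambda>z. s z * f z) \<in> H' \<and> hardy2_norm (\<lambda>z. s z * f z) \<le> hardy2_norm f)"

section \<open>The covering map\<close>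

text \<open>
  The Riemann sphere is the unit sphere of \<open>\<complex> \<times> \<real>\<close>, with \<open>(0, 1)\<close> as the point at infinity.
  A holomorphic map into it is a meromorphic function, whose (junk) value at a pole is ignored.
\<close>

definition stereographic :: "complex \<Rightarrow> complex \<times> real"
  where "stereographic w =
           (2 * w / of_real ((cmod w)\<^sup>2 + 1), ((cmod w)\<^sup>2 - 1) / ((cmod w)\<^sup>2 + 1))"

definition to_sphere :: "(complex \<Rightarrow> complex) \<Rightarrow> complex \<Rightarrow> complex \<times> real"
  where "to_sphere f z = (if is_pole f z then (0, 1) else stereographic (f z))"

text \<open>\<open>\<bbbD>\<close> being simply connected, a covering map defined on it is universal.\<close>

definition uniformization ::
    "(complex \<Rightarrow> complex) set \<Rightarrow> complex set \<Rightarrow> (complex \<Rightarrow> complex) \<Rightarrow> bool"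
  where "uniformization \<Gamma> E \<zz> \<longleftrightarrow>
           \<zz> nicely_meromorphic_on \<bbbD> \<and>
           covering_space \<bbbD> (to_sphere \<zz>) (sphere 0 1 - stereographic ` E) \<and>
           (\<forall>\<gamma>\<in>\<Gamma>. \<forall>z\<in>\<bbbD>. to_sphere \<zz> (\<gamma> z) = to_sphere \<zz> z) \<and>
           (\<forall>z\<^sub>1\<in>\<bbbD>. \<forall>z\<^sub>2\<in>\<bbbD>. to_sphere \<zz> z\<^sub>1 = to_sphere \<zz> z\<^sub>2 \<longrightarrow> (\<exists>\<gamma>\<in>\<Gamma>. z\<^sub>1 = \<gamma> z\<^sub>2))"

text \<open>\<open>(\<zz> b)(0)\<close>, the value at the removable singularity caused by the pole of \<open>\<zz>\<close> at \<open>0\<close>.\<close>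

definition residue_value :: "(complex \<Rightarrow> complex) set \<Rightarrow> (complex \<Rightarrow> complex) \<Rightarrow> complex"
  where "residue_value \<Gamma> \<zz> = remove_sings (\<lambda>z. \<zz> z * green_function \<Gamma> z) 0"

definition upper_domain :: "(complex \<Rightarrow> complex) \<Rightarrow> complex set"
  where "upper_domain \<zz> = {z \<in> \<bbbD>. \<not> is_pole \<zz> z \<and> Im (\<zz> z) > 0}"

definition cayley :: "(complex \<Rightarrow> complex) \<Rightarrow> complex \<Rightarrow> complex"
  where "cayley \<zz> z = (1 + \<i> * \<zz> z) / (1 - \<i> * \<zz> z)"

section \<open>The kernel representation\<close>

type_synonym char_kernel = "((complex \<Rightarrow> complex) \<Rightarrow> complex) \<Rightarrow> complex \<Rightarrow> complex \<Rightarrow> complex"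

text \<open>
  \<open>\<mu>\<close> is the character of \<open>b\<close>, and \<open>k \<alpha>\<close> the reproducing kernel belonging to \<open>\<alpha>\<close>. The quotient
  defining \<open>c(\<alpha>)\<close> is real and positive under the standing assumptions, hence equals its real part.
\<close>

definition kernel_const ::
    "(complex \<Rightarrow> complex) set \<Rightarrow> ((complex \<Rightarrow> complex) \<Rightarrow> complex) \<Rightarrow> (complex \<Rightarrow> complex) \<Rightarrow>
     char_kernel \<Rightarrow> ((complex \<Rightarrow> complex) \<Rightarrow> complex) \<Rightarrow> real"
  where "kernel_const \<Gamma> \<mu> \<zz> k \<alpha> = Re (residue_value \<Gamma> \<zz> / k (\<lambda>\<gamma>. \<alpha> \<gamma> * \<mu> \<gamma>) 0 0)"

definition kernel_quot ::
    "(complex \<Rightarrow> complex) set \<Rightarrow> ((complex \<Rightarrow> complex) \<Rightarrow> complex) \<Rightarrow> char_kernel \<Rightarrow>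
     ((complex \<Rightarrow> complex) \<Rightarrow> complex) \<Rightarrow> complex \<Rightarrow> complex"
  where "kernel_quot \<Gamma> \<mu> k \<alpha> z = k (\<lambda>\<gamma>. \<alpha> \<gamma> * \<mu> \<gamma>) z 0 / green_function \<Gamma> z"

definition A_fun ::
    "(complex \<Rightarrow> complex) set \<Rightarrow> ((complex \<Rightarrow> complex) \<Rightarrow> complex) \<Rightarrow> (complex \<Rightarrow> complex) \<Rightarrow>
     char_kernel \<Rightarrow> ((complex \<Rightarrow> complex) \<Rightarrow> complex) \<Rightarrow> complex \<Rightarrow> complex"
  where "A_fun \<Gamma> \<mu> \<zz> k \<alpha> z = of_real (sqrt (kernel_const \<Gamma> \<mu> \<zz> k \<alpha> / 2)) *
           (kernel_quot \<Gamma> \<mu> k \<alpha> z + \<i> * k \<alpha> z 0)"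

definition B_fun ::
    "(complex \<Rightarrow> complex) set \<Rightarrow> ((complex \<Rightarrow> complex) \<Rightarrow> complex) \<Rightarrow> (complex \<Rightarrow> complex) \<Rightarrow>
     char_kernel \<Rightarrow> ((complex \<Rightarrow> complex) \<Rightarrow> complex) \<Rightarrow> complex \<Rightarrow> complex"
  where "B_fun \<Gamma> \<mu> \<zz> k \<alpha> z = of_real (sqrt (kernel_const \<Gamma> \<mu> \<zz> k \<alpha> / 2)) *
           (kernel_quot \<Gamma> \<mu> k \<alpha> z - \<i> * k \<alpha> z 0)"

definition S_fun ::
    "(complex \<Rightarrow> complex) set \<Rightarrow> ((complex \<Rightarrow> complex) \<Rightarrow> complex) \<Rightarrow> (complex \<Rightarrow> complex) \<Rightarrow>
     char_kernel \<Rightarrow> ((complex \<Rightarrow> complex) \<Rightarrow> complex) \<Rightarrow> complex \<Rightarrow> complex"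
  where "S_fun \<Gamma> \<mu> \<zz> k \<alpha> z = B_fun \<Gamma> \<mu> \<zz> k \<alpha> z / A_fun \<Gamma> \<mu> \<zz> k \<alpha> z"

text \<open>
  The side conditions of \<open>kernel_formula\<close> only exclude points where the right-hand side is
  a limit rather than a quotient.
\<close>

locale widom_covering =
  fixes \<Gamma> :: "(complex \<Rightarrow> complex) set"
    and \<mu> :: "(complex \<Rightarrow> complex) \<Rightarrow> complex"
    and E :: "complex set"
    and \<zz> :: "complex \<Rightarrow> complex"
    and k :: char_kernel
  assumes fuchsian: "fuchsian_group \<Gamma>"
    and convergence: "convergence_type \<Gamma>"
    and no_elliptic: "\<gamma> \<in> \<Gamma> \<Longrightarrow> \<not> elliptic \<gamma>"
    and no_parabolic: "\<gamma> \<in> \<Gamma> \<Longrightarrow> \<not> parabolic \<gamma>"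
    and widom: "widom_type \<Gamma>"
    and green_character: "\<mu> \<in> characters \<Gamma>" "character_automorphic \<Gamma> \<mu> (green_function \<Gamma>)"
    and covering: "uniformization \<Gamma> E \<zz>"
    and normalized: "residue_value \<Gamma> \<zz> \<in> \<real>" "Re (residue_value \<Gamma> \<zz>) > 0"
    and kernel: "\<alpha> \<in> characters \<Gamma> \<Longrightarrow> reproducing_kernel (automorphic_hardy2 \<Gamma> \<alpha>) (k \<alpha>)"
    and kernel_positive: "\<alpha> \<in> characters \<Gamma> \<Longrightarrow> \<xi> \<in> \<bbbD> \<Longrightarrow> k \<alpha> \<xi> \<xi> \<in> \<real> \<and> Re (k \<alpha> \<xi> \<xi>) > 0"
    and kernel_formula: "\<lbrakk>\<alpha> \<in> characters \<Gamma>; z \<in> \<bbbD>; \<omega> \<in> \<bbbD>; \<not> is_pole \<zz> z; \<not> is_pole \<zz> \<omega>;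
          green_function \<Gamma> z \<noteq> 0; green_function \<Gamma> \<omega> \<noteq> 0; \<zz> z \<noteq> cnj (\<zz> \<omega>)\<rbrakk> \<Longrightarrow>
          k \<alpha> z \<omega> = of_real (kernel_const \<Gamma> \<mu> \<zz> k \<alpha>) *
            (kernel_quot \<Gamma> \<mu> k \<alpha> z * cnj (k \<alpha> \<omega> 0) - cnj (kernel_quot \<Gamma> \<mu> k \<alpha> \<omega>) * k \<alpha> z 0)
            / (\<zz> z - cnj (\<zz> \<omega>))"

section \<open>Matrix Schur functions and equality by meromorphic extension\<close>

definition matrix_schur_function :: "(complex \<Rightarrow> complex^2^2) \<Rightarrow> bool"
  where "matrix_schur_function \<Sigma> \<longleftrightarrow>
           (\<forall>i j. (\<lambda>z. \<Sigma> z $ i $ j) holomorphic_on \<bbbD>) \<and>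
           (\<forall>z\<in>\<bbbD>. \<forall>v. norm (\<Sigma> z *v v) \<le> norm v)"

text \<open>
  \<open>f = g\<close> on \<open>\<bbbD>\<close>, where the expression \<open>g\<close> makes sense only on \<open>\<Omega>\<close> and stands for its meromorphic
  extension elsewhere; meromorphic functions are compared off a discrete set.
\<close>

definition extended_eq :: "complex set \<Rightarrow> (complex \<Rightarrow> complex) \<Rightarrow> (complex \<Rightarrow> complex) \<Rightarrow> bool"
  where "extended_eq \<Omega> f g \<longleftrightarrow> (\<forall>z\<in>\<Omega>. f z = g z) \<and>
           (\<exists>G. G meromorphic_on \<bbbD> \<and> (\<forall>z\<in>\<Omega>. G z = g z) \<and>
                (\<forall>\<^sub>F z in cosparse \<bbbD>. f z = G z))"

end

theory Submission
  imports Defs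
begin

text \<open>
  Write \<open>\<Omega>\<close> for the part of the disc where \<open>Im \<zz> > 0\<close>, \<open>\<delta>\<close> for the character \<open>cnj \<beta> \<alpha>\<close>, and
  \<open>f*\<close> for the conjugate of \<open>f\<close>. Since \<open>s\<close> is holomorphic and \<open>S\<^sub>\<alpha>\<close> meromorphic on the disc, the two
  equations need to be discussed on \<open>\<Omega>\<close> only, and there the theorem is a chain of three equivalences.

  First, multiplication by \<open>s\<close> is a contraction if and only if \<open>k\<^sup>\<alpha>(z,w) - s(z) s(w)* k\<^sup>\<delta>(z,w)\<close> is a
  positive kernel on \<open>\<Omega>\<close> (\<open>contractive_multiplier_imp_positive_kernel\<close> and
  \<open>positive_kernel_imp_multiplier\<close>). That \<open>\<Omega>\<close> is as good as the whole disc is due to the identity theorem;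
  it is nonempty since \<open>\<zz>\<close> has a pole at \<open>0\<close>.

  Second, the kernel formula says that on \<open>\<Omega>\<close>, up to a factor \<open>g(z) g(w)*\<close> with \<open>g\<close> nonvanishing,
  \<open>k\<^sup>\<alpha>\<close> is \<open>A\<^sub>\<alpha>(z) A\<^sub>\<alpha>(w)* (1 - S\<^sub>\<alpha>(z) S\<^sub>\<alpha>(w)*) / (1 - \<sigma>(z) \<sigma>(w)*)\<close>, with the same \<open>g\<close> for all
  characters. With \<open>\<phi> = s A\<^sub>\<delta> / A\<^sub>\<alpha>\<close>, \<open>u = (1, \<phi> S\<^sub>\<delta>)\<close> and \<open>v = (S\<^sub>\<alpha>, \<phi>)\<close>, positivity of the difference
  above therefore means positivity of \<open>(u(z) u(w)* - v(z) v(w)*) / (1 - \<sigma>(z) \<sigma>(w)*)\<close>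
  (\<open>multiplier_kernel_factorization\<close>). These manipulations require that \<open>b\<close> does not vanish on \<open>\<Omega>\<close>, which
  follows from the convergence of the Blaschke product.

  Third, by the tangential Nevanlinna-Pick theorem this kernel is positive if and only if
  \<open>u(z) \<Sigma>(\<sigma>(z)) = v(z)\<close> on \<open>\<Omega>\<close> for some Schur function \<open>\<Sigma>\<close> (\<open>tangential_interpolation\<close> and
  \<open>tangential_interpolation_necessary\<close>). Written out, this is \<open>\<Sigma>\<^sub>1\<^sub>1 + \<phi> S\<^sub>\<delta> \<Sigma>\<^sub>2\<^sub>1 = S\<^sub>\<alpha>\<close> and
  \<open>\<Sigma>\<^sub>1\<^sub>2 + \<phi> S\<^sub>\<delta> \<Sigma>\<^sub>2\<^sub>2 = \<phi>\<close>; the second equation determines \<open>\<phi>\<close>, hence \<open>s\<close>, and substituting \<open>\<phi>\<close> into the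
  first gives the formula for \<open>S\<^sub>\<alpha>\<close>.

  Both existence statements, that of \<open>\<Sigma>\<close> and that of the product \<open>s f\<close> in the Hardy space, are obtained in
  the same way: an explicit regularized solution at finitely many points, followed by a normal
  families argument along a dense sequence.
\<close>

(* The coefficient notation for power series would make every matrix entry ambiguous. *)
no_notation fps_nth (infixl \<open>$\<close> 75)

section \<open>Sesquilinear forms and positive kernels\<close>

definition sesq ::
    "'i set \<Rightarrow> ('i \<Rightarrow> 'i \<Rightarrow> complex) \<Rightarrow> ('i \<Rightarrow> complex) \<Rightarrow> ('i \<Rightarrow> complex) \<Rightarrow> complex"
  where "sesq I H c d = (\<Sum>i\<in>I. \<Sum>j\<in>I. cnj (c i) * H i j * d j)"

definition positive_kernel :: "'a set \<Rightarrow> ('a \<Rightarrow> 'a \<Rightarrow> complex) \<Rightarrow> bool"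
  where "positive_kernel X K \<longleftrightarrow> (\<forall>F c. finite F \<and> F \<subseteq> X \<longrightarrow> 0 \<le> Re (sesq F K c c))"

lemma sesq_add: "sesq I (\<lambda>i j. G i j + H i j) c d = sesq I G c d + sesq I H c d"
  by (simp add: sesq_def algebra_simps sum.distrib)

lemma sesq_scale: "sesq F (\<lambda>z w. s z * cnj (s w) * K z w) c c = sesq F K (\<lambda>w. c w * cnj (s w)) (\<lambda>w. c w * cnj (s w))"
  unfolding sesq_def by (simp only: complex_cnj_mult complex_cnj_cnj mult_ac)

lemma sesq_diff: "sesq I (\<lambda>i j. G i j - H i j) c d = sesq I G c d - sesq I H c d"
  by (simp add: sesq_def algebra_simps sum_subtractf)

lemma sesq_delta:
  assumes "finite I"
  shows "sesq I (\<lambda>i j. if i = j then e i else 0) c d = (\<Sum>i\<in>I. e i * cnj (c i) * d i)"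
proof -
  have "sesq I (\<lambda>i j. if i = j then e i else 0) c d =
      (\<Sum>i\<in>I. \<Sum>j\<in>I. if i = j then cnj (c i) * e i * d i else 0)"
    unfolding sesq_def by (intro sum.cong refl) auto
  also have "\<dots> = (\<Sum>i\<in>I. cnj (c i) * e i * d i)"
    using assms by (intro sum.cong refl) (simp add: sum.delta)
  finally show ?thesis by (simp add: mult_ac)
qed

lemma sesq_rank_one:
  "sesq I (\<lambda>i j. f i * cnj (g j)) c d = cnj (\<Sum>i\<in>I. cnj (f i) * c i) * (\<Sum>j\<in>I. cnj (g j) * d j)"
proof -
  have "cnj (\<Sum>i\<in>I. cnj (f i) * c i) * (\<Sum>j\<in>I. cnj (g j) * d j) =
      (\<Sum>i\<in>I. f i * cnj (c i)) * (\<Sum>j\<in>I. cnj (g j) * d j)"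
    by simp
  also have "\<dots> = sesq I (\<lambda>i j. f i * cnj (g j)) c d"
    unfolding sesq_def sum_product by (simp only: mult_ac)
  finally show ?thesis ..
qed

lemma sesq_sum: "sesq I (\<lambda>i j. \<Sum>l\<in>L. H l i j) c d = (\<Sum>l\<in>L. sesq I (H l) c d)"
proof -
  have "sesq I (\<lambda>i j. \<Sum>l\<in>L. H l i j) c d = (\<Sum>i\<in>I. \<Sum>l\<in>L. \<Sum>j\<in>I. cnj (c i) * H l i j * d j)"
    unfolding sesq_def
    by (intro sum.cong refl, subst sum.swap) (simp add: sum_distrib_left sum_distrib_right)
  also have "\<dots> = (\<Sum>l\<in>L. sesq I (H l) c d)"
    unfolding sesq_def by (rule sum.swap)
  finally show ?thesis .
qed

text \<open>
  This is where positivity of Gram matrices enters: a sum of rank one forms is a sum of squares.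
\<close>

lemma sesq_gram:
  "sesq I (\<lambda>i j. \<Sum>l\<in>L. f i l * cnj (f j l)) c c =
     of_real (\<Sum>l\<in>L. (cmod (\<Sum>i\<in>I. cnj (f i l) * c i))\<^sup>2)"
  unfolding sesq_sum sesq_rank_one of_real_sum complex_norm_square
  by (simp only: mult.commute)

lemma positive_kernel_congruence:
  assumes K: "positive_kernel X K"
    and L: "\<And>z w. z \<in> X \<Longrightarrow> w \<in> X \<Longrightarrow> L z w = g z * cnj (g w) * K z w"
  shows "positive_kernel X L"
  unfolding positive_kernel_def
proof (intro allI impI, elim conjE)
  fix F c assume F: "finite F" "F \<subseteq> X"
  have "sesq F L c c = sesq F (\<lambda>z w. g z * cnj (g w) * K z w) c c"
    unfolding sesq_def using F(2) by (intro sum.cong refl) (simp add: L subset_iff)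
  also have "\<dots> = sesq F K (\<lambda>w. c w * cnj (g w)) (\<lambda>w. c w * cnj (g w))" by (rule sesq_scale)
  finally show "0 \<le> Re (sesq F L c c)" using K F unfolding positive_kernel_def by auto
qed

lemma positive_kernel_subset: "positive_kernel Y K \<Longrightarrow> X \<subseteq> Y \<Longrightarrow> positive_kernel X K"
  unfolding positive_kernel_def by blast

text \<open>
  Expand the form at \<open>c - t d\<close>. This weak form of the
  Cauchy-Schwarz inequality makes the estimates below linear in the squared norms.
\<close>

lemma sesq_amgm:
  assumes herm: "\<And>i j. i \<in> I \<Longrightarrow> j \<in> I \<Longrightarrow> H j i = cnj (H i j)"
    and psd: "\<And>c. 0 \<le> Re (sesq I H c c)"
  shows "2 * Re (t * sesq I H c d) \<le> Re (sesq I H c c) + (cmod t)\<^sup>2 * Re (sesq I H d d)"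
proof -
  have swap: "sesq I H d c = cnj (sesq I H c d)"
  proof -
    have "sesq I H d c = (\<Sum>j\<in>I. \<Sum>i\<in>I. cnj (d i) * H i j * c j)"
      unfolding sesq_def by (rule sum.swap)
    also have "\<dots> = (\<Sum>j\<in>I. \<Sum>i\<in>I. cnj (cnj (c j) * H j i * d i))"
    proof (intro sum.cong refl)
      fix i j assume "j \<in> I" "i \<in> I"
      then have "H i j = cnj (H j i)" by (intro herm)
      then show "cnj (d i) * H i j * c j = cnj (cnj (c j) * H j i * d i)" by simp
    qed
    finally show ?thesis by (simp add: sesq_def)
  qed
  have "sesq I H (\<lambda>i. c i - t * d i) (\<lambda>i. c i - t * d i) =
      sesq I H c c - t * sesq I H c d - cnj t * sesq I H d c + t * cnj t * sesq I H d d"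
    by (simp add: sesq_def algebra_simps sum.distrib sum_subtractf sum_distrib_left)
  also have "\<dots> = sesq I H c c - (t * sesq I H c d + cnj (t * sesq I H c d))
      + of_real ((cmod t)\<^sup>2) * sesq I H d d"
    by (simp add: swap complex_norm_square flip: of_real_power)
  finally have "Re (sesq I H (\<lambda>i. c i - t * d i) (\<lambda>i. c i - t * d i)) =
      Re (sesq I H c c) - 2 * Re (t * sesq I H c d) + (cmod t)\<^sup>2 * Re (sesq I H d d)"
    by (simp add: complex_add_cnj del: complex_cnj_mult) 
  with psd[of "\<lambda>i. c i - t * d i"] show ?thesis by simp
qed

text \<open>
  Gaussian elimination, by induction on the number of unknowns. Positivity of the real part makes the
  pivot nonzero and passes to the Schur complement, since a vector can be completed by an entry that
  makes the pivot row vanish. All operations are rational, so the solution depends holomorphically on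
  the parameter.
\<close>

lemma holomorphic_accretive_solution:
  fixes M :: "'i \<Rightarrow> 'i \<Rightarrow> complex \<Rightarrow> complex"
  assumes "finite I"
    and "\<And>i j. i \<in> I \<Longrightarrow> j \<in> I \<Longrightarrow> M i j holomorphic_on S"
    and "\<And>i. i \<in> I \<Longrightarrow> r i holomorphic_on S"
    and "\<And>x c. x \<in> S \<Longrightarrow> (\<exists>i\<in>I. c i \<noteq> 0) \<Longrightarrow> 0 < Re (sesq I (\<lambda>i j. M i j x) c c)"
  shows "\<exists>f. (\<forall>i\<in>I. f i holomorphic_on S) \<and> (\<forall>x\<in>S. \<forall>i\<in>I. (\<Sum>j\<in>I. M i j x * f j x) = r i x)"
  using assms
proof (induction I arbitrary: M r rule: finite_induct)
  case empty
  then show ?case by auto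
next
  case (insert a I)
  have pivot: "M a a x \<noteq> 0" if "x \<in> S" for x
  proof -
    have "0 < Re (sesq (insert a I) (\<lambda>i j. M i j x) (\<lambda>i. if i = a then 1 else 0) (\<lambda>i. if i = a then 1 else 0))"
      by (rule insert.prems(3)[OF that]) auto
    also have "sesq (insert a I) (\<lambda>i j. M i j x) (\<lambda>i. if i = a then 1 else 0) (\<lambda>i. if i = a then 1 else 0)
        = M a a x"
    proof -
      have [simp]: "(\<Sum>i\<in>I. cnj (if i = a then 1 else 0) * h i) = 0"
        "(\<Sum>i\<in>I. h i * (if i = a then 1 else 0)) = 0" for h :: "'i \<Rightarrow> complex"
        using insert.hyps by (auto intro!: sum.neutral)
      show ?thesis using insert.hyps by (simp add: sesq_def mult.assoc flip: sum_distrib_left)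
    qed
    finally show ?thesis by auto
  qed
  define M' where "M' i j x = M i j x - M i a x * M a j x / M a a x" for i j x
  define r' where "r' i x = r i x - M i a x * r a x / M a a x" for i x
  have "\<exists>f. (\<forall>i\<in>I. f i holomorphic_on S) \<and> (\<forall>x\<in>S. \<forall>i\<in>I. (\<Sum>j\<in>I. M' i j x * f j x) = r' i x)"
  proof (rule insert.IH)
    show "M' i j holomorphic_on S" if "i \<in> I" "j \<in> I" for i j
      unfolding M'_def using that pivot by (intro holomorphic_intros insert.prems) auto
    show "r' i holomorphic_on S" if "i \<in> I" for i
      unfolding r'_def using that pivot by (intro holomorphic_intros insert.prems) auto
    fix x and c :: "'i \<Rightarrow> complex" assume x: "x \<in> S" and c: "\<exists>i\<in>I. c i \<noteq> 0"
    \<comment> \<open>the entry at \<open>a\<close> that makes row \<open>a\<close> vanish\<close>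
    define c' where "c' = c(a := - (\<Sum>j\<in>I. M a j x * c j) / M a a x)"
    have c'I: "c' i = c i" if "i \<in> I" for i using that insert.hyps by (auto simp: c'_def)
    have row: "(\<Sum>j\<in>insert a I. M i j x * c' j) = (\<Sum>j\<in>I. M' i j x * c j)" for i
    proof -
      have "(\<Sum>j\<in>insert a I. M i j x * c' j) = M i a x * c' a + (\<Sum>j\<in>I. M i j x * c j)"
        using insert.hyps by (simp add: c'I)
      also have "\<dots> = (\<Sum>j\<in>I. M' i j x * c j)"
        using pivot[OF x]
        by (simp add: c'_def M'_def algebra_simps sum_subtractf sum_distrib_left sum_divide_distrib)
      finally show ?thesis .
    qed
    have row_a: "(\<Sum>j\<in>I. M' a j x * c j) = 0" using pivot[OF x] by (simp add: M'_def)
    have "0 < Re (sesq (insert a I) (\<lambda>i j. M i j x) c' c')"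
      using c c'I by (intro insert.prems(3)[OF x]) (metis insertCI)
    also have "sesq (insert a I) (\<lambda>i j. M i j x) c' c' = 
        (\<Sum>i\<in>insert a I. cnj (c' i) * (\<Sum>j\<in>insert a I. M i j x * c' j))"
      unfolding sesq_def by (simp only: sum_distrib_left mult.assoc)
    also have "\<dots> = (\<Sum>i\<in>insert a I. cnj (c' i) * (\<Sum>j\<in>I. M' i j x * c j))"
      unfolding row ..
    also have "\<dots> = (\<Sum>i\<in>I. cnj (c i) * (\<Sum>j\<in>I. M' i j x * c j))"
      using insert.hyps by (simp add: row_a c'I)
    also have "\<dots> = sesq I (\<lambda>i j. M' i j x) c c"
      unfolding sesq_def by (simp only: sum_distrib_left mult.assoc)
    finally show "0 < Re (sesq I (\<lambda>i j. M' i j x) c c)" .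
  qed
  then obtain f where f: "\<And>i. i \<in> I \<Longrightarrow> f i holomorphic_on S"
    and eq: "\<And>x i. x \<in> S \<Longrightarrow> i \<in> I \<Longrightarrow> (\<Sum>j\<in>I. M' i j x * f j x) = r' i x" by blast
  define g where "g = f(a := \<lambda>x. (r a x - (\<Sum>j\<in>I. M a j x * f j x)) / M a a x)"
  have gI: "g i = f i" if "i \<in> I" for i using that insert.hyps by (auto simp: g_def)
  have ga: "g a x = (r a x - (\<Sum>j\<in>I. M a j x * f j x)) / M a a x" for x by (simp add: g_def)
  show ?case
  proof (intro exI[of _ g] conjI ballI)
    show "g i holomorphic_on S" if "i \<in> insert a I" for i
    proof (cases "i = a")
      case True
      then show ?thesis unfolding g_def fun_upd_same True using pivot
        by (auto intro!: holomorphic_intros insert.prems f)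
    next
      case False then show ?thesis using that f gI by simp
    qed
    fix x i assume x: "x \<in> S" and i: "i \<in> insert a I"
    have split: "(\<Sum>j\<in>insert a I. M i j x * g j x) = M i a x * g a x + (\<Sum>j\<in>I. M i j x * f j x)"
      using insert.hyps by (simp add: gI)
    show "(\<Sum>j\<in>insert a I. M i j x * g j x) = r i x"
    proof (cases "i = a")
      case True then show ?thesis unfolding split ga using pivot[OF x] by simp
    next
      case False
      then have "i \<in> I" using i by simp
      from eq[OF x this] have "(\<Sum>j\<in>I. M i j x * f j x) =
          r i x - M i a x * r a x / M a a x + M i a x * (\<Sum>j\<in>I. M a j x * f j x) / M a a x"
        by (simp add: M'_def r'_def algebra_simps sum_subtractf sum_distrib_left sum_divide_distrib)
      then show ?thesis unfolding split ga using pivot[OF x] by (simp add: field_simps)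
    qed
  qed
qed

section \<open>Tangential Nevanlinna-Pick interpolation\<close>

definition pick_kernel ::
    "('a \<Rightarrow> complex) \<Rightarrow> ('a \<Rightarrow> complex^2) \<Rightarrow> ('a \<Rightarrow> complex^2) \<Rightarrow> 'a \<Rightarrow> 'a \<Rightarrow> complex"
  where "pick_kernel \<zeta> u v z w =
           ((\<Sum>l\<in>UNIV. u z $ l * cnj (u w $ l)) - (\<Sum>l\<in>UNIV. v z $ l * cnj (v w $ l)))
           / (1 - \<zeta> z * cnj (\<zeta> w))"

lemma norm_vec2_sq: "(norm (x :: complex^2))\<^sup>2 = (\<Sum>l\<in>UNIV. (cmod (x $ l))\<^sup>2)"
  by (simp add: norm_vec_def L2_set_def sum_nonneg)

text \<open>
  Interpolation at finitely many points, up to an error. Write \<open>Z\<close> for the diagonal matrix of the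
  \<open>\<zeta> i\<close>, \<open>U\<close> and \<open>V\<close> for the matrices with rows \<open>u i\<close> and \<open>v i\<close>, and \<open>P\<close> for the Pick matrix, which
  solves the Stein equation \<open>P - Z P Z* = U U* - V V*\<close>. With \<open>H = P + \<epsilon>\<close> the function
  \<open>\<Sigma>(x) = U* (H + V V* - x H Z*)\<^sup>-\<^sup>1 V\<close>
  is the transfer function of the lurking isometry that the Stein equation provides. Row \<open>i\<close> of
  \<open>H + V V* - \<zeta> i H Z*\<close> is row \<open>i\<close> of \<open>U U*\<close> up to a diagonal term of order \<open>\<epsilon>\<close>, which gives
  \<open>u i \<Sigma>(\<zeta> i) = v i\<close> approximately. The shift by \<open>\<epsilon>\<close> makes the matrix invertible even if the
  Pick matrix is singular.
\<close>

lemma approximate_tangential_interpolation: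
  fixes \<zeta> :: "'i \<Rightarrow> complex" and u v :: "'i \<Rightarrow> complex^2"
  assumes fin: "finite I" and \<zeta>: "\<And>i. i \<in> I \<Longrightarrow> cmod (\<zeta> i) < 1"
    and psd: "\<And>c. 0 \<le> Re (sesq I (pick_kernel \<zeta> u v) c c)"
    and \<epsilon>: "0 < \<epsilon>"
  shows "\<exists>\<Sigma>. matrix_schur_function \<Sigma> \<and>
           (\<forall>i\<in>I. \<forall>m. (cmod ((u i v* \<Sigma> (\<zeta> i)) $ m - v i $ m))\<^sup>2 \<le> \<epsilon>)"
proof -
  define P where "P = pick_kernel \<zeta> u v"
  define H where "H i j = P i j + (if i = j then of_real \<epsilon> else 0)" for i j
  define uu vv where "uu i j = (\<Sum>l\<in>UNIV. u i $ l * cnj (u j $ l))"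
    and "vv i j = (\<Sum>l\<in>UNIV. v i $ l * cnj (v j $ l))" for i j
  define D :: "'i \<Rightarrow> complex" where "D i = of_real (\<epsilon> * (1 - (cmod (\<zeta> i))\<^sup>2))" for i
  define M where "M i j x = (H i j + vv i j) - x * (H i j * cnj (\<zeta> j))" for i j x
  define Z where "Z c i = cnj (\<zeta> i) * c i" for c :: "'i \<Rightarrow> complex" and i
  define U where "U c l = (\<Sum>i\<in>I. cnj (u i $ l) * c i)" for c :: "'i \<Rightarrow> complex" and l :: 2
  define V where "V c l = (\<Sum>i\<in>I. cnj (v i $ l) * c i)" for c :: "'i \<Rightarrow> complex" and l :: 2
  define nH where "nH c = Re (sesq I H c c)" for c
  define nD where "nD c = (\<Sum>i\<in>I. \<epsilon> * (1 - (cmod (\<zeta> i))\<^sup>2) * (cmod (c i))\<^sup>2)" for c :: "'i \<Rightarrow> complex"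
  have ne1: "1 - \<zeta> i * cnj (\<zeta> j) \<noteq> 0" if "i \<in> I" "j \<in> I" for i j
  proof -
    have "cmod (\<zeta> i * cnj (\<zeta> j)) < 1 * 1"
      unfolding norm_mult complex_mod_cnj using \<zeta>[OF that(1)] \<zeta>[OF that(2)]
      by (intro mult_strict_mono') auto
    then show ?thesis by auto
  qed
  have herm: "H j i = cnj (H i j)" for i j
    by (auto simp: H_def P_def pick_kernel_def mult.commute)
  have nH: "nH c = Re (sesq I P c c) + \<epsilon> * (\<Sum>i\<in>I. (cmod (c i))\<^sup>2)" for c
  proof -
    have "sesq I H c c = sesq I P c c + (\<Sum>i\<in>I. of_real \<epsilon> * cnj (c i) * c i)"
      unfolding H_def sesq_add using sesq_delta[OF fin, of "\<lambda>_. of_real \<epsilon>"] by simp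
    also have "(\<Sum>i\<in>I. of_real \<epsilon> * cnj (c i) * c i) = of_real (\<epsilon> * (\<Sum>i\<in>I. (cmod (c i))\<^sup>2))"
      unfolding of_real_mult of_real_sum complex_norm_square by (simp add: sum_distrib_left mult_ac)
    finally show ?thesis by (simp add: nH_def)
  qed
  have psdH: "0 \<le> Re (sesq I H c c)" for c
    using psd[of c] \<epsilon> unfolding nH[unfolded nH_def] P_def[symmetric] 
    by (simp add: sum_nonneg)
  have stein: "H i j + vv i j = \<zeta> i * H i j * cnj (\<zeta> j) + uu i j + (if i = j then D i else 0)"
    if "i \<in> I" "j \<in> I" for i j
  proof -
    have "P i j * (1 - \<zeta> i * cnj (\<zeta> j)) = uu i j - vv i j"
      using ne1[OF that] by (simp add: P_def pick_kernel_def uu_def vv_def)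
    then have "P i j + vv i j = \<zeta> i * P i j * cnj (\<zeta> j) + uu i j"
      by (simp add: algebra_simps)
    then show ?thesis
      by (auto simp: H_def D_def algebra_simps complex_norm_square[of "\<zeta> j"] simp flip: of_real_power)
  qed
  have gramV: "sesq I vv c c = of_real (\<Sum>l\<in>UNIV. (cmod (V c l))\<^sup>2)" for c
    unfolding vv_def V_def by (rule sesq_gram)
  have gramU: "sesq I uu c c = of_real (\<Sum>l\<in>UNIV. (cmod (U c l))\<^sup>2)" for c
    unfolding uu_def U_def by (rule sesq_gram)
  define q where "q c = nH c + (\<Sum>l\<in>UNIV. (cmod (V c l))\<^sup>2)" for c
  \<comment> \<open>the Stein equation as an identity of quadratic forms\<close>
  have q: "q c = nH (Z c) + (\<Sum>l\<in>UNIV. (cmod (U c l))\<^sup>2) + nD c" for c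
  proof -
    have "sesq I H c c + sesq I vv c c =
        sesq I (\<lambda>i j. \<zeta> i * H i j * cnj (\<zeta> j) + uu i j + (if i = j then D i else 0)) c c"
      unfolding sesq_add[symmetric] unfolding sesq_def
      by (intro sum.cong refl) (simp add: stein)
    also have "\<dots> = sesq I (\<lambda>i j. \<zeta> i * H i j * cnj (\<zeta> j)) c c + sesq I uu c c
        + (\<Sum>i\<in>I. D i * cnj (c i) * c i)"
      unfolding sesq_add sesq_delta[OF fin] ..
    also have "sesq I (\<lambda>i j. \<zeta> i * H i j * cnj (\<zeta> j)) c c = sesq I H (Z c) (Z c)"
      unfolding sesq_def Z_def by (intro sum.cong refl) simp
    also have "(\<Sum>i\<in>I. D i * cnj (c i) * c i) = of_real (nD c)"
      unfolding nD_def D_def of_real_sum of_real_mult complex_norm_square by (simp add: mult_ac)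
    finally show ?thesis unfolding gramU gramV
      by (auto simp: q_def nH_def dest!: arg_cong[of _ _ Re])
  qed
  have le1: "(cmod (\<zeta> i))\<^sup>2 \<le> 1" if "i \<in> I" for i
    using \<zeta>[OF that] by (intro power_le_one) auto
  have nD: "0 \<le> nD c" for c
    unfolding nD_def using \<epsilon> le1 by (intro sum_nonneg mult_nonneg_nonneg) auto
  have nZ: "0 \<le> nH c" for c
    unfolding nH_def by (rule psdH)
  have formM: "Re (sesq I (\<lambda>i j. M i j x) c c) = q c - Re (x * sesq I H c (Z c))" for x c
  proof -
    have "sesq I (\<lambda>i j. M i j x) c c = sesq I H c c + sesq I vv c c - x * sesq I H c (Z c)"
      unfolding M_def Z_def sesq_def
      by (simp add: algebra_simps sum.distrib sum_subtractf sum_distrib_left)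
    then show ?thesis by (simp add: gramV q_def nH_def)
  qed
  have cross: "2 * Re (x * sesq I H c (Z c)) \<le> nH c + (cmod x)\<^sup>2 * nH (Z c)" for x c
    unfolding nH_def by (intro sesq_amgm herm psdH)
  have accretive: "0 < Re (sesq I (\<lambda>i j. M i j x) c c)" if x: "x \<in> \<bbbD>" and c: "\<exists>i\<in>I. c i \<noteq> 0" for x c
  proof -
    have "0 < (\<Sum>i\<in>I. (cmod (c i))\<^sup>2)" using c fin by (auto intro!: sum_pos2)
    then have "0 < nH c" using psd[of c] \<epsilon> unfolding nH P_def[symmetric] by (simp add: add_nonneg_pos)
    moreover have "nH c \<le> q c" "nH (Z c) \<le> q c"
      by (simp_all add: q_def sum_nonneg) (simp add: q[unfolded q_def] nD sum_nonneg)
    moreover have "(cmod x)\<^sup>2 < 1" using x by (simp add: power_less_one_iff)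
    ultimately have "(cmod x)\<^sup>2 * nH (Z c) < q c"
      using nZ[of "Z c"] by (smt (verit) mult_left_le_one_le mult_strict_right_mono zero_le_power2)
    with cross[of x c] \<open>nH c \<le> q c\<close> show ?thesis unfolding formM by linarith
  qed
  have "\<exists>f. (\<forall>i\<in>I. f i holomorphic_on \<bbbD>) \<and> (\<forall>x\<in>\<bbbD>. \<forall>i\<in>I. (\<Sum>j\<in>I. M i j x * f j x) = v i $ m)" for m
    using accretive fin
    by (intro holomorphic_accretive_solution) (auto simp: M_def intro!: holomorphic_intros)
  then obtain f where holf: "\<And>m i. i \<in> I \<Longrightarrow> f m i holomorphic_on \<bbbD>"
    and feq: "\<And>m x i. x \<in> \<bbbD> \<Longrightarrow> i \<in> I \<Longrightarrow> (\<Sum>j\<in>I. M i j x * f m j x) = v i $ m"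
    by metis
  define \<Sigma> :: "complex \<Rightarrow> complex^2^2" where "\<Sigma> x = (\<chi> l m. U (\<lambda>i. f m i x) l)" for x
  define C where "C y x i = (\<Sum>m\<in>UNIV. y $ m * f m i x)" for y :: "complex^2" and x i
  have \<Sigma>_mult: "(\<Sigma> x *v y) $ l = U (C y x) l" for x y l
    unfolding matrix_vector_mult_def \<Sigma>_def U_def C_def
    by (simp add: sum_distrib_left sum_distrib_right mult_ac) (rule sum.swap)
  \<comment> \<open>the energy balance of the colligation\<close>
  have energy: "nH (Z (C y x)) + (norm (\<Sigma> x *v y))\<^sup>2 + nD (C y x) \<le> (cmod x)\<^sup>2 * nH (Z (C y x)) + (norm y)\<^sup>2"
    if x: "x \<in> \<bbbD>" for x y
  proof -
    let ?c = "C y x"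
    have MC: "(\<Sum>j\<in>I. M i j x * ?c j) = (\<Sum>m\<in>UNIV. v i $ m * y $ m)" if "i \<in> I" for i
    proof -
      have "(\<Sum>j\<in>I. M i j x * ?c j) = (\<Sum>m\<in>UNIV. y $ m * (\<Sum>j\<in>I. M i j x * f m j x))"
        unfolding C_def by (simp add: sum_distrib_left mult_ac) (rule sum.swap)
      then show ?thesis using feq[OF x that] by (simp add: mult.commute)
    qed
    have "sesq I (\<lambda>i j. M i j x) ?c ?c = (\<Sum>i\<in>I. cnj (?c i) * (\<Sum>j\<in>I. M i j x * ?c j))"
      unfolding sesq_def by (simp only: sum_distrib_left mult.assoc)
    also have "\<dots> = (\<Sum>i\<in>I. \<Sum>m\<in>UNIV. cnj (?c i) * (v i $ m * y $ m))"
      by (simp add: MC sum_distrib_left)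
    also have "\<dots> = (\<Sum>m\<in>UNIV. cnj (V ?c m) * y $ m)"
      unfolding V_def by (subst sum.swap) (simp add: sum_distrib_left sum_distrib_right mult_ac)
    finally have "q ?c = Re (x * sesq I H ?c (Z ?c)) + (\<Sum>m\<in>UNIV. Re (cnj (V ?c m) * y $ m))"
      using formM[of x ?c] by simp
    moreover have "2 * (\<Sum>m\<in>UNIV. Re (cnj (V ?c m) * y $ m)) \<le>
        (\<Sum>m\<in>UNIV. (cmod (V ?c m))\<^sup>2) + (norm y)\<^sup>2"
    proof -
      have "2 * Re (cnj a * b) \<le> (cmod a)\<^sup>2 + (cmod b)\<^sup>2" for a b
        using zero_le_power2[of "Re a - Re b"] zero_le_power2[of "Im a - Im b"]
        by (simp add: cmod_power2 power2_diff)
      then show ?thesis unfolding norm_vec2_sq sum_distrib_left sum.distrib[symmetric]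
        by (intro sum_mono)
    qed
    moreover note cross[of x ?c]
    ultimately have "q ?c \<le> (cmod x)\<^sup>2 * nH (Z ?c) + (norm y)\<^sup>2" unfolding q_def by linarith
    then show ?thesis unfolding q norm_vec2_sq \<Sigma>_mult .
  qed
  have less: "(cmod x)\<^sup>2 * nH c \<le> nH c" if "x \<in> \<bbbD>" for x c
    using that nZ[of c] by (intro mult_left_le_one_le) (auto simp: power_le_one)
  have "matrix_schur_function \<Sigma>"
    unfolding matrix_schur_function_def
  proof (intro conjI allI ballI)
    show "(\<lambda>z. \<Sigma> z $ l $ m) holomorphic_on \<bbbD>" for l m
      unfolding \<Sigma>_def U_def by (auto intro!: holomorphic_intros holf)
    fix x :: complex and y :: "complex^2" assume x: "x \<in> \<bbbD>"
    have "(norm (\<Sigma> x *v y))\<^sup>2 \<le> (norm y)\<^sup>2"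
      using energy[OF x, of y] less[OF x, of "Z (C y x)"] nD[of "C y x"] by linarith
    then show "norm (\<Sigma> x *v y) \<le> norm y" by (simp add: power2_le_iff_abs_le)
  qed
  moreover have "(cmod ((u i v* \<Sigma> (\<zeta> i)) $ m - v i $ m))\<^sup>2 \<le> \<epsilon>" if i: "i \<in> I" for i m
  proof -
    let ?x = "\<zeta> i" and ?e = "\<epsilon> * (1 - (cmod (\<zeta> i))\<^sup>2)"
    have x: "?x \<in> \<bbbD>" using \<zeta>[OF i] by simp
    have "(u i v* \<Sigma> ?x) $ m = (\<Sum>l\<in>UNIV. \<Sum>j\<in>I. u i $ l * cnj (u j $ l) * f m j ?x)"
      unfolding vector_matrix_mult_def \<Sigma>_def U_def by (simp add: sum_distrib_left mult_ac)
    also have "\<dots> = (\<Sum>j\<in>I. uu i j * f m j ?x)"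
      unfolding uu_def by (subst sum.swap) (simp add: sum_distrib_right)
    also have "\<dots> = (\<Sum>j\<in>I. M i j ?x * f m j ?x - (if j = i then D i * f m i ?x else 0))"
    proof (intro sum.cong refl)
      fix j assume "j \<in> I"
      show "uu i j * f m j ?x = M i j ?x * f m j ?x - (if j = i then D i * f m i ?x else 0)"
        unfolding M_def stein[OF i \<open>j \<in> I\<close>] by (auto simp: algebra_simps)
    qed
    also have "\<dots> = v i $ m - D i * f m i ?x"
      using fin i by (simp add: sum_subtractf feq[OF x i] sum.delta)
    finally have "(cmod ((u i v* \<Sigma> ?x) $ m - v i $ m))\<^sup>2 = (cmod (D i * f m i ?x))\<^sup>2"
      by simp
    also have "\<dots> = ?e * (?e * (cmod (f m i ?x))\<^sup>2)"
      unfolding D_def norm_mult norm_of_real by (simp add: power2_eq_square power_mult_distrib) 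
    also have "\<dots> \<le> \<epsilon> * 1"
    proof (rule mult_mono)
      show "?e \<le> \<epsilon>" using \<epsilon> by (simp add: mult_left_le)
      show "0 \<le> ?e * (cmod (f m i ?x))\<^sup>2" using le1[OF i] \<epsilon> by simp
      have C: "C (axis m 1) ?x = (\<lambda>i. f m i ?x)"
        unfolding C_def axis_def by (auto simp: if_distrib[of "\<lambda>x. x * _"] cong: if_cong)
      have "?e * (cmod (f m i ?x))\<^sup>2 \<le> nD (\<lambda>i. f m i ?x)"
        unfolding nD_def using fin i \<epsilon> le1
        by (intro member_le_sum[of i I "\<lambda>i. \<epsilon> * (1 - (cmod (\<zeta> i))\<^sup>2) * (cmod (f m i ?x))\<^sup>2"])
           auto
      also have "\<dots> \<le> (norm (axis m 1 :: complex^2))\<^sup>2"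
        using energy[OF x, of "axis m 1"] less[OF x, of "Z (C (axis m 1) ?x)"]
          zero_le_power2[of "norm (\<Sigma> ?x *v axis m 1)"] unfolding C by linarith
      finally show "?e * (cmod (f m i ?x))\<^sup>2 \<le> 1" by simp
    qed (use \<epsilon> in auto)
    finally show ?thesis by simp
  qed
  ultimately show ?thesis by blast
qed

text \<open>
  Montel's theorem for several sequences at once, by passing to successive subsequences.
\<close>

lemma montel_finite_family:
  fixes F :: "nat \<Rightarrow> 'l \<Rightarrow> complex \<Rightarrow> complex"
  assumes "finite L" "open S"
    and "\<And>n l. l \<in> L \<Longrightarrow> F n l holomorphic_on S"
    and "\<And>n l z. l \<in> L \<Longrightarrow> z \<in> S \<Longrightarrow> cmod (F n l z) \<le> B"
  shows "\<exists>g r. strict_mono (r :: nat \<Rightarrow> nat) \<and>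
           (\<forall>l\<in>L. g l holomorphic_on S \<and> (\<forall>z\<in>S. (\<lambda>n. F (r n) l z) \<longlonglongrightarrow> g l z))"
  using assms
proof (induction L rule: finite_induct)
  case empty
  show ?case by (rule exI, rule exI[of _ id]) (auto simp: strict_mono_def)
next
  case (insert a L)
  then obtain g r where r: "strict_mono (r :: nat \<Rightarrow> nat)"
    and g: "\<And>l. l \<in> L \<Longrightarrow> g l holomorphic_on S"
      "\<And>l z. l \<in> L \<Longrightarrow> z \<in> S \<Longrightarrow> (\<lambda>n. F (r n) l z) \<longlonglongrightarrow> g l z"
    by (metis insertCI)
  obtain h r' where h: "h holomorphic_on S" and r': "strict_mono (r' :: nat \<Rightarrow> nat)"
    and lim: "\<And>z. z \<in> S \<Longrightarrow> (\<lambda>n. F (r (r' n)) a z) \<longlonglongrightarrow> h z"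
  proof (rule Montel[of S "range (\<lambda>n. F (r n) a)" "\<lambda>n. F (r n) a"])
    show "\<exists>B. \<forall>h\<in>range (\<lambda>n. F (r n) a). \<forall>z\<in>K. cmod (h z) \<le> B" if "K \<subseteq> S" for K
      using that insert.prems(3) by blast
  qed (use insert.prems in auto)
  show ?case
  proof (intro exI[of _ "g(a := h)"] exI[of _ "r \<circ> r'"] conjI ballI)
    show "strict_mono (r \<circ> r')" using r r' by (rule strict_mono_o)
    fix l assume l: "l \<in> insert a L"
    show "(g(a := h)) l holomorphic_on S" using l g h by auto
    fix z assume "z \<in> S"
    then show "(\<lambda>n. F ((r \<circ> r') n) l z) \<longlonglongrightarrow> (g(a := h)) l z"
      using l lim LIMSEQ_subseq_LIMSEQ[OF g(2)[of l z] r'] by (auto simp: o_def)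
  qed
qed

lemma matrix_schur_function_entry_le_1:
  fixes \<Sigma> :: "complex \<Rightarrow> complex^2^2"
  assumes "matrix_schur_function \<Sigma>" "z \<in> \<bbbD>"
  shows "cmod (\<Sigma> z $ i $ j) \<le> 1"
proof -
  have "\<Sigma> z $ i $ j = (\<Sigma> z *v axis j 1) $ i"
    by (simp add: matrix_vector_mult_def axis_def if_distrib[of "\<lambda>x. _ * x"] cong: if_cong)
  also have "cmod \<dots> \<le> norm (\<Sigma> z *v axis j 1)" by (rule Finite_Cartesian_Product.norm_nth_le)
  also have "\<dots> \<le> norm (axis j 1 :: complex^2)"
    using assms unfolding matrix_schur_function_def by blast
  finally show ?thesis by simp
qed

lemma matrix_schur_function_limit:
  fixes \<Sigma> :: "nat \<Rightarrow> complex \<Rightarrow> complex^2^2"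
  assumes "\<And>n. matrix_schur_function (\<Sigma> n)"
  obtains \<Theta> r where "matrix_schur_function \<Theta>" "strict_mono (r :: nat \<Rightarrow> nat)"
    "\<And>z. z \<in> \<bbbD> \<Longrightarrow> (\<lambda>n. \<Sigma> (r n) z) \<longlonglongrightarrow> \<Theta> z"
proof -
  have "\<exists>g r. strict_mono (r :: nat \<Rightarrow> nat) \<and>
     (\<forall>l\<in>UNIV. g l holomorphic_on \<bbbD> \<and> (\<forall>z\<in>\<bbbD>. (\<lambda>n. \<Sigma> (r n) z $ fst l $ snd l) \<longlonglongrightarrow> g l z))"
    using assms matrix_schur_function_entry_le_1
    by (intro montel_finite_family[where B = 1 and F = "\<lambda>n l z. \<Sigma> n z $ fst l $ snd l"])
       (auto simp: matrix_schur_function_def)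
  then obtain g r where r: "strict_mono (r :: nat \<Rightarrow> nat)"
    and g: "\<And>l. g l holomorphic_on \<bbbD>"
      "\<And>l z. z \<in> \<bbbD> \<Longrightarrow> (\<lambda>n. \<Sigma> (r n) z $ fst l $ snd l) \<longlonglongrightarrow> g l z"
    by blast
  define \<Theta> :: "complex \<Rightarrow> complex^2^2" where "\<Theta> z = (\<chi> i j. g (i, j) z)" for z
  have lim: "(\<lambda>n. \<Sigma> (r n) z) \<longlonglongrightarrow> \<Theta> z" if "z \<in> \<bbbD>" for z
    unfolding \<Theta>_def using g(2)[OF that, of "(_, _)"] by (intro vec_tendstoI) simp
  have "matrix_schur_function \<Theta>"
    unfolding matrix_schur_function_def
  proof (intro conjI allI ballI)
    show "(\<lambda>z. \<Theta> z $ i $ j) holomorphic_on \<bbbD>" for i j by (simp add: \<Theta>_def g)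
    fix z :: complex and y :: "complex^2" assume z: "z \<in> \<bbbD>"
    have "(\<lambda>n. \<Sigma> (r n) z *v y) \<longlonglongrightarrow> \<Theta> z *v y"
      unfolding matrix_vector_mult_def
      by (intro vec_tendstoI) (simp, intro tendsto_intros tendsto_vec_nth lim z)
    then have "(\<lambda>n. norm (\<Sigma> (r n) z *v y)) \<longlonglongrightarrow> norm (\<Theta> z *v y)" by (rule tendsto_norm)
    then show "norm (\<Theta> z *v y) \<le> norm y"
      by (rule LIMSEQ_le_const2) (use assms z in \<open>auto simp: matrix_schur_function_def\<close>)
  qed
  with r lim that show ?thesis by blast
qed

text \<open>
  The tangential Nevanlinna-Pick theorem: positivity of the Pick kernel suffices for a Schur function to
  solve the interpolation problem on all of \<open>X\<close>. Approximate solutions on an increasing sequence of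
  finite subsets of a countable dense set have a subsequence converging to a Schur function, which
  interpolates on the dense set and by continuity everywhere.
\<close>

lemma tangential_interpolation:
  fixes \<zeta> :: "'a :: {metric_space, second_countable_topology} \<Rightarrow> complex"
    and u v :: "'a \<Rightarrow> complex^2"
  assumes \<zeta>: "continuous_on X \<zeta>" "\<zeta> ` X \<subseteq> \<bbbD>"
    and uv: "continuous_on X u" "continuous_on X v"
    and pos: "positive_kernel X (pick_kernel \<zeta> u v)"
  obtains \<Sigma> where "matrix_schur_function \<Sigma>" "\<And>z. z \<in> X \<Longrightarrow> u z v* \<Sigma> (\<zeta> z) = v z"
proof -
  obtain T where T: "countable T" "T \<subseteq> X" "X \<subseteq> closure T" using separable by blast
  define F where "F n = from_nat_into T ` {..n} \<inter> T" for n
  have "\<exists>\<Sigma>. matrix_schur_function \<Sigma> \<and>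
      (\<forall>z\<in>F n. \<forall>m. (cmod ((u z v* \<Sigma> (\<zeta> z)) $ m - v z $ m))\<^sup>2 \<le> inverse (real (Suc n)))" for n
  proof (rule approximate_tangential_interpolation)
    have FX: "finite (F n)" "F n \<subseteq> X" using T(2) by (auto simp: F_def)
    then show "finite (F n)" by simp
    show "cmod (\<zeta> z) < 1" if "z \<in> F n" for z
      using FX \<zeta>(2) that by (auto simp: image_subset_iff)
    show "0 \<le> Re (sesq (F n) (pick_kernel \<zeta> u v) c c)" for c
      using pos FX unfolding positive_kernel_def by blast
  qed (auto simp: F_def)
  then obtain S where S: "\<And>n. matrix_schur_function (S n)"
    and approx: "\<And>n z m. z \<in> F n \<Longrightarrow>
      (cmod ((u z v* S n (\<zeta> z)) $ m - v z $ m))\<^sup>2 \<le> inverse (real (Suc n))"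
    by metis
  obtain \<Sigma> r where \<Sigma>: "matrix_schur_function \<Sigma>" and r: "strict_mono (r :: nat \<Rightarrow> nat)"
    and lim: "\<And>x. x \<in> \<bbbD> \<Longrightarrow> (\<lambda>n. S (r n) x) \<longlonglongrightarrow> \<Sigma> x"
    using matrix_schur_function_limit[of S, OF S] by blast
  have on_T: "u z v* \<Sigma> (\<zeta> z) = v z" if z: "z \<in> T" for z
  proof (rule vec_eq_iff[THEN iffD2, rule_format])
    fix m
    have \<zeta>z: "\<zeta> z \<in> \<bbbD>" using z T(2) \<zeta>(2) by blast
    let ?d = "\<lambda>n. (u z v* S (r n) (\<zeta> z)) $ m - v z $ m"
    have "?d \<longlonglongrightarrow> (u z v* \<Sigma> (\<zeta> z)) $ m - v z $ m"
      unfolding vector_matrix_mult_def by (simp, intro tendsto_intros tendsto_vec_nth lim \<zeta>z)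
    moreover have "?d \<longlonglongrightarrow> 0"
    proof -
      obtain N where N: "from_nat_into T N = z" using from_nat_into_surj[OF T(1) z] by blast
      have "\<forall>\<^sub>F n in sequentially. (cmod (?d n))\<^sup>2 \<le> inverse (real (Suc (r n)))"
      proof (rule eventually_sequentiallyI[of N])
        fix n assume "N \<le> n"
        then have "N \<le> r n" using seq_suble[OF r, of n] by simp
        then have "z \<in> F (r n)" using N z by (auto simp: F_def)
        then show "(cmod (?d n))\<^sup>2 \<le> inverse (real (Suc (r n)))" by (rule approx)
      qed
      moreover have "(\<lambda>n. inverse (real (Suc (r n)))) \<longlonglongrightarrow> 0"
        using LIMSEQ_subseq_LIMSEQ[OF LIMSEQ_inverse_real_of_nat r] by (simp add: o_def)
      ultimately have "(\<lambda>n. (cmod (?d n))\<^sup>2) \<longlonglongrightarrow> 0"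
        by (rule tendsto_sandwich[of "\<lambda>_. 0", rotated, OF _ tendsto_const]) auto
      then have "(\<lambda>n. sqrt ((cmod (?d n))\<^sup>2)) \<longlonglongrightarrow> sqrt 0" by (rule tendsto_real_sqrt)
      then show ?thesis by (simp add: tendsto_norm_zero_iff)
    qed
    ultimately show "(u z v* \<Sigma> (\<zeta> z)) $ m = v z $ m" using LIMSEQ_unique by fastforce
  qed
  have cont\<Sigma>: "continuous_on X (\<lambda>z. \<Sigma> (\<zeta> z) $ i $ j)" for i j
    using \<Sigma> \<zeta> unfolding matrix_schur_function_def
    by (intro continuous_on_compose2[of \<bbbD> "\<lambda>x. \<Sigma> x $ i $ j" X \<zeta>] holomorphic_on_imp_continuous_on) auto
  have "u z v* \<Sigma> (\<zeta> z) = v z" if z: "z \<in> X" for z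
  proof (rule vec_eq_iff[THEN iffD2, rule_format])
    fix m
    obtain t where t: "\<And>n. t n \<in> T" "t \<longlonglongrightarrow> z" using z T(3) closure_sequential by blast
    have "continuous_on X (\<lambda>z. (u z v* \<Sigma> (\<zeta> z)) $ m - v z $ m)"
      unfolding vector_matrix_mult_def
      by (simp, intro continuous_on_diff continuous_on_sum continuous_on_mult cont\<Sigma>
          uv[THEN continuous_on_component])
    then have "(\<lambda>n. (u (t n) v* \<Sigma> (\<zeta> (t n))) $ m - v (t n) $ m) \<longlonglongrightarrow> (u z v* \<Sigma> (\<zeta> z)) $ m - v z $ m"
      using t T(2) z unfolding continuous_on_sequentially by (auto simp: o_def)
    then show "(u z v* \<Sigma> (\<zeta> z)) $ m = v z $ m" using t(1) on_T LIMSEQ_unique by fastforce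
  qed
  with \<Sigma> that show ?thesis by blast
qed

section \<open>The Hardy space in terms of Taylor coefficients\<close>

definition taylor_coeff :: "(complex \<Rightarrow> complex) \<Rightarrow> nat \<Rightarrow> complex"
  where "taylor_coeff f n = (deriv ^^ n) f 0 / fact n"

lemma taylor_sums:
  assumes "f holomorphic_on \<bbbD>" "z \<in> \<bbbD>"
  shows "(\<lambda>n. taylor_coeff f n * z ^ n) sums f z"
  using holomorphic_power_series[OF assms] by (simp add: taylor_coeff_def)

text \<open>
  Needed to read off the coefficients of linear combinations and of the Szego kernels.
\<close>

lemma taylor_unique:
  assumes "\<And>z. z \<in> \<bbbD> \<Longrightarrow> (\<lambda>n. c n * z ^ n) sums f z"
  shows "taylor_coeff f n = c n"
proof -
  have "f has_fps_expansion Abs_fps c"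
    using assms eventually_nhds_in_open[of \<bbbD> 0]
    by (intro has_fps_expansionI) (auto elim!: eventually_mono)
  from fps_nth_fps_expansion[OF this, of n] show ?thesis by (simp add: taylor_coeff_def)
qed

lemma summable_taylor:
  assumes "f holomorphic_on \<bbbD>" "0 \<le> r" "r < 1"
  shows "summable (\<lambda>n. cmod (taylor_coeff f n) * r ^ n)"
proof -
  define \<rho> where "\<rho> = (r + 1) / 2"
  have \<rho>: "r < \<rho>" "\<rho> < 1" using assms(3) by (auto simp: \<rho>_def field_simps)
  have "summable (\<lambda>n. taylor_coeff f n * of_real \<rho> ^ n)"
    using taylor_sums[OF assms(1), of "of_real \<rho>"] \<rho> assms(2) by (auto simp: sums_iff)
  from powser_insidea[OF this, of "of_real r"] show ?thesis
    using \<rho> assms(2) by (simp add: norm_mult norm_power)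
qed

lemma taylor_uniform_limit:
  assumes "f holomorphic_on \<bbbD>" "0 \<le> r" "r < 1"
  shows "uniform_limit (cball 0 r) (\<lambda>N z. \<Sum>n<N. taylor_coeff f n * z ^ n) f sequentially"
proof -
  have "uniform_limit (cball 0 r) (\<lambda>N z. \<Sum>n<N. taylor_coeff f n * z ^ n)
          (\<lambda>z. \<Sum>n. taylor_coeff f n * z ^ n) sequentially"
    using summable_taylor[OF assms]
    by (intro Weierstrass_m_test[where M = "\<lambda>n. cmod (taylor_coeff f n) * r ^ n"])
       (auto simp: norm_mult norm_power intro!: mult_left_mono power_mono)
  also have "?this \<longleftrightarrow> ?thesis"
    using taylor_sums[OF assms(1)] assms(3)
    by (intro uniform_limit_cong refl always_eventually allI ballI) (auto simp: sums_iff)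
  finally show ?thesis .
qed

lemma circle_mean_monomials:
  "circle_mean (\<lambda>z. z ^ m * cnj (z ^ n)) r = (if m = n then of_real (r ^ (2 * n)) else 0)"
proof -
  define d where "d = real m - real n"
  have eq: "(of_real r * cis t) ^ m * cnj ((of_real r * cis t) ^ n) = of_real (r ^ (m + n)) * cis (d * t)" for t
  proof -
    have "cis t ^ m * cnj (cis t ^ n) = cis (d * t)"
      unfolding complex_cnj_power cis_cnj Complex.DeMoivre cis_mult by (simp add: d_def algebra_simps)
    moreover have "(of_real r * cis t) ^ m * cnj ((of_real r * cis t) ^ n)
        = of_real (r ^ (m + n)) * (cis t ^ m * cnj (cis t ^ n))"
      by (simp add: power_mult_distrib power_add)
    ultimately show ?thesis by simp
  qed
  have "integral {0..2 * pi} (\<lambda>t. cis (d * t)) = (if m = n then of_real (2 * pi) else 0)"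
  proof (cases "m = n")
    case True
    then show ?thesis by (simp add: d_def scaleR_conv_of_real)
  next
    case False
    then have d0: "d \<noteq> 0" by (simp add: d_def)
    have "((\<lambda>t. cis (d * t) / (\<i> * of_real d)) has_vector_derivative cis (d * t)) (at t within {0..2*pi})" for t
    proof -
      have "((\<lambda>t. cis (d * t)) has_vector_derivative (of_real d * (\<i> * cis (d * t)))) (at t within {0..2*pi})"
        unfolding cis_conv_exp of_real_mult
        by (rule has_vector_derivative_real_field[where f = "\<lambda>z. exp (\<i> * (of_real d * z))"])
           (auto intro!: derivative_eq_intros)
      from has_vector_derivative_divide[OF this, of "\<i> * of_real d"] show ?thesis using d0 by simp
    qed
    then have "((\<lambda>t. cis (d * t)) has_integral (cis (d * (2 * pi)) / (\<i> * of_real d) - cis (d * 0) / (\<i> * of_real d))) {0..2*pi}"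
      by (intro fundamental_theorem_of_calculus) auto
    moreover have "cis (d * (2 * pi)) = 1"
    proof -
      have "cis (2 * pi * d) = 1" by (rule cis_multiple_2pi) (simp add: d_def)
      moreover have "d * (2 * pi) = 2 * pi * d" by simp
      ultimately show ?thesis by (simp only:)
    qed
    ultimately show ?thesis using False by (simp add: integral_unique)
  qed
  then have "circle_mean (\<lambda>z. z ^ m * cnj (z ^ n)) r
      = (1 / (2 * pi)) *\<^sub>R (of_real (r ^ (m + n)) * (if m = n then of_real (2 * pi) else 0))"
    unfolding circle_mean_def eq by simp
  also have "\<dots> = (if m = n then of_real (r ^ (2 * n)) else 0)"
    by (cases "m = n") (simp_all add: scaleR_conv_of_real flip: mult_2)
  finally show ?thesis .
qed

lemma continuous_on_circle:
  assumes "f holomorphic_on \<bbbD>" "0 \<le> r" "r < 1"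
  shows "continuous_on S (\<lambda>t. f (of_real r * cis t))"
  by (rule continuous_on_compose2[OF holomorphic_on_imp_continuous_on[OF assms(1)]])
     (use assms in \<open>auto intro!: continuous_intros simp: norm_mult\<close>)

lemma circle_mean_sum:
  assumes "finite A" "\<And>i. i \<in> A \<Longrightarrow> (\<lambda>t. f i (of_real r * cis t)) integrable_on {0..2*pi}"
  shows "circle_mean (\<lambda>z. \<Sum>i\<in>A. f i z) r = (\<Sum>i\<in>A. circle_mean (f i) r)"
  unfolding circle_mean_def using assms by (simp add: integral_sum scaleR_sum_right)

lemma circle_mean_product_tendsto:
  assumes F: "uniform_limit (cball 0 r) F f sequentially" "\<And>n. continuous_on (cball 0 r) (F n)"
    and G: "uniform_limit (cball 0 r) G g sequentially" "\<And>n. continuous_on (cball 0 r) (G n)"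
    and r: "0 \<le> r"
  shows "(\<lambda>n. circle_mean (\<lambda>z. F n z * cnj (G n z)) r) \<longlonglongrightarrow> circle_mean (\<lambda>z. f z * cnj (g z)) r"
proof -
  define c where "c t = of_real r * cis t" for t
  have c: "c t \<in> cball 0 r" for t using r by (simp add: c_def norm_mult)
  have cont_c: "continuous_on S c" for S unfolding c_def by (intro continuous_intros)
  have cont: "continuous_on S (\<lambda>t. h (c t))" if "continuous_on (cball 0 r) h" for S and h :: "complex \<Rightarrow> complex"
    by (rule continuous_on_compose2[OF that cont_c]) (use c in auto)
  have bdd: "bounded ((\<lambda>t. h (c t)) ` {0..2*pi})" if "continuous_on (cball 0 r) h" for h :: "complex \<Rightarrow> complex"
    by (intro compact_imp_bounded compact_continuous_image cont that) auto
  have f: "continuous_on (cball 0 r) f" and g: "continuous_on (cball 0 r) g"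
    by (rule uniform_limit_theorem[OF _ F(1)] uniform_limit_theorem[OF _ G(1)]; use F G in simp)+
  have ulim: "uniform_limit {0..2*pi} (\<lambda>n t. F n (c t) * cnj (G n (c t)))
      (\<lambda>t. f (c t) * cnj (g (c t))) sequentially"
  proof (rule uniform_lim_mult)
    show "uniform_limit {0..2*pi} (\<lambda>n t. F n (c t)) (\<lambda>t. f (c t)) sequentially"
      by (rule uniform_limit_compose'[OF F(1)]) (use c in auto)
    show "uniform_limit {0..2*pi} (\<lambda>n t. cnj (G n (c t))) (\<lambda>t. cnj (g (c t))) sequentially"
      by (rule bounded_linear.uniform_limit[OF bounded_linear_cnj uniform_limit_compose'[OF G(1)]])
         (use c in auto)
    show "bounded ((\<lambda>t. cnj (g (c t))) ` {0..2*pi})"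
      using bdd[OF g] by (auto simp: bounded_iff)
    show "bounded ((\<lambda>t. f (c t)) ` {0..2*pi})" by (rule bdd[OF f])
  qed
  have "continuous_on {0..2*pi} (\<lambda>t. F n (c t) * cnj (G n (c t)))" for n
    by (intro continuous_intros cont F G)
  then obtain I J where I: "\<And>n. ((\<lambda>t. F n (c t) * cnj (G n (c t))) has_integral I n) {0..2*pi}"
    and J: "((\<lambda>t. f (c t) * cnj (g (c t))) has_integral J) {0..2*pi}" and "I \<longlonglongrightarrow> J"
    by (rule uniform_limit_integral[OF ulim _ trivial_limit_sequentially]) (rule that)
  then show ?thesis
    unfolding circle_mean_def c_def[symmetric] integral_unique[OF I] integral_unique[OF J]
    by (intro tendsto_intros)
qed

text \<open>
  Orthogonality of the monomials on the circle of radius \<open>r\<close>, applied to the Taylor polynomials, which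
  converge uniformly there.
\<close>

theorem parseval_circle:
  assumes f: "f holomorphic_on \<bbbD>" and g: "g holomorphic_on \<bbbD>" and r: "0 \<le> r" "r < 1"
  shows "(\<lambda>n. taylor_coeff f n * cnj (taylor_coeff g n) * of_real (r ^ (2 * n)))
           sums circle_mean (\<lambda>z. f z * cnj (g z)) r"
proof -
  define p where "p h N z = (\<Sum>n<N. taylor_coeff h n * z ^ n)" for h N z
  have "(\<lambda>N. circle_mean (\<lambda>z. p f N z * cnj (p g N z)) r) \<longlonglongrightarrow> circle_mean (\<lambda>z. f z * cnj (g z)) r"
    unfolding p_def
    by (intro circle_mean_product_tendsto taylor_uniform_limit f g r continuous_intros)
  moreover have "circle_mean (\<lambda>z. p f N z * cnj (p g N z)) r =
      (\<Sum>n<N. taylor_coeff f n * cnj (taylor_coeff g n) * of_real (r ^ (2 * n)))" for N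
  proof -
    have "circle_mean (\<lambda>z. p f N z * cnj (p g N z)) r = circle_mean (\<lambda>z. \<Sum>m<N. \<Sum>n<N. 
        (taylor_coeff f m * cnj (taylor_coeff g n)) * (z ^ m * cnj (z ^ n))) r"
      by (simp add: p_def sum_product mult_ac)
    also have "\<dots> = (\<Sum>m<N. \<Sum>n<N. circle_mean (\<lambda>z. 
        (taylor_coeff f m * cnj (taylor_coeff g n)) * (z ^ m * cnj (z ^ n))) r)"
      by (subst circle_mean_sum, simp, intro integrable_continuous_real continuous_intros,
          intro sum.cong refl, rule circle_mean_sum) (auto intro!: integrable_continuous_real continuous_intros)
    also have "\<dots> = (\<Sum>m<N. \<Sum>n<N. (taylor_coeff f m * cnj (taylor_coeff g n)) * circle_mean (\<lambda>z. z ^ m * cnj (z ^ n)) r)"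
      unfolding circle_mean_def by simp
    also have "\<dots> = (\<Sum>m<N. \<Sum>n<N. if m = n then taylor_coeff f n * cnj (taylor_coeff g n) * of_real (r ^ (2 * n)) else 0)"
      unfolding circle_mean_monomials by (intro sum.cong refl) auto
    finally show ?thesis by (simp add: sum.delta')
  qed
  ultimately show ?thesis by (simp add: sums_def)
qed

lemma circle_mean_norm_square:
  assumes f: "f holomorphic_on \<bbbD>" and r: "0 \<le> r" "r < 1"
  shows "circle_mean (\<lambda>z. f z * cnj (f z)) r = of_real (circle_mean (\<lambda>z. (cmod (f z))\<^sup>2) r)"
proof -
  have "(\<lambda>t. (cmod (f (of_real r * cis t)))\<^sup>2) integrable_on {0..2*pi}"
    by (intro integrable_continuous_real continuous_intros continuous_on_circle assms)
  from integral_linear[OF this bounded_linear_of_real[where 'a = complex]]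
  show ?thesis
    unfolding circle_mean_def complex_norm_square[symmetric] by (simp add: o_def scaleR_conv_of_real)
qed

lemma parseval_circle_norm:
  assumes f: "f holomorphic_on \<bbbD>" and r: "0 \<le> r" "r < 1"
  shows "(\<lambda>n. (cmod (taylor_coeff f n))\<^sup>2 * r ^ (2 * n)) sums circle_mean (\<lambda>z. (cmod (f z))\<^sup>2) r"
proof -
  note circle_mean_norm_square[OF assms]
  with parseval_circle[OF f f r]
  have "(\<lambda>n. complex_of_real ((cmod (taylor_coeff f n))\<^sup>2 * r ^ (2 * n))) sums of_real (circle_mean (\<lambda>z. (cmod (f z))\<^sup>2) r)"
    by (simp add: complex_norm_square[symmetric] del: of_real_power flip: of_real_mult)
  then show ?thesis by (simp only: sums_of_real_iff)
qed

lemma hardy2_holomorphic: "f \<in> hardy2 \<Longrightarrow> f holomorphic_on \<bbbD>"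
  by (simp add: hardy2_def)

lemma circle_mean_le_taylor_norm:
  assumes "f holomorphic_on \<bbbD>" "summable (\<lambda>n. (cmod (taylor_coeff f n))\<^sup>2)" "r \<in> {0..<1}"
  shows "circle_mean (\<lambda>z. (cmod (f z))\<^sup>2) r \<le> (\<Sum>n. (cmod (taylor_coeff f n))\<^sup>2)"
proof -
  have "(cmod (taylor_coeff f n))\<^sup>2 * r ^ (2 * n) \<le> (cmod (taylor_coeff f n))\<^sup>2" for n
    using assms(3) by (intro mult_right_le_one_le) (auto simp: power_le_one)
  then show ?thesis
    using parseval_circle_norm[OF assms(1), of r] assms(2,3)
    by (intro sums_le[OF _ _ summable_sums]) auto
qed

text \<open>
  By Parseval's formula the means are \<open>\<Sum>n. |a\<^sub>n|\<^sup>2 r\<^sup>2\<^sup>n\<close>; they are bounded for \<open>r < 1\<close> exactly if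
  the series converges at \<open>r = 1\<close>.
\<close>

lemma hardy2_iff:
  "f \<in> hardy2 \<longleftrightarrow> f holomorphic_on \<bbbD> \<and> summable (\<lambda>n. (cmod (taylor_coeff f n))\<^sup>2)"
proof safe
  assume f: "f \<in> hardy2"
  then show hol: "f holomorphic_on \<bbbD>" by (rule hardy2_holomorphic)
  obtain B where B: "\<And>r. r \<in> {0..<1} \<Longrightarrow> circle_mean (\<lambda>z. (cmod (f z))\<^sup>2) r \<le> B"
    using f unfolding hardy2_def bdd_above_def by blast
  have "(\<Sum>n<N. (cmod (taylor_coeff f n))\<^sup>2) \<le> B" for N
  proof (rule tendsto_upperbound)
    have "((\<lambda>r. \<Sum>n<N. (cmod (taylor_coeff f n))\<^sup>2 * r ^ (2 * n)) \<longlongrightarrow>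
        (\<Sum>n<N. (cmod (taylor_coeff f n))\<^sup>2 * 1 ^ (2 * n))) (at_left 1)"
      by (intro tendsto_intros)
    then show "((\<lambda>r. \<Sum>n<N. (cmod (taylor_coeff f n))\<^sup>2 * r ^ (2 * n)) \<longlongrightarrow>
        (\<Sum>n<N. (cmod (taylor_coeff f n))\<^sup>2)) (at_left 1)" by simp
    have "(\<Sum>n<N. (cmod (taylor_coeff f n))\<^sup>2 * r ^ (2 * n)) \<le> B" if "r \<in> {0<..<1}" for r
    proof -
      note s = parseval_circle_norm[OF hol, of r]
      have "(\<Sum>n<N. (cmod (taylor_coeff f n))\<^sup>2 * r ^ (2 * n)) \<le> (\<Sum>n. (cmod (taylor_coeff f n))\<^sup>2 * r ^ (2 * n))"
        using s that by (intro sum_le_suminf) (auto simp: sums_iff)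
      also have "\<dots> \<le> B" using s B[of r] that by (auto simp: sums_iff)
      finally show ?thesis .
    qed
    then show "\<forall>\<^sub>F r in at_left 1. (\<Sum>n<N. (cmod (taylor_coeff f n))\<^sup>2 * r ^ (2 * n)) \<le> B"
      using eventually_at_left_real[of 0 1] by (auto elim!: eventually_mono)
  qed auto
  then show "summable (\<lambda>n. (cmod (taylor_coeff f n))\<^sup>2)"
    by (intro bounded_imp_summable[of _ B]) (auto simp: lessThan_Suc_atMost[symmetric] simp del: sum.lessThan_Suc)
next
  assume "f holomorphic_on \<bbbD>" "summable (\<lambda>n. (cmod (taylor_coeff f n))\<^sup>2)"
  moreover from circle_mean_le_taylor_norm[OF this]
  have "bdd_above (circle_mean (\<lambda>z. (cmod (f z))\<^sup>2) ` {0..<1})" by (rule bdd_aboveI2)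
  ultimately show "f \<in> hardy2" by (simp add: hardy2_def)
qed

lemma summable_taylor_inner:
  assumes "f \<in> hardy2" "g \<in> hardy2"
  shows "summable (\<lambda>n. cmod (taylor_coeff f n * cnj (taylor_coeff g n)))"
proof (rule summable_comparison_test'[of "\<lambda>n. (cmod (taylor_coeff f n))\<^sup>2 + (cmod (taylor_coeff g n))\<^sup>2"])
  show "summable (\<lambda>n. (cmod (taylor_coeff f n))\<^sup>2 + (cmod (taylor_coeff g n))\<^sup>2)"
    using assms by (intro summable_add) (auto simp: hardy2_iff)
  show "norm (cmod (taylor_coeff f n * cnj (taylor_coeff g n))) \<le> (cmod (taylor_coeff f n))\<^sup>2 + (cmod (taylor_coeff g n))\<^sup>2" for n
  proof -
    have "2 * (cmod (taylor_coeff f n) * cmod (taylor_coeff g n)) \<le> (cmod (taylor_coeff f n))\<^sup>2 + (cmod (taylor_coeff g n))\<^sup>2"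
      using sum_squares_bound[of "cmod (taylor_coeff f n)" "cmod (taylor_coeff g n)"] by (simp add: mult.assoc)
    moreover have "0 \<le> cmod (taylor_coeff f n) * cmod (taylor_coeff g n)" by simp
    ultimately show ?thesis unfolding norm_mult complex_mod_cnj real_norm_def abs_mult abs_norm_cancel by linarith
  qed
qed

text \<open>
  The limit in the inner product exists: the Parseval series is dominated by its value at \<open>r = 1\<close>, so
  that Tannery's theorem applies.
\<close>

lemma circle_mean_tendsto:
  assumes "f \<in> hardy2" "g \<in> hardy2"
  shows "(circle_mean (\<lambda>z. f z * cnj (g z)) \<longlongrightarrow> (\<Sum>n. taylor_coeff f n * cnj (taylor_coeff g n))) (at_left 1)"
proof -
  let ?a = "\<lambda>n. taylor_coeff f n * cnj (taylor_coeff g n)"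
  have ev: "\<forall>\<^sub>F r in at_left (1::real). r \<in> {0<..<1}" using eventually_at_left_real[of 0 1] by simp
  have "((\<lambda>r::real. \<Sum>n. ?a n * of_real (r ^ (2 * n))) \<longlongrightarrow> (\<Sum>n. ?a n)) (at_left 1)"
  proof (rule tannerys_theorem[THEN conjunct2, THEN conjunct2])
    have "((\<lambda>r::real. ?a n * of_real (r ^ (2 * n))) \<longlongrightarrow> ?a n * of_real (1 ^ (2 * n))) (at_left 1)" for n
      by (intro tendsto_intros)
    then show "((\<lambda>r::real. ?a n * of_real (r ^ (2 * n))) \<longlongrightarrow> ?a n) (at_left 1)" for n by simp
    have bnd: "cmod (?a n * of_real (r ^ (2 * n))) \<le> cmod (?a n)" if "r \<in> {0<..<1}" for n and r :: real
      using that unfolding norm_mult[of "?a n"]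
      by (intro mult_right_le_one_le) (auto simp: norm_power power_le_one)
    show "\<forall>\<^sub>F (n, r) in sequentially \<times>\<^sub>F at_left 1. cmod (?a n * of_real (r ^ (2 * n))) \<le> cmod (?a n)"
      unfolding eventually_prod_filter
      by (rule exI[of _ "\<lambda>_. True"], rule exI[of _ "\<lambda>r. r \<in> {0<..<1}"]) (use ev bnd in auto)
    show "summable (\<lambda>n. cmod (?a n))" using assms by (rule summable_taylor_inner)
  qed auto
  moreover have "\<forall>\<^sub>F r in at_left 1. (\<Sum>n. ?a n * of_real (r ^ (2 * n))) = circle_mean (\<lambda>z. f z * cnj (g z)) r"
    using ev
  proof eventually_elim
    case (elim r)
    then show ?case
      using parseval_circle[of f g r] assms by (simp add: hardy2_holomorphic sums_iff)
  qed
  ultimately show ?thesis by (rule Lim_transform_eventually)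
qed

lemma hardy2_inner_sums:
  assumes "f \<in> hardy2" "g \<in> hardy2"
  shows "(\<lambda>n. taylor_coeff f n * cnj (taylor_coeff g n)) sums hardy2_inner f g"
proof -
  have "hardy2_inner f g = (\<Sum>n. taylor_coeff f n * cnj (taylor_coeff g n))"
    unfolding hardy2_inner_def by (rule tendsto_Lim[OF _ circle_mean_tendsto[OF assms]]) simp
  then show ?thesis
    using summable_norm_cancel[OF summable_taylor_inner[OF assms]] by (simp add: sums_iff)
qed

lemma circle_mean_norm_tendsto_taylor:
  assumes f: "f \<in> hardy2"
  shows "(circle_mean (\<lambda>z. (cmod (f z))\<^sup>2) \<longlongrightarrow> (\<Sum>n. (cmod (taylor_coeff f n))\<^sup>2)) (at_left 1)"
proof -
  have "((\<lambda>r. complex_of_real (circle_mean (\<lambda>z. (cmod (f z))\<^sup>2) r)) \<longlongrightarrow> (\<Sum>n. taylor_coeff f n * cnj (taylor_coeff f n))) (at_left 1)"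
  proof (rule Lim_transform_eventually[OF circle_mean_tendsto[OF f f]])
    have "\<forall>\<^sub>F r in at_left (1::real). r \<in> {0<..<1}" using eventually_at_left_real[of 0 1] by simp
    then show "\<forall>\<^sub>F r in at_left 1. circle_mean (\<lambda>z. f z * cnj (f z)) r = complex_of_real (circle_mean (\<lambda>z. (cmod (f z))\<^sup>2) r)"
      by eventually_elim (use f in \<open>simp add: circle_mean_norm_square hardy2_holomorphic\<close>)
  qed
  moreover have "(\<Sum>n. taylor_coeff f n * cnj (taylor_coeff f n)) = of_real (\<Sum>n. (cmod (taylor_coeff f n))\<^sup>2)"
    using f by (simp only: complex_norm_square[symmetric] suminf_of_real hardy2_iff)
  ultimately show ?thesis by (simp only: tendsto_of_real_iff)
qed

lemma hardy2_norm_sums: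
  assumes f: "f \<in> hardy2"
  shows "(\<lambda>n. (cmod (taylor_coeff f n))\<^sup>2) sums (hardy2_norm f)\<^sup>2"
proof -
  let ?m = "circle_mean (\<lambda>z. (cmod (f z))\<^sup>2)" and ?s = "\<Sum>n. (cmod (taylor_coeff f n))\<^sup>2"
  have hol: "f holomorphic_on \<bbbD>" and s: "summable (\<lambda>n. (cmod (taylor_coeff f n))\<^sup>2)"
    using f by (auto simp: hardy2_iff)
  have bdd: "bdd_above (?m ` {0..<1})" using f by (simp add: hardy2_def)
  have "(SUP r\<in>{0..<1}. ?m r) = ?s"
  proof (rule antisym)
    show "(SUP r\<in>{0..<1}. ?m r) \<le> ?s"
      by (rule cSUP_least) (use circle_mean_le_taylor_norm[OF hol s] in auto)
    have "?m r \<le> (SUP r\<in>{0..<1}. ?m r)" if "r \<in> {0<..<1}" for r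
      using that by (intro cSUP_upper bdd) auto
    then have "\<forall>\<^sub>F r in at_left 1. ?m r \<le> (SUP r\<in>{0..<1}. ?m r)"
      using eventually_at_left_real[of 0 1] by (auto elim!: eventually_mono)
    then show "?s \<le> (SUP r\<in>{0..<1}. ?m r)"
      by (rule tendsto_upperbound[OF circle_mean_norm_tendsto_taylor[OF f]]) simp
  qed
  moreover have "0 \<le> ?s" by (intro suminf_nonneg s) auto
  ultimately have "(hardy2_norm f)\<^sup>2 = ?s" by (simp add: hardy2_norm_def)
  then show ?thesis using s by (simp add: sums_iff)
qed

lemma circle_mean_norm_tendsto:
  assumes "f \<in> hardy2"
  shows "(circle_mean (\<lambda>z. (cmod (f z))\<^sup>2) \<longlongrightarrow> (hardy2_norm f)\<^sup>2) (at_left 1)"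
  using circle_mean_norm_tendsto_taylor[OF assms] hardy2_norm_sums[OF assms] by (simp add: sums_iff)

lemma circle_mean_le_hardy2_norm:
  assumes "f \<in> hardy2" "r \<in> {0..<1}"
  shows "circle_mean (\<lambda>z. (cmod (f z))\<^sup>2) r \<le> (hardy2_norm f)\<^sup>2"
  using circle_mean_le_taylor_norm[of f r] hardy2_norm_sums[OF assms(1)] assms
  by (simp add: hardy2_iff sums_iff)

lemma hardy2_normI:
  assumes "f holomorphic_on \<bbbD>" "0 \<le> B" "\<And>r. r \<in> {0..<1} \<Longrightarrow> circle_mean (\<lambda>z. (cmod (f z))\<^sup>2) r \<le> B\<^sup>2"
  shows "f \<in> hardy2" "hardy2_norm f \<le> B"
proof -
  have "bdd_above (circle_mean (\<lambda>z. (cmod (f z))\<^sup>2) ` {0..<1})" using assms(3) by (rule bdd_aboveI2)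
  then show "f \<in> hardy2" using assms(1) by (simp add: hardy2_def)
  have "(SUP r\<in>{0..<1}. circle_mean (\<lambda>z. (cmod (f z))\<^sup>2) r) \<le> B\<^sup>2"
    by (rule cSUP_least) (use assms(3) in auto)
  then show "hardy2_norm f \<le> B" 
    unfolding hardy2_norm_def using assms(2) by (intro real_le_lsqrt)
qed

text \<open>
  A locally uniform bound is all that Montel's theorem asks for; comparing the Taylor series termwise with
  \<open>(|a\<^sub>n|\<^sup>2 + |z|\<^sup>2\<^sup>n) / 2\<close> gives this one.
\<close>

lemma hardy2_pointwise_bound:
  assumes f: "f \<in> hardy2" and z: "z \<in> \<bbbD>"
  shows "cmod (f z) \<le> ((hardy2_norm f)\<^sup>2 + 1 / (1 - (cmod z)\<^sup>2)) / 2"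
proof -
  have z1: "(cmod z)\<^sup>2 < 1" using z by (simp add: power_less_one_iff)
  have s1: "(\<lambda>n. ((cmod (taylor_coeff f n))\<^sup>2 + ((cmod z)\<^sup>2) ^ n) / 2) sums
      (((hardy2_norm f)\<^sup>2 + 1 / (1 - (cmod z)\<^sup>2)) / 2)"
    by (intro sums_divide sums_add hardy2_norm_sums f geometric_sums) (use z1 in simp)
  have s2: "(\<lambda>n. taylor_coeff f n * z ^ n) sums f z"
    by (rule taylor_sums[OF hardy2_holomorphic[OF f] z])
  have le: "cmod (taylor_coeff f n * z ^ n) \<le> ((cmod (taylor_coeff f n))\<^sup>2 + ((cmod z)\<^sup>2) ^ n) / 2" for n
    using sum_squares_bound[of "cmod (taylor_coeff f n)" "cmod z ^ n"]
    by (simp add: norm_mult norm_power power_commutes mult.commute flip: power_mult)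
  show ?thesis
    by (rule norm_sums_le[OF s2 s1 le])
qed

lemma hardy2_norm_square_inner:
  assumes "f \<in> hardy2" shows "hardy2_inner f f = of_real ((hardy2_norm f)\<^sup>2)"
proof -
  have "(\<lambda>n. taylor_coeff f n * cnj (taylor_coeff f n)) sums of_real ((hardy2_norm f)\<^sup>2)"
    using hardy2_norm_sums[OF assms] 
    by (simp only: complex_norm_square[symmetric] sums_of_real_iff)
  then show ?thesis using hardy2_inner_sums[OF assms assms] sums_unique2 by blast
qed

lemma hardy2_inner_commute:
  assumes "f \<in> hardy2" "g \<in> hardy2" shows "hardy2_inner g f = cnj (hardy2_inner f g)"
proof -
  have "(\<lambda>n. taylor_coeff g n * cnj (taylor_coeff f n)) sums cnj (hardy2_inner f g)"
    using hardy2_inner_sums[OF assms, THEN bounded_linear.sums[OF bounded_linear_cnj]] by (simp add: mult.commute)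
  then show ?thesis using hardy2_inner_sums[OF assms(2,1)] sums_unique2 by blast
qed

lemma taylor_sum:
  assumes "\<And>i. i \<in> A \<Longrightarrow> f i holomorphic_on \<bbbD>"
  shows "taylor_coeff (\<lambda>z. \<Sum>i\<in>A. c i * f i z) n = (\<Sum>i\<in>A. c i * taylor_coeff (f i) n)"
proof (rule taylor_unique)
  fix z :: complex assume "z \<in> \<bbbD>"
  then have "(\<lambda>n. \<Sum>i\<in>A. c i * (taylor_coeff (f i) n * z ^ n)) sums (\<Sum>i\<in>A. c i * f i z)"
    by (intro sums_sum sums_mult taylor_sums assms)
  then show "(\<lambda>n. (\<Sum>i\<in>A. c i * taylor_coeff (f i) n) * z ^ n) sums (\<Sum>i\<in>A. c i * f i z)"
    by (simp add: sum_distrib_right mult.assoc)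
qed

lemma hardy2_sum:
  assumes "finite A" "\<And>i. i \<in> A \<Longrightarrow> f i \<in> hardy2"
  shows "(\<lambda>z. \<Sum>i\<in>A. c i * f i z) \<in> hardy2"
  unfolding hardy2_iff
proof
  show "(\<lambda>z. \<Sum>i\<in>A. c i * f i z) holomorphic_on \<bbbD>"
    by (intro holomorphic_intros hardy2_holomorphic assms)
  have "summable (\<lambda>n. of_nat (card A) * (\<Sum>i\<in>A. (cmod (c i))\<^sup>2 * (cmod (taylor_coeff (f i) n))\<^sup>2))"
    using assms by (intro summable_mult summable_sum) (auto simp: hardy2_iff)
  then show "summable (\<lambda>n. (cmod (taylor_coeff (\<lambda>z. \<Sum>i\<in>A. c i * f i z) n))\<^sup>2)"
  proof (rule summable_comparison_test')
    fix n
    have "cmod (\<Sum>i\<in>A. c i * taylor_coeff (f i) n) \<le> (\<Sum>i\<in>A. cmod (c i) * cmod (taylor_coeff (f i) n))"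
      by (rule order_trans[OF norm_sum]) (simp add: norm_mult)
    then have "(cmod (\<Sum>i\<in>A. c i * taylor_coeff (f i) n))\<^sup>2 \<le> (\<Sum>i\<in>A. cmod (c i) * cmod (taylor_coeff (f i) n))\<^sup>2"
      by (intro power_mono) auto
    also have "\<dots> \<le> of_nat (card A) * (\<Sum>i\<in>A. (cmod (c i) * cmod (taylor_coeff (f i) n))\<^sup>2)"
      using Cauchy_Schwarz_ineq_sum[of "\<lambda>_. 1" "\<lambda>i. cmod (c i) * cmod (taylor_coeff (f i) n)" A] by simp
    finally show "norm ((cmod (taylor_coeff (\<lambda>z. \<Sum>i\<in>A. c i * f i z) n))\<^sup>2) \<le>
        of_nat (card A) * (\<Sum>i\<in>A. (cmod (c i))\<^sup>2 * (cmod (taylor_coeff (f i) n))\<^sup>2)"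
      using assms by (simp add: taylor_sum hardy2_holomorphic power_mult_distrib)
  qed
qed

lemma hardy2_inner_sum_left:
  assumes "finite A" "\<And>i. i \<in> A \<Longrightarrow> f i \<in> hardy2" "g \<in> hardy2"
  shows "hardy2_inner (\<lambda>z. \<Sum>i\<in>A. c i * f i z) g = (\<Sum>i\<in>A. c i * hardy2_inner (f i) g)"
proof -
  have "(\<lambda>n. \<Sum>i\<in>A. c i * (taylor_coeff (f i) n * cnj (taylor_coeff g n))) sums (\<Sum>i\<in>A. c i * hardy2_inner (f i) g)"
    by (intro sums_sum sums_mult hardy2_inner_sums assms)
  then have "(\<lambda>n. taylor_coeff (\<lambda>z. \<Sum>i\<in>A. c i * f i z) n * cnj (taylor_coeff g n)) sums (\<Sum>i\<in>A. c i * hardy2_inner (f i) g)"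
    using assms by (simp add: taylor_sum hardy2_holomorphic sum_distrib_right mult.assoc)
  moreover have "(\<lambda>n. taylor_coeff (\<lambda>z. \<Sum>i\<in>A. c i * f i z) n * cnj (taylor_coeff g n)) sums
      hardy2_inner (\<lambda>z. \<Sum>i\<in>A. c i * f i z) g"
    using assms by (intro hardy2_inner_sums hardy2_sum)
  ultimately show ?thesis by (rule sums_unique2[rotated])
qed

lemma hardy2_inner_sum_right:
  assumes "finite A" "\<And>i. i \<in> A \<Longrightarrow> f i \<in> hardy2" "g \<in> hardy2"
  shows "hardy2_inner g (\<lambda>z. \<Sum>i\<in>A. c i * f i z) = (\<Sum>i\<in>A. cnj (c i) * hardy2_inner g (f i))"
proof -
  have "hardy2_inner g (\<lambda>z. \<Sum>i\<in>A. c i * f i z) = cnj (\<Sum>i\<in>A. c i * hardy2_inner (f i) g)"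
    using hardy2_inner_commute[OF hardy2_sum[OF assms(1,2)] assms(3), where c1 = c]
    by (simp only: hardy2_inner_sum_left[OF assms])
  also have "\<dots> = (\<Sum>i\<in>A. cnj (c i) * hardy2_inner g (f i))"
    unfolding cnj_sum complex_cnj_mult
    by (intro sum.cong refl) (simp add: hardy2_inner_commute[OF assms(2,3)])
  finally show ?thesis .
qed

lemma hardy2_norm_nonneg: "f \<in> hardy2 \<Longrightarrow> 0 \<le> hardy2_norm f"
proof -
  assume "f \<in> hardy2"
  then have "circle_mean (\<lambda>z. (cmod (f z))\<^sup>2) 0 \<le> (SUP r\<in>{0..<1}. circle_mean (\<lambda>z. (cmod (f z))\<^sup>2) r)"
    by (intro cSUP_upper) (auto simp: hardy2_def)
  moreover have "0 \<le> circle_mean (\<lambda>z. (cmod (f z))\<^sup>2) 0"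
    by (simp add: circle_mean_def)
  ultimately show ?thesis by (simp add: hardy2_norm_def)
qed

text \<open>
  The right-hand side is the square of the norm of \<open>f - g\<close>.
\<close>

lemma hardy2_diff_norm_square:
  assumes "f \<in> hardy2" "g \<in> hardy2"
  shows "0 \<le> (hardy2_norm f)\<^sup>2 - 2 * Re (hardy2_inner f g) + (hardy2_norm g)\<^sup>2"
proof -
  have "(\<lambda>n. (cmod (taylor_coeff f n))\<^sup>2 - 2 * Re (taylor_coeff f n * cnj (taylor_coeff g n)) + (cmod (taylor_coeff g n))\<^sup>2) sums
      ((hardy2_norm f)\<^sup>2 - 2 * Re (hardy2_inner f g) + (hardy2_norm g)\<^sup>2)"
    by (rule sums_add[OF sums_diff[OF hardy2_norm_sums[OF assms(1)]
          sums_mult[OF sums_Re[OF hardy2_inner_sums[OF assms]]]] hardy2_norm_sums[OF assms(2)]])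
  moreover have "0 \<le> (cmod a)\<^sup>2 - 2 * Re (a * cnj b) + (cmod b)\<^sup>2" for a b
    using zero_le_power2[of "Re a - Re b"] zero_le_power2[of "Im a - Im b"]
    by (simp add: cmod_power2 power2_diff)
  ultimately show ?thesis by (rule sums_le[OF _ sums_zero, rotated])
qed

definition szego :: "complex \<Rightarrow> complex \<Rightarrow> complex"
  where "szego w z = 1 / (1 - z * cnj w)"

lemma taylor_szego:
  assumes w: "w \<in> \<bbbD>" shows "taylor_coeff (szego w) n = cnj w ^ n"
proof (rule taylor_unique)
  fix z :: complex assume z: "z \<in> \<bbbD>"
  have "cmod (z * cnj w) < 1 * 1"
    unfolding norm_mult complex_mod_cnj using z w by (intro mult_strict_mono') auto
  from geometric_sums[of "z * cnj w"] this show "(\<lambda>n. cnj w ^ n * z ^ n) sums szego w z"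
    by (simp add: szego_def power_mult_distrib mult.commute)
qed

lemma szego_hardy2:
  assumes w: "w \<in> \<bbbD>" shows "szego w \<in> hardy2"
  unfolding hardy2_iff
proof
  have "1 - z * cnj w \<noteq> 0" if "z \<in> \<bbbD>" for z
  proof -
    have "cmod (z * cnj w) < 1 * 1"
      unfolding norm_mult complex_mod_cnj using that w by (intro mult_strict_mono') auto
    then show ?thesis by auto
  qed
  then show "szego w holomorphic_on \<bbbD>" unfolding szego_def by (intro holomorphic_intros) auto
  have "(cmod w)\<^sup>2 < 1" using w by (simp add: power_less_one_iff)
  then have "summable (\<lambda>n. ((cmod w)\<^sup>2) ^ n)" by (intro summable_geometric) simp
  then show "summable (\<lambda>n. (cmod (taylor_coeff (szego w) n))\<^sup>2)"
    unfolding taylor_szego[OF w] by (simp add: norm_power mult.commute flip: power_mult)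
qed

lemma hardy2_inner_szego:
  assumes "f \<in> hardy2" "w \<in> \<bbbD>" shows "hardy2_inner f (szego w) = f w"
proof -
  have "(\<lambda>n. taylor_coeff f n * w ^ n) sums hardy2_inner f (szego w)"
    using hardy2_inner_sums[OF assms(1) szego_hardy2[OF assms(2)]] by (simp add: taylor_szego[OF assms(2)])
  then show ?thesis using taylor_sums[OF hardy2_holomorphic[OF assms(1)] assms(2)] sums_unique2 by blast
qed

section \<open>Positivity of the Pick kernel of a Schur function\<close>

lemma circle_mean_mono:
  assumes "continuous_on {0..2*pi} (\<lambda>t. f (of_real r * cis t))"
    and "continuous_on {0..2*pi} (\<lambda>t. g (of_real r * cis t))"
    and "\<And>t. (f (of_real r * cis t) :: real) \<le> g (of_real r * cis t)"
  shows "circle_mean f r \<le> circle_mean g r"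
  unfolding circle_mean_def
  by (intro scaleR_left_mono integral_le integrable_continuous_real assms) auto

text \<open>
  The pointwise inequality \<open>\<parallel>\<Sigma> F\<parallel> \<le> \<parallel>F\<parallel>\<close>, integrated over circles.
\<close>

lemma schur_function_contracts_hardy2:
  fixes \<Sigma> :: "complex \<Rightarrow> complex^2^2"
  assumes \<Sigma>: "matrix_schur_function \<Sigma>" and F: "\<And>m. F m \<in> hardy2"
  defines "G \<equiv> \<lambda>l z. \<Sum>m\<in>UNIV. \<Sigma> z $ l $ m * F m z"
  shows "G l \<in> hardy2" "(\<Sum>l\<in>UNIV. (hardy2_norm (G l))\<^sup>2) \<le> (\<Sum>m\<in>UNIV. (hardy2_norm (F m))\<^sup>2)"
proof -
  have holF: "F m holomorphic_on \<bbbD>" for m using F by (rule hardy2_holomorphic)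
  have holG: "G l holomorphic_on \<bbbD>" for l
    unfolding G_def using \<Sigma> by (intro holomorphic_intros holF) (auto simp: matrix_schur_function_def)
  have pw: "(\<Sum>l\<in>UNIV. (cmod (G l z))\<^sup>2) \<le> (\<Sum>m\<in>UNIV. (cmod (F m z))\<^sup>2)" if "z \<in> \<bbbD>" for z
  proof -
    have "norm (\<Sigma> z *v (\<chi> m. F m z)) \<le> norm (\<chi> m. F m z)"
      using \<Sigma> that unfolding matrix_schur_function_def by blast
    then have "(norm (\<Sigma> z *v (\<chi> m. F m z)))\<^sup>2 \<le> (norm (\<chi> m. F m z))\<^sup>2" by (intro power_mono) auto
    then show ?thesis unfolding norm_vec2_sq by (simp add: matrix_vector_mult_def G_def)
  qed
  have sum_eq: "circle_mean (\<lambda>z. \<Sum>l\<in>UNIV. (cmod (h l z))\<^sup>2) r = (\<Sum>l\<in>UNIV. circle_mean (\<lambda>z. (cmod (h l z))\<^sup>2) r)"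
    if "\<And>l. h l holomorphic_on \<bbbD>" "r \<in> {0..<1}" for r and h :: "2 \<Rightarrow> complex \<Rightarrow> complex"
    using that by (intro circle_mean_sum integrable_continuous_real continuous_intros continuous_on_circle) auto
  have means: "(\<Sum>l\<in>UNIV. circle_mean (\<lambda>z. (cmod (G l z))\<^sup>2) r) \<le> (\<Sum>m\<in>UNIV. circle_mean (\<lambda>z. (cmod (F m z))\<^sup>2) r)"
    if r: "r \<in> {0..<1}" for r
    unfolding sum_eq[OF holG r, symmetric] sum_eq[OF holF r, symmetric]
    using r by (intro circle_mean_mono continuous_intros continuous_on_circle holF holG pw) (auto simp: norm_mult)
  show mem: "G l \<in> hardy2" for l
  proof (rule hardy2_normI(1)[OF holG])
    fix r :: real assume r: "r \<in> {0..<1}"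
    have nonneg: "0 \<le> circle_mean (\<lambda>z. (cmod (G l z))\<^sup>2) r" for l
      unfolding circle_mean_def
      by (intro scaleR_nonneg_nonneg integral_nonneg integrable_continuous_real continuous_intros
          continuous_on_circle holG) (use r in auto)
    have "circle_mean (\<lambda>z. (cmod (G l z))\<^sup>2) r \<le> (\<Sum>l\<in>UNIV. circle_mean (\<lambda>z. (cmod (G l z))\<^sup>2) r)"
      by (rule member_le_sum) (use nonneg in auto)
    also note means[OF r]
    also have "(\<Sum>m\<in>UNIV. circle_mean (\<lambda>z. (cmod (F m z))\<^sup>2) r) \<le> (\<Sum>m\<in>UNIV. (hardy2_norm (F m))\<^sup>2)"
      by (intro sum_mono circle_mean_le_hardy2_norm F r)
    finally show "circle_mean (\<lambda>z. (cmod (G l z))\<^sup>2) r \<le> (sqrt (\<Sum>m\<in>UNIV. (hardy2_norm (F m))\<^sup>2))\<^sup>2"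
      by (simp add: sum_nonneg)
  qed (simp add: sum_nonneg)
  show "(\<Sum>l\<in>UNIV. (hardy2_norm (G l))\<^sup>2) \<le> (\<Sum>m\<in>UNIV. (hardy2_norm (F m))\<^sup>2)"
  proof (rule tendsto_le)
    show "((\<lambda>r. \<Sum>l\<in>UNIV. circle_mean (\<lambda>z. (cmod (G l z))\<^sup>2) r) \<longlongrightarrow> (\<Sum>l\<in>UNIV. (hardy2_norm (G l))\<^sup>2)) (at_left 1)"
      by (intro tendsto_sum circle_mean_norm_tendsto mem)
    show "((\<lambda>r. \<Sum>l\<in>UNIV. circle_mean (\<lambda>z. (cmod (F l z))\<^sup>2) r) \<longlongrightarrow> (\<Sum>l\<in>UNIV. (hardy2_norm (F l))\<^sup>2)) (at_left 1)"
      by (intro tendsto_sum circle_mean_norm_tendsto F)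
    have "\<forall>\<^sub>F r in at_left (1::real). r \<in> {0<..<1}" using eventually_at_left_real[of 0 1] by simp
    then show "\<forall>\<^sub>F r in at_left 1. (\<Sum>l\<in>UNIV. circle_mean (\<lambda>z. (cmod (G l z))\<^sup>2) r) \<le>
        (\<Sum>m\<in>UNIV. circle_mean (\<lambda>z. (cmod (F m z))\<^sup>2) r)"
      by eventually_elim (use means in auto)
  qed simp
qed

text \<open>
  The converse half of the Nevanlinna-Pick theorem. The adjoint of multiplication by \<open>\<Sigma>\<close> maps the
  Szego kernel at \<open>\<zeta> i\<close> with vector coefficient \<open>u i\<close> to the one with coefficient \<open>v i\<close>. Hence, for the
  combinations \<open>K u\<close> and \<open>K v\<close> of these kernels, the inner product of \<open>\<Sigma> (K v)\<close> and \<open>K u\<close> is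
  \<open>\<parallel>K v\<parallel>\<^sup>2\<close>, and expanding \<open>\<parallel>K u - \<Sigma> (K v)\<parallel>\<^sup>2 \<ge> 0\<close> shows that \<open>\<parallel>K u\<parallel>\<^sup>2 - \<parallel>K v\<parallel>\<^sup>2\<close>, the form of
  the Pick kernel, is nonnegative.
\<close>

lemma tangential_interpolation_necessary:
  fixes \<zeta> :: "'a \<Rightarrow> complex" and u v :: "'a \<Rightarrow> complex^2"
  assumes \<Sigma>: "matrix_schur_function \<Sigma>" and \<zeta>: "\<zeta> ` X \<subseteq> \<bbbD>"
    and v: "\<And>z. z \<in> X \<Longrightarrow> u z v* \<Sigma> (\<zeta> z) = v z"
  shows "positive_kernel X (pick_kernel \<zeta> u v)"
  unfolding positive_kernel_def
proof (intro allI impI, elim conjE)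
  fix I and c :: "'a \<Rightarrow> complex" assume I: "finite I" "I \<subseteq> X"
  have \<zeta>I: "\<zeta> i \<in> \<bbbD>" if "i \<in> I" for i using that I(2) \<zeta> by blast
  \<comment> \<open>combinations of Szego kernels\<close>
  define K where "K a l z = (\<Sum>j\<in>I. (c j * cnj (a j $ l)) * szego (\<zeta> j) z)" for a :: "'a \<Rightarrow> complex^2" and l z
  define \<Sigma>K where "\<Sigma>K l z = (\<Sum>m\<in>UNIV. \<Sigma> z $ l $ m * K v m z)" for l z
  have K: "K a l \<in> hardy2" for a l
    unfolding K_def by (intro hardy2_sum I szego_hardy2 \<zeta>I)
  note \<Sigma>K = schur_function_contracts_hardy2[OF \<Sigma>, of "K v", OF K, folded \<Sigma>K_def]
  have inner_K: "hardy2_inner h (K a l) = (\<Sum>i\<in>I. cnj (c i) * a i $ l * h (\<zeta> i))" if "h \<in> hardy2" for h a l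
  proof -
    have "hardy2_inner h (K a l) = (\<Sum>j\<in>I. cnj (c j * cnj (a j $ l)) * hardy2_inner h (szego (\<zeta> j)))"
      unfolding K_def by (intro hardy2_inner_sum_right I szego_hardy2 \<zeta>I that)
    then show ?thesis using hardy2_inner_szego[OF that \<zeta>I] by simp
  qed
  have norm_K: "of_real (\<Sum>l\<in>UNIV. (hardy2_norm (K a l))\<^sup>2) =
      sesq I (\<lambda>i j. (\<Sum>l\<in>UNIV. a i $ l * cnj (a j $ l)) / (1 - \<zeta> i * cnj (\<zeta> j))) c c" for a
  proof -
    have "of_real (\<Sum>l\<in>UNIV. (hardy2_norm (K a l))\<^sup>2) = (\<Sum>l\<in>UNIV. \<Sum>i\<in>I. cnj (c i) * a i $ l * K a l (\<zeta> i))"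
      unfolding of_real_sum hardy2_norm_square_inner[OF K, symmetric] inner_K[OF K] ..
    also have "\<dots> = (\<Sum>l\<in>UNIV. sesq I (\<lambda>i j. a i $ l * cnj (a j $ l) / (1 - \<zeta> i * cnj (\<zeta> j))) c c)"
      unfolding K_def szego_def sesq_def by (simp add: sum_distrib_left mult_ac)
    also have "\<dots> = sesq I (\<lambda>i j. \<Sum>l\<in>UNIV. a i $ l * cnj (a j $ l) / (1 - \<zeta> i * cnj (\<zeta> j))) c c"
      by (rule sesq_sum[symmetric])
    finally show ?thesis by (simp only: sum_divide_distrib)
  qed
  have cross: "(\<Sum>l\<in>UNIV. hardy2_inner (\<Sigma>K l) (K u l)) = of_real (\<Sum>m\<in>UNIV. (hardy2_norm (K v m))\<^sup>2)"
  proof -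
    have "(\<Sum>l\<in>UNIV. hardy2_inner (\<Sigma>K l) (K u l)) =
        (\<Sum>i\<in>I. cnj (c i) * (\<Sum>l\<in>UNIV. u i $ l * \<Sigma>K l (\<zeta> i)))"
      unfolding inner_K[OF \<Sigma>K(1)] by (subst sum.swap) (simp add: sum_distrib_left mult_ac)
    also have "\<dots> = (\<Sum>i\<in>I. cnj (c i) * (\<Sum>m\<in>UNIV. v i $ m * K v m (\<zeta> i)))"
    proof (rule sum.cong[OF refl])
      fix i assume "i \<in> I"
      then have "v i = u i v* \<Sigma> (\<zeta> i)" using v I(2) by auto
      then have vi: "v i $ m = (\<Sum>l\<in>UNIV. u i $ l * \<Sigma> (\<zeta> i) $ l $ m)" for m
        by (simp add: vector_matrix_mult_def mult.commute)
      have "(\<Sum>l\<in>UNIV. u i $ l * \<Sigma>K l (\<zeta> i)) = (\<Sum>m\<in>UNIV. v i $ m * K v m (\<zeta> i))"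
        unfolding vi \<Sigma>K_def sum_distrib_left sum_distrib_right by (subst sum.swap) (simp only: mult_ac)
      then show "cnj (c i) * (\<Sum>l\<in>UNIV. u i $ l * \<Sigma>K l (\<zeta> i)) = cnj (c i) * (\<Sum>m\<in>UNIV. v i $ m * K v m (\<zeta> i))"
        by (simp only:)
    qed
    also have "\<dots> = (\<Sum>m\<in>UNIV. hardy2_inner (K v m) (K v m))"
      unfolding inner_K[OF K] by (subst sum.swap) (simp add: sum_distrib_left mult_ac)
    finally show ?thesis by (simp add: hardy2_norm_square_inner[OF K])
  qed
  have "0 \<le> (\<Sum>l\<in>UNIV. (hardy2_norm (\<Sigma>K l))\<^sup>2 - 2 * Re (hardy2_inner (\<Sigma>K l) (K u l)) + (hardy2_norm (K u l))\<^sup>2)"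
    by (intro sum_nonneg hardy2_diff_norm_square \<Sigma>K(1) K)
  also have "\<dots> = (\<Sum>l\<in>UNIV. (hardy2_norm (\<Sigma>K l))\<^sup>2) - 2 * Re (\<Sum>l\<in>UNIV. hardy2_inner (\<Sigma>K l) (K u l))
      + (\<Sum>l\<in>UNIV. (hardy2_norm (K u l))\<^sup>2)"
    by (simp only: sum.distrib sum_subtractf sum_distrib_left Re_sum)
  also have "\<dots> \<le> (\<Sum>l\<in>UNIV. (hardy2_norm (K u l))\<^sup>2) - (\<Sum>l\<in>UNIV. (hardy2_norm (K v l))\<^sup>2)"
    unfolding cross using \<Sigma>K(2) by simp
  also have "\<dots> = Re (of_real (\<Sum>l\<in>UNIV. (hardy2_norm (K u l))\<^sup>2) - of_real (\<Sum>l\<in>UNIV. (hardy2_norm (K v l))\<^sup>2))"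
    by simp
  also have "\<dots> = Re (sesq I (pick_kernel \<zeta> u v) c c)"
    unfolding norm_K sesq_diff[symmetric] pick_kernel_def[abs_def] diff_divide_distrib ..
  finally show "0 \<le> Re (sesq I (pick_kernel \<zeta> u v) c c)" .
qed

section \<open>Contractive multipliers and positive kernels\<close>

lemma reproducing_kernel_inner_sum:
  assumes k: "reproducing_kernel H k" and H: "H \<subseteq> hardy2" and F: "finite F" "F \<subseteq> \<bbbD>" and f: "f \<in> H"
  shows "hardy2_inner f (\<lambda>z. \<Sum>w\<in>F. c w * k z w) = (\<Sum>w\<in>F. cnj (c w) * f w)"
proof -
  have "hardy2_inner f (\<lambda>z. \<Sum>w\<in>F. c w * k z w) = (\<Sum>w\<in>F. cnj (c w) * hardy2_inner f (\<lambda>z. k z w))"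
    by (rule hardy2_inner_sum_right) (use assms in \<open>auto simp: reproducing_kernel_def subset_iff\<close>)
  also have "\<dots> = (\<Sum>w\<in>F. cnj (c w) * f w)"
    using k F(2) f by (intro sum.cong refl) (auto simp: reproducing_kernel_def)
  finally show ?thesis .
qed

lemma reproducing_kernel_norm_sum:
  assumes k: "reproducing_kernel H k" and H: "H \<subseteq> hardy2" and F: "finite F" "F \<subseteq> \<bbbD>"
  shows "(\<lambda>z. \<Sum>w\<in>F. c w * k z w) \<in> hardy2"
    and "of_real ((hardy2_norm (\<lambda>z. \<Sum>w\<in>F. c w * k z w))\<^sup>2) = sesq F k c c"
proof -
  have kH: "(\<lambda>z. k z w) \<in> H" if "w \<in> F" for w
    using k F(2) that by (auto simp: reproducing_kernel_def)
  then have kh: "(\<lambda>z. k z w) \<in> hardy2" if "w \<in> F" for w using H that by blast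
  show mem: "(\<lambda>z. \<Sum>w\<in>F. c w * k z w) \<in> hardy2"
    using hardy2_sum[OF F(1), of "\<lambda>w z. k z w"] kh by simp
  have "of_real ((hardy2_norm (\<lambda>z. \<Sum>w\<in>F. c w * k z w))\<^sup>2) =
      hardy2_inner (\<lambda>z. \<Sum>w\<in>F. c w * k z w) (\<lambda>z. \<Sum>w\<in>F. c w * k z w)"
    by (rule hardy2_norm_square_inner[OF mem, symmetric])
  also have "\<dots> = (\<Sum>w\<in>F. c w * hardy2_inner (\<lambda>z. k z w) (\<lambda>z. \<Sum>w\<in>F. c w * k z w))"
    by (rule hardy2_inner_sum_left[OF F(1) kh mem])
  also have "\<dots> = (\<Sum>w\<in>F. c w * (\<Sum>z\<in>F. cnj (c z) * k z w))"
    using reproducing_kernel_inner_sum[OF k H F kH] by (intro sum.cong refl) simp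
  also have "\<dots> = sesq F k c c"
    unfolding sesq_def by (subst sum.swap) (simp add: sum_distrib_left mult_ac)
  finally show "of_real ((hardy2_norm (\<lambda>z. \<Sum>w\<in>F. c w * k z w))\<^sup>2) = sesq F k c c" .
qed

text \<open>
  The adjoint of the multiplier maps \<open>k\<^sub>2(_, w)\<close> to \<open>cnj (s w) k\<^sub>1(_, w)\<close>. If \<open>g\<close> is a combination of the
  former and \<open>f\<close> its image, then the inner product of \<open>s f\<close> and \<open>g\<close> is \<open>\<parallel>f\<parallel>\<^sup>2\<close>, and
  \<open>\<parallel>g - s f\<parallel>\<^sup>2 \<ge> 0\<close> yields \<open>\<parallel>f\<parallel> \<le> \<parallel>g\<parallel>\<close>.
\<close>

lemma contractive_multiplier_imp_positive_kernel:
  assumes k1: "reproducing_kernel H\<^sub>1 k\<^sub>1" and H1: "H\<^sub>1 \<subseteq> hardy2"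
    and k2: "reproducing_kernel H\<^sub>2 k\<^sub>2" and H2: "H\<^sub>2 \<subseteq> hardy2"
    and comb: "\<And>F c. finite F \<Longrightarrow> F \<subseteq> \<bbbD> \<Longrightarrow> (\<lambda>z. \<Sum>w\<in>F. c w * k\<^sub>1 z w) \<in> H\<^sub>1"
    and s: "contractive_multiplier s H\<^sub>1 H\<^sub>2"
  shows "positive_kernel \<bbbD> (\<lambda>z w. k\<^sub>2 z w - s z * cnj (s w) * k\<^sub>1 z w)"
  unfolding positive_kernel_def
proof (intro allI impI, elim conjE)
  fix F :: "complex set" and c assume F: "finite F" "F \<subseteq> \<bbbD>"
  define f where "f z = (\<Sum>w\<in>F. (c w * cnj (s w)) * k\<^sub>1 z w)" for z
  define g where "g z = (\<Sum>w\<in>F. c w * k\<^sub>2 z w)" for z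
  have f: "f \<in> H\<^sub>1" unfolding f_def by (rule comb[OF F])
  have sf: "(\<lambda>z. s z * f z) \<in> H\<^sub>2" and le: "hardy2_norm (\<lambda>z. s z * f z) \<le> hardy2_norm f"
    using s f by (auto simp: contractive_multiplier_def)
  have nf: "of_real ((hardy2_norm f)\<^sup>2) = sesq F (\<lambda>z w. s z * cnj (s w) * k\<^sub>1 z w) c c"
    unfolding f_def sesq_scale by (rule reproducing_kernel_norm_sum(2)[OF k1 H1 F])
  have g: "g \<in> hardy2" and ng: "of_real ((hardy2_norm g)\<^sup>2) = sesq F k\<^sub>2 c c"
    unfolding g_def by (rule reproducing_kernel_norm_sum[OF k2 H2 F])+
  have "hardy2_inner (\<lambda>z. s z * f z) g = (\<Sum>w\<in>F. cnj (c w) * (s w * f w))"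
    unfolding g_def by (rule reproducing_kernel_inner_sum[OF k2 H2 F sf])
  also have "\<dots> = (\<Sum>w\<in>F. cnj (c w * cnj (s w)) * f w)" by (simp add: mult.assoc)
  also have "\<dots> = of_real ((hardy2_norm f)\<^sup>2)"
    unfolding nf sesq_scale unfolding f_def sesq_def by (simp only: sum_distrib_left mult_ac)
  finally have inner: "hardy2_inner (\<lambda>z. s z * f z) g = of_real ((hardy2_norm f)\<^sup>2)" .
  have "0 \<le> (hardy2_norm (\<lambda>z. s z * f z))\<^sup>2 - 2 * Re (hardy2_inner (\<lambda>z. s z * f z) g) + (hardy2_norm g)\<^sup>2"
    using sf H2 g by (intro hardy2_diff_norm_square) auto
  moreover have "(hardy2_norm (\<lambda>z. s z * f z))\<^sup>2 \<le> (hardy2_norm f)\<^sup>2"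
    using le sf H2 by (intro power_mono hardy2_norm_nonneg) auto
  ultimately have "0 \<le> (hardy2_norm g)\<^sup>2 - (hardy2_norm f)\<^sup>2"
    unfolding inner by simp
  also have "\<dots> = Re (sesq F k\<^sub>2 c c - sesq F (\<lambda>z w. s z * cnj (s w) * k\<^sub>1 z w) c c)"
    unfolding nf[symmetric] ng[symmetric] by simp
  finally show "0 \<le> Re (sesq F (\<lambda>z w. k\<^sub>2 z w - s z * cnj (s w) * k\<^sub>1 z w) c c)"
    unfolding sesq_diff .
qed

text \<open>
  A combination \<open>g\<close> of the kernels \<open>k\<^sub>2(_, w)\<close>, \<open>w \<in> F\<close>, that nearly agrees with \<open>s f\<close> on \<open>F\<close> and has
  norm at most \<open>\<parallel>f\<parallel>\<close>. Its coefficients solve the system with the Gram matrix shifted by \<open>\<epsilon>\<close>, which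
  keeps the system solvable if the kernels are linearly dependent.
\<close>

lemma approximate_multiplier_interpolation:
  assumes k1: "reproducing_kernel H\<^sub>1 k\<^sub>1" and H1: "H\<^sub>1 \<subseteq> hardy2"
    and k2: "reproducing_kernel H\<^sub>2 k\<^sub>2" and H2: "H\<^sub>2 \<subseteq> hardy2"
    and pos: "positive_kernel X (\<lambda>z w. k\<^sub>2 z w - s z * cnj (s w) * k\<^sub>1 z w)"
    and F: "finite F" "F \<subseteq> X" and X: "X \<subseteq> \<bbbD>"
    and f: "f \<in> H\<^sub>1" and \<epsilon>: "0 < \<epsilon>"
  shows "\<exists>g\<in>hardy2. hardy2_norm g \<le> hardy2_norm f \<and>
           (\<forall>z\<in>F. (cmod (s z * f z - g z))\<^sup>2 \<le> \<epsilon> * (hardy2_norm f)\<^sup>2)"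
proof -
  have FD: "F \<subseteq> \<bbbD>" using F(2) X by blast
  define M where "M z w = k\<^sub>2 z w + (if z = w then of_real \<epsilon> else 0)" for z w
  have formM: "sesq F M c c = of_real ((hardy2_norm (\<lambda>z. \<Sum>w\<in>F. c w * k\<^sub>2 z w))\<^sup>2 +
      \<epsilon> * (\<Sum>z\<in>F. (cmod (c z))\<^sup>2))" for c
  proof -
    have "sesq F M c c = sesq F k\<^sub>2 c c + (\<Sum>i\<in>F. of_real \<epsilon> * cnj (c i) * c i)"
      unfolding M_def sesq_add using sesq_delta[OF F(1), of "\<lambda>_. of_real \<epsilon>"] by simp
    also have "(\<Sum>i\<in>F. of_real \<epsilon> * cnj (c i) * c i) = of_real (\<epsilon> * (\<Sum>i\<in>F. (cmod (c i))\<^sup>2))"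
      unfolding of_real_mult of_real_sum complex_norm_square by (simp add: sum_distrib_left mult_ac)
    finally show ?thesis
      unfolding reproducing_kernel_norm_sum(2)[OF k2 H2 F(1) FD, symmetric] by simp
  qed
  \<comment> \<open>a system with constant coefficients: the parameter ranges over a single point\<close>
  have "\<exists>h. (\<forall>z\<in>F. h z holomorphic_on {0::complex}) \<and>
      (\<forall>x\<in>{0}. \<forall>z\<in>F. (\<Sum>w\<in>F. M z w * h w x) = s z * f z)"
  proof (rule holomorphic_accretive_solution[OF F(1)])
    fix c :: "complex \<Rightarrow> complex" assume c: "\<exists>z\<in>F. c z \<noteq> 0"
    then have "0 < (\<Sum>z\<in>F. (cmod (c z))\<^sup>2)" using F(1) by (auto intro!: sum_pos2)
    then show "0 < Re (sesq F M c c)"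
      unfolding formM using \<epsilon> by (simp add: add_nonneg_pos)
  qed (rule holomorphic_on_const)+
  then obtain c\<^sub>0 where c\<^sub>0: "\<forall>x\<in>{0::complex}. \<forall>z\<in>F. (\<Sum>w\<in>F. M z w * c\<^sub>0 w x) = s z * f z" by blast
  define c where "c w = c\<^sub>0 w 0" for w
  have c: "(\<Sum>w\<in>F. M z w * c w) = s z * f z" if "z \<in> F" for z
    using c\<^sub>0 that unfolding c_def by simp
  define g where "g z = (\<Sum>w\<in>F. c w * k\<^sub>2 z w)" for z
  define h where "h z = (\<Sum>w\<in>F. (c w * cnj (s w)) * k\<^sub>1 z w)" for z
  have g: "g \<in> hardy2" and ng: "of_real ((hardy2_norm g)\<^sup>2) = sesq F k\<^sub>2 c c"
    unfolding g_def by (rule reproducing_kernel_norm_sum[OF k2 H2 F(1) FD])+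
  have h: "h \<in> hardy2" and nh: "of_real ((hardy2_norm h)\<^sup>2) = sesq F (\<lambda>z w. s z * cnj (s w) * k\<^sub>1 z w) c c"
    unfolding h_def sesq_scale by (rule reproducing_kernel_norm_sum[OF k1 H1 F(1) FD])+
  have gF: "s z * f z - g z = of_real \<epsilon> * c z" if "z \<in> F" for z
  proof -
    have "s z * f z = (\<Sum>w\<in>F. c w * k\<^sub>2 z w + (if z = w then of_real \<epsilon> * c w else 0))"
      unfolding c[OF that, symmetric] M_def by (intro sum.cong refl) (simp add: algebra_simps)
    then show ?thesis using F(1) that by (simp add: sum.distrib g_def)
  qed
  have "0 \<le> Re (sesq F k\<^sub>2 c c - sesq F (\<lambda>z w. s z * cnj (s w) * k\<^sub>1 z w) c c)"
    using pos F unfolding positive_kernel_def sesq_diff by blast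
  then have hg: "(hardy2_norm h)\<^sup>2 \<le> (hardy2_norm g)\<^sup>2"
    unfolding nh[symmetric] ng[symmetric] by simp
  have "hardy2_inner f h = (\<Sum>w\<in>F. cnj (c w * cnj (s w)) * f w)"
    unfolding h_def by (rule reproducing_kernel_inner_sum[OF k1 H1 F(1) FD f])
  also have "\<dots> = (\<Sum>z\<in>F. cnj (c z) * (\<Sum>w\<in>F. M z w * c w))"
    by (intro sum.cong refl) (simp add: c)
  also have "\<dots> = sesq F M c c" unfolding sesq_def by (simp only: sum_distrib_left mult_ac)
  finally have inner: "Re (hardy2_inner f h) = (hardy2_norm g)\<^sup>2 + \<epsilon> * (\<Sum>z\<in>F. (cmod (c z))\<^sup>2)"
    unfolding formM g_def[symmetric] by simp
  have main: "(hardy2_norm g)\<^sup>2 + 2 * (\<epsilon> * (\<Sum>z\<in>F. (cmod (c z))\<^sup>2)) \<le> (hardy2_norm f)\<^sup>2"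
    using hardy2_diff_norm_square[of f h] f H1 h inner hg by auto
  have nonneg: "0 \<le> \<epsilon> * (\<Sum>z\<in>F. (cmod (c z))\<^sup>2)" using \<epsilon> by (simp add: sum_nonneg)
  have "(hardy2_norm g)\<^sup>2 \<le> (hardy2_norm f)\<^sup>2" using main nonneg by linarith
  then have "hardy2_norm g \<le> hardy2_norm f"
    by (rule power2_le_imp_le) (use f H1 in \<open>blast intro: hardy2_norm_nonneg\<close>)
  moreover have "(cmod (s z * f z - g z))\<^sup>2 \<le> \<epsilon> * (hardy2_norm f)\<^sup>2" if z: "z \<in> F" for z
  proof -
    have "(cmod (s z * f z - g z))\<^sup>2 = \<epsilon> * (\<epsilon> * (cmod (c z))\<^sup>2)"
      unfolding gF[OF z] norm_mult norm_of_real by (simp add: power2_eq_square)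
    also have "\<dots> \<le> \<epsilon> * (\<epsilon> * (\<Sum>z\<in>F. (cmod (c z))\<^sup>2))"
      using \<epsilon> F(1) z by (intro mult_left_mono member_le_sum) auto
    also have "\<dots> \<le> \<epsilon> * (hardy2_norm f)\<^sup>2"
      using main nonneg zero_le_power2[of "hardy2_norm g"] \<epsilon> by (intro mult_left_mono) linarith+
    finally show ?thesis .
  qed
  ultimately show ?thesis using g by blast
qed

lemma hardy2_norm_le_limit:
  assumes hol: "\<And>n. g n \<in> hardy2" and B: "0 \<le> B" "\<And>n. hardy2_norm (g n) \<le> B" and h: "h holomorphic_on \<bbbD>"
    and lim: "\<And>K. compact K \<Longrightarrow> K \<subseteq> \<bbbD> \<Longrightarrow> uniform_limit K g h sequentially"
  shows "h \<in> hardy2" "hardy2_norm h \<le> B"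
proof -
  have "circle_mean (\<lambda>z. (cmod (h z))\<^sup>2) r \<le> B\<^sup>2" if r: "r \<in> {0..<1}" for r
  proof (rule LIMSEQ_le_const2)
    have sub: "cball 0 r \<subseteq> \<bbbD>" using r by auto
    have "(\<lambda>n. circle_mean (\<lambda>z. g n z * cnj (g n z)) r) \<longlonglongrightarrow> circle_mean (\<lambda>z. h z * cnj (h z)) r"
      using r sub by (intro circle_mean_product_tendsto lim)
        (auto intro!: holomorphic_on_imp_continuous_on[OF holomorphic_on_subset[OF hardy2_holomorphic[OF hol] sub]])
    then have "(\<lambda>n. complex_of_real (circle_mean (\<lambda>z. (cmod (g n z))\<^sup>2) r)) \<longlonglongrightarrow>
        complex_of_real (circle_mean (\<lambda>z. (cmod (h z))\<^sup>2) r)"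
      using r by (simp add: circle_mean_norm_square hardy2_holomorphic[OF hol] h)
    then show "(\<lambda>n. circle_mean (\<lambda>z. (cmod (g n z))\<^sup>2) r) \<longlonglongrightarrow> circle_mean (\<lambda>z. (cmod (h z))\<^sup>2) r"
      by (simp only: tendsto_of_real_iff)
    have "circle_mean (\<lambda>z. (cmod (g n z))\<^sup>2) r \<le> B\<^sup>2" for n
    proof -
      have "circle_mean (\<lambda>z. (cmod (g n z))\<^sup>2) r \<le> (hardy2_norm (g n))\<^sup>2"
        by (rule circle_mean_le_hardy2_norm[OF hol r])
      also have "\<dots> \<le> B\<^sup>2" by (intro power_mono B hardy2_norm_nonneg hol)
      finally show ?thesis .
    qed
    then show "\<exists>N. \<forall>n\<ge>N. circle_mean (\<lambda>z. (cmod (g n z))\<^sup>2) r \<le> B\<^sup>2" by blast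
  qed
  from hardy2_normI[OF h B(1) this] show "h \<in> hardy2" "hardy2_norm h \<le> B" by auto
qed

text \<open>
  A locally uniform limit \<open>h\<close> of the approximate
  interpolants along a dense sequence in \<open>X\<close> has norm at most \<open>\<parallel>f\<parallel>\<close> and coincides with \<open>s f\<close> on this
  sequence, hence everywhere by the identity theorem.
\<close>

lemma positive_kernel_imp_multiplier:
  assumes k1: "reproducing_kernel H\<^sub>1 k\<^sub>1" and H1: "H\<^sub>1 \<subseteq> hardy2"
    and k2: "reproducing_kernel H\<^sub>2 k\<^sub>2" and H2: "H\<^sub>2 \<subseteq> hardy2"
    and X: "X \<subseteq> \<bbbD>" "open X" "X \<noteq> {}"
    and pos: "positive_kernel X (\<lambda>z w. k\<^sub>2 z w - s z * cnj (s w) * k\<^sub>1 z w)"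
    and s: "s holomorphic_on \<bbbD>" and f: "f \<in> H\<^sub>1"
  shows "(\<lambda>z. s z * f z) \<in> hardy2" "hardy2_norm (\<lambda>z. s z * f z) \<le> hardy2_norm f"
proof -
  have fh: "f \<in> hardy2" using f H1 by blast
  have B0: "0 \<le> hardy2_norm f" by (rule hardy2_norm_nonneg[OF fh])
  obtain T where T: "countable T" "T \<subseteq> X" "X \<subseteq> closure T" using separable by blast
  define F where "F n = from_nat_into T ` {..n} \<inter> T" for n
  have "\<exists>g\<in>hardy2. hardy2_norm g \<le> hardy2_norm f \<and>
      (\<forall>z\<in>F n. (cmod (s z * f z - g z))\<^sup>2 \<le> inverse (real (Suc n)) * (hardy2_norm f)\<^sup>2)" for n
    using T(2) by (intro approximate_multiplier_interpolation[OF k1 H1 k2 H2 pos _ _ X(1) f]) (auto simp: F_def)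
  then obtain G where G: "\<And>n. G n \<in> hardy2" "\<And>n. hardy2_norm (G n) \<le> hardy2_norm f"
    and approx: "\<And>n z. z \<in> F n \<Longrightarrow> (cmod (s z * f z - G n z))\<^sup>2 \<le> inverse (real (Suc n)) * (hardy2_norm f)\<^sup>2"
    by metis
  obtain h r where h: "h holomorphic_on \<bbbD>" and r: "strict_mono (r :: nat \<Rightarrow> nat)"
    and lim: "\<And>x. x \<in> \<bbbD> \<Longrightarrow> (\<lambda>n. G (r n) x) \<longlonglongrightarrow> h x"
    and ulim: "\<And>K. compact K \<Longrightarrow> K \<subseteq> \<bbbD> \<Longrightarrow> uniform_limit K (G \<circ> r) h sequentially"
  proof (rule Montel[of \<bbbD> "range G" G])
    fix K :: "complex set" assume K: "compact K" "K \<subseteq> \<bbbD>"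
    have "1 - (cmod z)\<^sup>2 \<noteq> 0" if "z \<in> K" for z
      using that K(2) power_less_one_iff[of "cmod z" 2] by fastforce
    then have "continuous_on K (\<lambda>z. ((hardy2_norm f)\<^sup>2 + 1 / (1 - (cmod z)\<^sup>2)) / 2)"
      by (intro continuous_intros) auto
    then have "bounded ((\<lambda>z. ((hardy2_norm f)\<^sup>2 + 1 / (1 - (cmod z)\<^sup>2)) / 2) ` K)"
      using K(1) compact_continuous_image compact_imp_bounded by blast
    then obtain C where C: "\<forall>x\<in>(\<lambda>z. ((hardy2_norm f)\<^sup>2 + 1 / (1 - (cmod z)\<^sup>2)) / 2) ` K. norm x \<le> C"
      unfolding bounded_iff by blast
    have "cmod (G n z) \<le> C" if z: "z \<in> K" for n z
    proof -
      have "cmod (G n z) \<le> ((hardy2_norm (G n))\<^sup>2 + 1 / (1 - (cmod z)\<^sup>2)) / 2"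
        using z K(2) by (intro hardy2_pointwise_bound G) auto
      also have "\<dots> \<le> ((hardy2_norm f)\<^sup>2 + 1 / (1 - (cmod z)\<^sup>2)) / 2"
        by (intro divide_right_mono add_right_mono power_mono G hardy2_norm_nonneg) auto
      finally show ?thesis using C z by force
    qed
    then show "\<exists>B. \<forall>h\<in>range G. \<forall>z\<in>K. cmod (h z) \<le> B" by blast
  qed (use G hardy2_holomorphic in auto)
  have norm_h: "h \<in> hardy2" "hardy2_norm h \<le> hardy2_norm f"
    by (rule hardy2_norm_le_limit[of "\<lambda>n. G (r n)", OF G(1) B0 G(2) h ulim[unfolded o_def]]; assumption)+
  have on_T: "s z * f z - h z = 0" if z: "z \<in> T" for z
  proof -
    let ?d = "\<lambda>n. s z * f z - G (r n) z"
    have zD: "z \<in> \<bbbD>" using z T(2) X(1) by blast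
    have "?d \<longlonglongrightarrow> s z * f z - h z" by (intro tendsto_intros lim zD)
    moreover have "?d \<longlonglongrightarrow> 0"
    proof -
      obtain N where N: "from_nat_into T N = z" using from_nat_into_surj[OF T(1) z] by blast
      have "\<forall>\<^sub>F n in sequentially. (cmod (?d n))\<^sup>2 \<le> inverse (real (Suc (r n))) * (hardy2_norm f)\<^sup>2"
      proof (rule eventually_sequentiallyI[of N])
        fix n assume "N \<le> n"
        then have "N \<le> r n" using seq_suble[OF r, of n] by simp
        then have "z \<in> F (r n)" using N z by (auto simp: F_def)
        then show "(cmod (?d n))\<^sup>2 \<le> inverse (real (Suc (r n))) * (hardy2_norm f)\<^sup>2" by (rule approx)
      qed
      moreover have "(\<lambda>n. inverse (real (Suc (r n))) * (hardy2_norm f)\<^sup>2) \<longlonglongrightarrow> 0"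
        using LIMSEQ_subseq_LIMSEQ[OF LIMSEQ_inverse_real_of_nat r]
        by (intro tendsto_mult_left_zero) (simp add: o_def)
      ultimately have "(\<lambda>n. (cmod (?d n))\<^sup>2) \<longlonglongrightarrow> 0"
        by (rule tendsto_sandwich[of "\<lambda>_. 0", rotated, OF _ tendsto_const]) auto
      then have "(\<lambda>n. sqrt ((cmod (?d n))\<^sup>2)) \<longlonglongrightarrow> sqrt 0" by (rule tendsto_real_sqrt)
      then show ?thesis by (simp add: tendsto_norm_zero_iff)
    qed
    ultimately show ?thesis using LIMSEQ_unique by blast
  qed
  obtain \<xi> where \<xi>: "\<xi> \<in> X" using X(3) by blast
  then have "\<xi> islimpt X" using X(2) by (intro interior_limit_point) (simp add: interior_open)
  then have "\<xi> islimpt T" using T(3) islimpt_subset limpt_of_closure by blast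
  have eq: "s z * f z = h z" if "z \<in> \<bbbD>" for z
  proof -
    have "s z * f z - h z = 0"
      by (rule analytic_continuation[of "\<lambda>z. s z * f z - h z" \<bbbD> T \<xi>])
         (use \<xi> X T \<open>\<xi> islimpt T\<close> on_T that in \<open>auto intro!: holomorphic_intros s h hardy2_holomorphic[OF fh]\<close>)
    then show ?thesis by simp
  qed
  have "circle_mean (\<lambda>z. (cmod (s z * f z))\<^sup>2) r \<le> (hardy2_norm f)\<^sup>2" if r: "r \<in> {0..<1}" for r
  proof -
    have "circle_mean (\<lambda>z. (cmod (s z * f z))\<^sup>2) r = circle_mean (\<lambda>z. (cmod (h z))\<^sup>2) r"
      unfolding circle_mean_def using r by (intro arg_cong2[where f = scaleR] refl integral_cong) (simp add: eq norm_mult)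
    also have "\<dots> \<le> (hardy2_norm h)\<^sup>2" by (rule circle_mean_le_hardy2_norm[OF norm_h(1) r])
    also have "\<dots> \<le> (hardy2_norm f)\<^sup>2" by (intro power_mono norm_h hardy2_norm_nonneg)
    finally show ?thesis .
  qed
  from hardy2_normI[OF _ B0 this]
  show "(\<lambda>z. s z * f z) \<in> hardy2" "hardy2_norm (\<lambda>z. s z * f z) \<le> hardy2_norm f"
    by (auto intro!: holomorphic_intros s hardy2_holomorphic[OF fh])
qed

section \<open>Blaschke products and the Green's function\<close>

lemma blaschke_denominator_nonzero:
  assumes "a \<in> \<bbbD>" "z \<in> \<bbbD>" shows "1 - cnj a * z \<noteq> 0"
proof -
  have "cmod (cnj a * z) < 1 * 1"
    unfolding norm_mult complex_mod_cnj using assms by (intro mult_strict_mono') auto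
  then show ?thesis by auto
qed

lemma blaschke_factor_holomorphic:
  assumes "a \<in> \<bbbD>" shows "blaschke_factor a holomorphic_on \<bbbD>"
proof (cases "a = 0")
  case True
  then show ?thesis unfolding blaschke_factor_def by (simp add: holomorphic_on_ident)
next
  case False
  then show ?thesis
    unfolding blaschke_factor_def using blaschke_denominator_nonzero[OF assms]
    by (auto intro!: holomorphic_intros)
qed

lemma blaschke_factor_eq_0_iff:
  assumes "a \<in> \<bbbD>" "z \<in> \<bbbD>" shows "blaschke_factor a z = 0 \<longleftrightarrow> z = a"
proof -
  have "blaschke_factor a z = 0 \<longleftrightarrow> a - z = 0"
    using blaschke_denominator_nonzero[OF assms] by (simp add: blaschke_factor_def)
  then show ?thesis by auto
qed

lemma blaschke_factor_near_1:
  assumes a: "a \<in> \<bbbD>" "a \<noteq> 0" and z: "cmod z \<le> R" and R: "R < 1"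
  shows "cmod (blaschke_factor a z - 1) \<le> 2 / (1 - R) * (1 - cmod a)"
proof -
  have zD: "z \<in> \<bbbD>" using z R by simp
  note ne = blaschke_denominator_nonzero[OF a(1) zD]
  have "blaschke_factor a z - 1 = - ((1 - of_real (cmod a)) * (a + of_real (cmod a) * z)) / (a * (1 - cnj a * z))"
  proof -
    have "of_real (cmod a) * of_real (cmod a) = a * cnj a"
      using complex_norm_square[of a] by (simp add: power2_eq_square)
    then show ?thesis using ne a(2) by (simp add: blaschke_factor_def field_simps)
  qed
  also have "cmod \<dots> = (1 - cmod a) * cmod (a + of_real (cmod a) * z) / (cmod a * cmod (1 - cnj a * z))"
  proof -
    have "cmod (1 - of_real (cmod a)) = 1 - cmod a"
      using a(1) norm_of_real[of "1 - cmod a", where 'a = complex] by simp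
    then show ?thesis by (simp add: norm_mult norm_divide)
  qed
  also have "\<dots> \<le> (1 - cmod a) * (cmod a * 2) / (cmod a * (1 - R))"
  proof (intro frac_le mult_left_mono mult_nonneg_nonneg mult_pos_pos)
    have "cmod (a + of_real (cmod a) * z) \<le> cmod a + cmod a * cmod z"
      by (rule order_trans[OF norm_triangle_ineq]) (simp add: norm_mult)
    also have "\<dots> \<le> cmod a * 2" using zD by (simp add: algebra_simps mult_left_le)
    finally show "cmod (a + of_real (cmod a) * z) \<le> cmod a * 2" .
    have "1 - cmod (cnj a * z) \<le> cmod (1 - cnj a * z)" using norm_triangle_ineq2[of 1 "cnj a * z"] by simp
    moreover have "cmod (cnj a * z) \<le> R"
      unfolding norm_mult complex_mod_cnj using a(1) z mult_left_le_one_le[of "cmod z" "cmod a"] by auto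
    ultimately show "1 - R \<le> cmod (1 - cnj a * z)" by linarith
  qed (use a R in auto)
  also have "\<dots> = (cmod a * ((1 - cmod a) * 2)) / (cmod a * (1 - R))" by (simp only: mult_ac)
  also have "\<dots> = 2 / (1 - R) * (1 - cmod a)" using a(2) by simp
  finally show ?thesis .
qed

lemma summable_on_finite_large_terms:
  fixes f :: "'i \<Rightarrow> real"
  assumes f: "f summable_on I" and nonneg: "\<And>i. i \<in> I \<Longrightarrow> 0 \<le> f i" and \<epsilon>: "0 < \<epsilon>"
  shows "finite {i \<in> I. \<epsilon> \<le> f i}"
proof (rule ccontr)
  assume inf: "infinite {i \<in> I. \<epsilon> \<le> f i}"
  obtain n :: nat where n: "infsum f I < real n * \<epsilon>" using reals_Archimedean3[OF \<epsilon>] by blast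
  obtain F where F: "F \<subseteq> {i \<in> I. \<epsilon> \<le> f i}" "finite F" "card F = n"
    using infinite_arbitrarily_large[OF inf] by blast
  have "real n * \<epsilon> = (\<Sum>i\<in>F. \<epsilon>)" using F by simp
  also have "\<dots> \<le> (\<Sum>i\<in>F. f i)" using F by (intro sum_mono) auto
  also have "\<dots> \<le> infsum f I" using F by (intro finite_sum_le_infsum f nonneg) auto
  finally show False using n by simp
qed

text \<open>
  On a smaller disc all but finitely many factors are close to \<open>1\<close>, and their principal logarithms are
  dominated by a summable family. So the product is a finite product times the exponential of a
  uniformly convergent sum, which also locates its zeros.
\<close>

theorem blaschke_product_limit:
  assumes a: "\<And>i. i \<in> I \<Longrightarrow> a i \<in> \<bbbD>" and summable: "(\<lambda>i. 1 - cmod (a i)) summable_on I"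
    and R: "R < 1"
  obtains g where "g holomorphic_on ball 0 R"
    "\<And>z. z \<in> ball 0 R \<Longrightarrow> ((\<lambda>F. \<Prod>i\<in>F. blaschke_factor (a i) z) \<longlongrightarrow> g z) (finite_subsets_at_top I)"
    "\<And>z. z \<in> ball 0 R \<Longrightarrow> g z = 0 \<Longrightarrow> \<exists>i\<in>I. z = a i"
proof -
  define e where "e i = 2 / (1 - R) * (1 - cmod (a i))" for i
  define M where "M i = 2 * e i" for i
  have M: "M summable_on I" unfolding M_def e_def by (intro summable_on_cmult_right summable)
  have M0: "0 \<le> M i" if "i \<in> I" for i using a[OF that] R by (simp add: M_def e_def)
  define F\<^sub>0 where "F\<^sub>0 = {i \<in> I. 1 \<le> M i} \<union> {i \<in> I. 1 \<le> 1 - cmod (a i)}"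
  have F0: "finite F\<^sub>0" "F\<^sub>0 \<subseteq> I"
    unfolding F\<^sub>0_def
    using summable_on_finite_large_terms[OF M, of 1] summable_on_finite_large_terms[OF summable, of 1] M0 a
    by (auto simp: less_imp_le)
  have near: "cmod (blaschke_factor (a i) z - 1) \<le> M i / 2" "cmod (blaschke_factor (a i) z - 1) < 1 / 2"
    if "i \<in> I - F\<^sub>0" "z \<in> cball 0 R" for i z
  proof -
    have "a i \<noteq> 0" "M i < 1" using that by (auto simp: F\<^sub>0_def)
    moreover from this have "cmod (blaschke_factor (a i) z - 1) \<le> e i"
      unfolding e_def using that by (intro blaschke_factor_near_1 a R) auto
    ultimately show "cmod (blaschke_factor (a i) z - 1) \<le> M i / 2" "cmod (blaschke_factor (a i) z - 1) < 1 / 2"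
      unfolding M_def by linarith+
  qed
  have sub: "cball 0 R \<subseteq> \<bbbD>" using R by auto
  \<comment> \<open>logarithms of the factors, with the finitely many factors that may vanish left out\<close>
  define l where "l i z = (if i \<in> F\<^sub>0 then 0 else Ln (blaschke_factor (a i) z))" for i z
  have l_bound: "cmod (l i z) \<le> M i" if "i \<in> I" "z \<in> cball 0 R" for i z
  proof (cases "i \<in> F\<^sub>0")
    case True then show ?thesis using M0[OF that(1)] by (simp add: l_def)
  next
    case False
    then show ?thesis
      using norm_Ln_le[OF near(2)[of i z]] near(1)[of i z] that by (simp add: l_def)
  qed
  have l_hol: "l i holomorphic_on cball 0 R" if "i \<in> I" for i
  proof (cases "i \<in> F\<^sub>0")
    case True then show ?thesis unfolding l_def by (simp add: holomorphic_on_const)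
  next
    case False
    have "blaschke_factor (a i) z \<notin> \<real>\<^sub>\<le>\<^sub>0" if "z \<in> cball 0 R" for z
    proof
      assume "blaschke_factor (a i) z \<in> \<real>\<^sub>\<le>\<^sub>0"
      then have "Re (blaschke_factor (a i) z - 1) \<le> - 1" by (auto simp: complex_nonpos_Reals_iff)
      then show False
        using near(2)[of i z] False \<open>i \<in> I\<close> that complex_Re_le_cmod[of "- (blaschke_factor (a i) z - 1)"] 
        by (auto simp: norm_minus_commute)
    qed
    from holomorphic_on_Ln'[OF this holomorphic_on_subset[OF blaschke_factor_holomorphic[OF a[OF that]] sub]]
    have "(\<lambda>z. Ln (blaschke_factor (a i) z)) holomorphic_on cball 0 R" .
    then show ?thesis using False unfolding l_def by simp
  qed
  define L where "L z = (\<Sum>\<^sub>\<infinity>i\<in>I. l i z)" for z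
  have ulim: "uniform_limit (cball 0 R) (\<lambda>F z. \<Sum>i\<in>F. l i z) L (finite_subsets_at_top I)"
    unfolding L_def by (rule Weierstrass_m_test_general[OF l_bound M])
  have ev: "\<forall>\<^sub>F F in finite_subsets_at_top I. finite F \<and> F\<^sub>0 \<subseteq> F \<and> F \<subseteq> I"
    unfolding eventually_finite_subsets_at_top using F0 by blast
  have L_hol: "L holomorphic_on ball 0 R"
  proof (rule holomorphic_uniform_limit[OF _ ulim])
    show "\<forall>\<^sub>F F in finite_subsets_at_top I. continuous_on (cball 0 R) (\<lambda>z. \<Sum>i\<in>F. l i z) \<and>
        (\<lambda>z. \<Sum>i\<in>F. l i z) holomorphic_on ball 0 R"
      using ev
    proof eventually_elim
      case (elim F)
      then have "(\<lambda>z. \<Sum>i\<in>F. l i z) holomorphic_on cball 0 R" by (intro holomorphic_intros l_hol) auto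
      then show ?case
        using holomorphic_on_imp_continuous_on holomorphic_on_subset ball_subset_cball by blast
    qed
  qed auto
  define g where "g z = (\<Prod>i\<in>F\<^sub>0. blaschke_factor (a i) z) * exp (L z)" for z
  have sub': "ball 0 R \<subseteq> \<bbbD>" using sub by auto
  show ?thesis
  proof
    show "g holomorphic_on ball 0 R"
      unfolding g_def using F0 a
      by (intro holomorphic_intros L_hol holomorphic_on_subset[OF blaschke_factor_holomorphic sub']) auto
    fix z :: complex assume z: "z \<in> ball 0 R"
    have "((\<lambda>F. \<Sum>i\<in>F. l i z) \<longlongrightarrow> L z) (finite_subsets_at_top I)"
      by (rule tendsto_uniform_limitI[OF ulim]) (use z in auto)
    then have "((\<lambda>F. (\<Prod>i\<in>F\<^sub>0. blaschke_factor (a i) z) * exp (\<Sum>i\<in>F. l i z)) \<longlongrightarrow> g z) (finite_subsets_at_top I)"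
      unfolding g_def by (intro tendsto_intros)
    moreover have "\<forall>\<^sub>F F in finite_subsets_at_top I.
        (\<Prod>i\<in>F\<^sub>0. blaschke_factor (a i) z) * exp (\<Sum>i\<in>F. l i z) = (\<Prod>i\<in>F. blaschke_factor (a i) z)"
      using ev
    proof eventually_elim
      case (elim F)
      have "exp (\<Sum>i\<in>F. l i z) = (\<Prod>i\<in>F. exp (l i z))" using elim by (simp add: exp_sum)
      also have "\<dots> = (\<Prod>i\<in>F - F\<^sub>0. exp (l i z))"
        using elim by (intro prod.mono_neutral_right) (auto simp: l_def)
      also have "\<dots> = (\<Prod>i\<in>F - F\<^sub>0. blaschke_factor (a i) z)"
      proof (intro prod.cong refl)
        fix i assume i: "i \<in> F - F\<^sub>0"
        then have "blaschke_factor (a i) z \<noteq> 0" using near(2)[of i z] elim z by auto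
        then show "exp (l i z) = blaschke_factor (a i) z" using i by (simp add: l_def)
      qed
      finally show ?case using elim prod.subset_diff[of F\<^sub>0 F "\<lambda>i. blaschke_factor (a i) z"] by (simp add: mult.commute)
    qed
    ultimately show "((\<lambda>F. \<Prod>i\<in>F. blaschke_factor (a i) z) \<longlongrightarrow> g z) (finite_subsets_at_top I)"
      by (rule Lim_transform_eventually)
    assume "g z = 0"
    then obtain i where "i \<in> F\<^sub>0" "blaschke_factor (a i) z = 0" using F0 by (auto simp: g_def)
    moreover from this have "i \<in> I" "z \<in> \<bbbD>" using F0 z sub' by blast+
    ultimately show "\<exists>i\<in>I. z = a i" using blaschke_factor_eq_0_iff[OF a[of i], of z] by blast
  qed
qed

lemma fuchsian_group_disc:
  assumes "fuchsian_group \<Gamma>" "\<gamma> \<in> \<Gamma>" "z \<in> \<bbbD>" shows "\<gamma> z \<in> \<bbbD>"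
proof -
  have "subgroup \<Gamma> (BijGroup \<bbbD>)" using assms(1) by (simp add: fuchsian_group_def)
  from subgroup.subset[OF this] have "\<gamma> \<in> Bij \<bbbD>" using assms(2) by (auto simp: BijGroup_def)
  then show ?thesis using Bij_imp_funcset assms(3) by blast
qed

lemma fuchsian_group_identity:
  assumes "fuchsian_group \<Gamma>" shows "(\<lambda>z\<in>\<bbbD>. z) \<in> \<Gamma>"
proof -
  have "subgroup \<Gamma> (BijGroup \<bbbD>)" using assms(1) by (simp add: fuchsian_group_def)
  from subgroup.one_closed[OF this] show ?thesis by (simp only: BijGroup_def monoid.simps)
qed

context
  fixes \<Gamma> assumes \<Gamma>: "fuchsian_group \<Gamma>" "convergence_type \<Gamma>"
begin

lemma green_function_limit:
  assumes "R < 1"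
  shows "green_function \<Gamma> holomorphic_on ball 0 R"
    and "z \<in> ball 0 R \<Longrightarrow> green_function \<Gamma> z = 0 \<Longrightarrow> \<exists>\<gamma>\<in>\<Gamma>. z = \<gamma> 0"
    and "z \<in> ball 0 R \<Longrightarrow> ((\<lambda>F. \<Prod>\<gamma>\<in>F. blaschke_factor (\<gamma> 0) z) \<longlongrightarrow> green_function \<Gamma> z) (finite_subsets_at_top \<Gamma>)"
proof -
  have orbit: "\<gamma> 0 \<in> \<bbbD>" if "\<gamma> \<in> \<Gamma>" for \<gamma> using fuchsian_group_disc[OF \<Gamma>(1) that] by simp
  have "(\<lambda>\<gamma>. 1 - (cmod (\<gamma> 0))\<^sup>2) summable_on \<Gamma>" using \<Gamma>(2) by (simp add: convergence_type_def)
  then have "(\<lambda>\<gamma>. 1 - cmod (\<gamma> 0)) summable_on \<Gamma>"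
  proof (rule summable_on_comparison_test)
    fix \<gamma> assume "\<gamma> \<in> \<Gamma>"
    then have "cmod (\<gamma> 0) < 1" using orbit by simp
    then show "1 - cmod (\<gamma> 0) \<le> 1 - (cmod (\<gamma> 0))\<^sup>2" "0 \<le> 1 - cmod (\<gamma> 0)"
      by (auto simp: power2_eq_square mult_left_le)
  qed
  then obtain g where g: "g holomorphic_on ball 0 R"
    "\<And>z. z \<in> ball 0 R \<Longrightarrow> ((\<lambda>F. \<Prod>\<gamma>\<in>F. blaschke_factor (\<gamma> 0) z) \<longlongrightarrow> g z) (finite_subsets_at_top \<Gamma>)"
    "\<And>z. z \<in> ball 0 R \<Longrightarrow> g z = 0 \<Longrightarrow> \<exists>\<gamma>\<in>\<Gamma>. z = \<gamma> 0"
    by (rule blaschke_product_limit[where a = "\<lambda>\<gamma>. \<gamma> 0" and I = \<Gamma> and R = R, rotated])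
       (use orbit assms in \<open>blast+\<close>)
  have eq: "green_function \<Gamma> z = g z" if "z \<in> ball 0 R" for z
    unfolding green_function_def by (rule tendsto_Lim[OF _ g(2)[OF that]]) simp
  show "green_function \<Gamma> holomorphic_on ball 0 R" by (rule holomorphic_transform[OF g(1)]) (simp add: eq)
  show "\<exists>\<gamma>\<in>\<Gamma>. z = \<gamma> 0" if "z \<in> ball 0 R" "green_function \<Gamma> z = 0"
    using that g(3)[of z] by (simp only: eq)
  show "((\<lambda>F. \<Prod>\<gamma>\<in>F. blaschke_factor (\<gamma> 0) z) \<longlongrightarrow> green_function \<Gamma> z) (finite_subsets_at_top \<Gamma>)"
    if "z \<in> ball 0 R" using g(2)[OF that] that by (simp only: eq)
qed

lemma green_function_holomorphic: "green_function \<Gamma> holomorphic_on \<bbbD>"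
  unfolding holomorphic_on_def
proof
  fix z :: complex assume "z \<in> \<bbbD>"
  then obtain R where R: "cmod z < R" "R < 1" using dense[of "cmod z" 1] by auto
  have "green_function \<Gamma> field_differentiable (at z)"
    by (rule holomorphic_on_imp_differentiable_at[OF green_function_limit(1)[OF R(2)]]) (use R in auto)
  then show "green_function \<Gamma> field_differentiable (at z within \<bbbD>)"
    by (rule field_differentiable_at_within)
qed

lemma green_function_zero:
  assumes "z \<in> \<bbbD>" "green_function \<Gamma> z = 0" shows "\<exists>\<gamma>\<in>\<Gamma>. z = \<gamma> 0"
proof -
  obtain R where "cmod z < R" "R < 1" using dense[of "cmod z" 1] assms by auto
  with green_function_limit(2)[of R z] assms(2) show ?thesis by simp
qed

lemma green_function_0: "green_function \<Gamma> 0 = 0"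
proof -
  define e where "e = (\<lambda>z\<in>\<bbbD>. z)"
  have e: "e \<in> \<Gamma>" "e 0 = 0" using fuchsian_group_identity[OF \<Gamma>(1)] by (auto simp: e_def)
  have "((\<lambda>F. \<Prod>\<gamma>\<in>F. blaschke_factor (\<gamma> 0) 0) \<longlongrightarrow> green_function \<Gamma> 0) (finite_subsets_at_top \<Gamma>)"
    by (rule green_function_limit(3)[of "1/2"]) auto
  moreover have "\<forall>\<^sub>F F in finite_subsets_at_top \<Gamma>. (\<Prod>\<gamma>\<in>F. blaschke_factor (\<gamma> 0) 0) = (0::complex)"
    unfolding eventually_finite_subsets_at_top
    using e by (intro exI[of _ "{e}"]) (auto simp: blaschke_factor_def intro!: prod_zero)
  ultimately have "((\<lambda>F. 0::complex) \<longlongrightarrow> green_function \<Gamma> 0) (finite_subsets_at_top \<Gamma>)"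
    by (rule Lim_transform_eventually)
  then show ?thesis by (simp add: tendsto_const_iff)
qed

end

section \<open>The kernels on the upper domain\<close>

lemma characters_iff:
  "\<alpha> \<in> characters \<Gamma> \<longleftrightarrow> (\<forall>\<gamma>\<in>\<Gamma>. cmod (\<alpha> \<gamma>) = 1) \<and>
     (\<forall>\<gamma>\<in>\<Gamma>. \<forall>\<delta>\<in>\<Gamma>. \<alpha> (\<gamma> \<otimes>\<^bsub>BijGroup \<bbbD>\<^esub> \<delta>) = \<alpha> \<gamma> * \<alpha> \<delta>)"
  by (auto simp: characters_def hom_def unit_circle_group_def Pi_iff)

lemma characters_mult:
  "\<alpha> \<in> characters \<Gamma> \<Longrightarrow> \<beta> \<in> characters \<Gamma> \<Longrightarrow> (\<lambda>\<gamma>. \<alpha> \<gamma> * \<beta> \<gamma>) \<in> characters \<Gamma>"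
  by (simp add: characters_iff norm_mult)

lemma characters_cnj: "\<alpha> \<in> characters \<Gamma> \<Longrightarrow> (\<lambda>\<gamma>. cnj (\<alpha> \<gamma>)) \<in> characters \<Gamma>"
  by (simp add: characters_iff)

lemma automorphic_hardy2_subset: "automorphic_hardy2 \<Gamma> \<alpha> \<subseteq> hardy2"
  by (auto simp: automorphic_hardy2_def)

lemma automorphic_hardy2_sum:
  assumes "finite A" "\<And>i. i \<in> A \<Longrightarrow> f i \<in> automorphic_hardy2 \<Gamma> \<alpha>"
  shows "(\<lambda>z. \<Sum>i\<in>A. c i * f i z) \<in> automorphic_hardy2 \<Gamma> \<alpha>"
  using assms hardy2_sum[of A f c]
  by (auto simp: automorphic_hardy2_def character_automorphic_def sum_distrib_left intro!: sum.cong)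

text \<open>
  As \<open>|\<beta>| = 1\<close>, the characters of \<open>s\<close> and \<open>f\<close> multiply to \<open>\<alpha>\<close>.
\<close>

lemma automorphic_hardy2_multiplier:
  assumes "\<beta> \<in> characters \<Gamma>" "character_automorphic \<Gamma> \<beta> s"
    and "f \<in> automorphic_hardy2 \<Gamma> (\<lambda>\<gamma>. cnj (\<beta> \<gamma>) * \<alpha> \<gamma>)" "(\<lambda>z. s z * f z) \<in> hardy2"
  shows "(\<lambda>z. s z * f z) \<in> automorphic_hardy2 \<Gamma> \<alpha>"
proof -
  have "s (\<gamma> z) * f (\<gamma> z) = \<alpha> \<gamma> * (s z * f z)" if "\<gamma> \<in> \<Gamma>" "z \<in> \<bbbD>" for \<gamma> z
  proof -
    have "s (\<gamma> z) = \<beta> \<gamma> * s z" "f (\<gamma> z) = cnj (\<beta> \<gamma>) * \<alpha> \<gamma> * f z"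
      using assms(2,3) that by (auto simp: character_automorphic_def automorphic_hardy2_def)
    moreover have "\<beta> \<gamma> * cnj (\<beta> \<gamma>) = 1"
      using assms(1) that(1) complex_norm_square[of "\<beta> \<gamma>"] by (simp add: characters_iff)
    ultimately have "s (\<gamma> z) * f (\<gamma> z) = (\<beta> \<gamma> * cnj (\<beta> \<gamma>)) * (\<alpha> \<gamma> * (s z * f z))"
      by (simp add: mult_ac)
    then show ?thesis using \<open>\<beta> \<gamma> * cnj (\<beta> \<gamma>) = 1\<close> by simp
  qed
  then show ?thesis using assms(4) by (simp add: automorphic_hardy2_def character_automorphic_def)
qed

text \<open>
  The reciprocal is an open map near the pole and therefore takes small values on the negative imaginary axis.
\<close>

lemma exists_upper_half_plane_value_near_pole:
  assumes f: "f meromorphic_on {z}" "is_pole f z" and \<epsilon>: "0 < \<epsilon>"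
  obtains w where "w \<in> ball z \<epsilon>" "f analytic_on {w}" "0 < Im (f w)"
proof -
  have "isolated_singularity_at f z" using f(1) by (simp add: meromorphic_at_iff)
  then obtain \<delta>\<^sub>1 where \<delta>\<^sub>1: "0 < \<delta>\<^sub>1" "f analytic_on ball z \<delta>\<^sub>1 - {z}"
    unfolding isolated_singularity_at_def by blast
  have "\<forall>\<^sub>F w in at z. f w \<noteq> 0" using f(2) by (rule non_zero_neighbour_pole)
  then obtain \<delta>\<^sub>2 where \<delta>\<^sub>2: "0 < \<delta>\<^sub>2" "\<And>w. w \<noteq> z \<Longrightarrow> dist w z < \<delta>\<^sub>2 \<Longrightarrow> f w \<noteq> 0"
    unfolding eventually_at by auto
  define \<delta> where "\<delta> = min \<delta>\<^sub>1 \<delta>\<^sub>2"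
  have \<delta>: "0 < \<delta>" "\<And>w. w \<in> ball z \<delta> - {z} \<Longrightarrow> f w \<noteq> 0"
    using \<delta>\<^sub>1(1) \<delta>\<^sub>2 by (auto simp: \<delta>_def dist_commute)
  have ana: "f analytic_on ball z \<delta> - {z}"
    by (rule analytic_on_subset[OF \<delta>\<^sub>1(2)]) (auto simp: \<delta>_def)
  define r where "r = min \<delta> \<epsilon>"
  define h where "h w = (if w = z then 0 else inverse (f w))" for w
  have holf: "f holomorphic_on ball z r - {z}"
    by (rule analytic_imp_holomorphic[OF analytic_on_subset[OF ana]]) (auto simp: r_def)
  have hol: "h holomorphic_on ball z r"
    unfolding h_def using \<delta>(2)
    by (intro is_pole_inverse_holomorphic holf f) (auto simp: r_def)
  have r: "0 < r" using \<delta>(1) \<epsilon> by (simp add: r_def)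
  have "\<not> h constant_on ball z r"
  proof
    assume "h constant_on ball z r"
    then obtain c where c: "\<And>w. w \<in> ball z r \<Longrightarrow> h w = c" unfolding constant_on_def by blast
    have "c = 0" using c[of z] r by (simp add: h_def)
    moreover have "z + of_real (r / 2) \<in> ball z r" using r by (simp add: dist_norm)
    ultimately have "h (z + of_real (r / 2)) = 0" using c by blast
    moreover have "f (z + of_real (r / 2)) \<noteq> 0"
    proof (rule \<delta>(2))
      have "r \<le> \<delta>" by (simp add: r_def)
      then show "z + of_real (r / 2) \<in> ball z \<delta> - {z}" using r by (simp add: dist_norm)
    qed
    ultimately show False using r by (simp add: h_def)
  qed
  then have "open (h ` ball z r)" by (intro open_mapping_thm[OF hol]) auto
  moreover have "0 \<in> h ` ball z r" using r by (intro image_eqI[of _ _ z]) (auto simp: h_def)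
  ultimately obtain e where e: "0 < e" "ball 0 e \<subseteq> h ` ball z r"
    unfolding open_contains_ball by blast
  have "- \<i> * of_real (e / 2) \<in> ball 0 e" using e(1) by (simp add: norm_mult)
  then obtain w where w: "w \<in> ball z r" "h w = - \<i> * of_real (e / 2)" using e(2) by (metis imageE subsetD)
  have wz: "w \<noteq> z" using w(2) e(1) by (auto simp: h_def)
  have "f w = inverse (h w)" using wz by (simp add: h_def)
  then have "Im (f w) = 2 / e" using e(1) unfolding w(2) by (simp add: Im_divide power2_eq_square)
  moreover have "f analytic_on {w}"
    by (rule analytic_on_subset[OF ana]) (use w(1) wz in \<open>auto simp: r_def\<close>)
  ultimately show ?thesis using that[of w] w(1) e(1) by (simp add: r_def)
qed

context widom_covering
begin

lemma zz_meromorphic: "\<zz> meromorphic_on \<bbbD>" and zz_nicely: "\<zz> nicely_meromorphic_on \<bbbD>"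
  using covering by (auto simp: uniformization_def nicely_meromorphic_on_def)

text \<open>
  Otherwise \<open>\<zz> b\<close> would vanish at \<open>0\<close>, against the normalization.
\<close>

lemma zz_pole_0: "is_pole \<zz> 0"
proof (rule ccontr)
  assume "\<not> is_pole \<zz> 0"
  then have "\<zz> analytic_on {0}" using zz_nicely by (intro nicely_meromorphic_on_imp_analytic_at) auto
  then have "isCont \<zz> 0" by (rule analytic_at_imp_isCont)
  moreover have "isCont (green_function \<Gamma>) 0"
    using holomorphic_on_imp_continuous_on[OF green_function_holomorphic[OF fuchsian convergence]]
    by (simp add: continuous_on_eq_continuous_at)
  ultimately have "isCont (\<lambda>z. \<zz> z * green_function \<Gamma> z) 0" by (intro continuous_intros)
  then have "(\<lambda>z. \<zz> z * green_function \<Gamma> z) \<midarrow>0\<rightarrow> 0"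
    using green_function_0[OF fuchsian convergence] by (simp add: isCont_def)
  then have "residue_value \<Gamma> \<zz> = 0" unfolding residue_value_def by (rule remove_sings_eqI)
  with normalized(2) show False by simp
qed

text \<open>
  The zeros of \<open>b\<close> form the orbit of \<open>0\<close>, on which \<open>\<zz>\<close> is infinite.
\<close>

lemma green_function_nonzero: "z \<in> upper_domain \<zz> \<Longrightarrow> green_function \<Gamma> z \<noteq> 0"
proof
  assume z: "z \<in> upper_domain \<zz>" and "green_function \<Gamma> z = 0"
  then obtain \<gamma> where \<gamma>: "\<gamma> \<in> \<Gamma>" "z = \<gamma> 0"
    using green_function_zero[OF fuchsian convergence] by (auto simp: upper_domain_def)
  have "to_sphere \<zz> (\<gamma> 0) = to_sphere \<zz> 0" using covering \<gamma>(1) by (simp add: uniformization_def)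
  then have "stereographic (\<zz> z) = (0, 1)"
    using z zz_pole_0 \<gamma>(2) by (simp add: to_sphere_def upper_domain_def)
  then have "(cmod (\<zz> z))\<^sup>2 - 1 = (cmod (\<zz> z))\<^sup>2 + 1"
    by (simp add: stereographic_def divide_eq_eq split: if_splits)
  then show False by simp
qed

lemma upper_domain_subset: "upper_domain \<zz> \<subseteq> \<bbbD>"
  by (auto simp: upper_domain_def)

lemma zz_analytic: "z \<in> upper_domain \<zz> \<Longrightarrow> \<zz> analytic_on {z}"
  using zz_nicely by (auto simp: upper_domain_def intro: nicely_meromorphic_on_imp_analytic_at)

lemma upper_domainI: "z \<in> \<bbbD> \<Longrightarrow> \<zz> analytic_on {z} \<Longrightarrow> 0 < Im (\<zz> z) \<Longrightarrow> z \<in> upper_domain \<zz>"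
  using analytic_at_imp_no_pole by (auto simp: upper_domain_def)

lemma upper_domain_open: "open (upper_domain \<zz>)"
  unfolding open_contains_ball
proof
  fix z assume z: "z \<in> upper_domain \<zz>"
  then have "\<zz> analytic_on {z}" by (rule zz_analytic)
  then obtain e where e: "0 < e" "\<zz> holomorphic_on ball z e" unfolding analytic_on_def by auto
  define V where "V = ball z e \<inter> \<zz> -` {u. 0 < Im u} \<inter> \<bbbD>"
  have "open V"
    unfolding V_def
    by (intro open_Int continuous_open_preimage holomorphic_on_imp_continuous_on e open_halfspace_Im_gt open_ball)
  moreover have "z \<in> V" using z e(1) by (simp add: V_def upper_domain_def)
  ultimately obtain d where "0 < d" "ball z d \<subseteq> V" by (rule openE)
  moreover have "V \<subseteq> upper_domain \<zz>"
  proof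
    fix w assume w: "w \<in> V"
    then have "\<zz> analytic_on {w}" using e(2) analytic_at[of \<zz> w] by (auto simp: V_def)
    then show "w \<in> upper_domain \<zz>" using w by (intro upper_domainI) (auto simp: V_def)
  qed
  ultimately show "\<exists>e>0. ball z e \<subseteq> upper_domain \<zz>" by blast
qed

lemma upper_domain_nonempty: "upper_domain \<zz> \<noteq> {}"
proof -
  have "\<zz> meromorphic_on {0}" using zz_meromorphic by (rule meromorphic_on_subset) auto
  from exists_upper_half_plane_value_near_pole[OF this zz_pole_0, of 1]
  show ?thesis using upper_domainI by auto
qed

lemma zz_holomorphic: "\<zz> holomorphic_on upper_domain \<zz>"
  using zz_analytic analytic_imp_holomorphic analytic_on_analytic_at by blast

lemma kernel_holomorphic: "\<alpha> \<in> characters \<Gamma> \<Longrightarrow> w \<in> \<bbbD> \<Longrightarrow> (\<lambda>z. k \<alpha> z w) holomorphic_on \<bbbD>"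
  using kernel[of \<alpha>] automorphic_hardy2_subset hardy2_holomorphic
  unfolding reproducing_kernel_def by blast

lemma kernel_const_pos:
  assumes "\<alpha> \<in> characters \<Gamma>" shows "0 < kernel_const \<Gamma> \<mu> \<zz> k \<alpha>"
proof -
  let ?k = "k (\<lambda>\<gamma>. \<alpha> \<gamma> * \<mu> \<gamma>) 0 0"
  have "?k \<in> \<real>" "0 < Re ?k"
    using kernel_positive[OF characters_mult[OF assms green_character(1)], of 0] by auto
  then show ?thesis
    using normalized by (auto simp: kernel_const_def elim!: Reals_cases)
qed

lemma kernel_quot_holomorphic:
  assumes "\<alpha> \<in> characters \<Gamma>"
  shows "kernel_quot \<Gamma> \<mu> k \<alpha> holomorphic_on upper_domain \<zz>"
  unfolding kernel_quot_def using green_function_nonzero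
  by (intro holomorphic_intros holomorphic_on_subset[OF kernel_holomorphic upper_domain_subset]
      holomorphic_on_subset[OF green_function_holomorphic upper_domain_subset]
      fuchsian convergence characters_mult assms green_character) auto

lemma A_holomorphic:
  assumes "\<alpha> \<in> characters \<Gamma>" shows "A_fun \<Gamma> \<mu> \<zz> k \<alpha> holomorphic_on upper_domain \<zz>"
  unfolding A_fun_def using assms
  by (intro holomorphic_intros kernel_quot_holomorphic
      holomorphic_on_subset[OF kernel_holomorphic upper_domain_subset]) auto

lemma B_holomorphic:
  assumes "\<alpha> \<in> characters \<Gamma>" shows "B_fun \<Gamma> \<mu> \<zz> k \<alpha> holomorphic_on upper_domain \<zz>"
  unfolding B_fun_def using assms
  by (intro holomorphic_intros kernel_quot_holomorphic
      holomorphic_on_subset[OF kernel_holomorphic upper_domain_subset]) auto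

lemma S_meromorphic:
  assumes "\<alpha> \<in> characters \<Gamma>" shows "S_fun \<Gamma> \<mu> \<zz> k \<alpha> meromorphic_on \<bbbD>"
proof -
  have mero: "f meromorphic_on \<bbbD>" if "f holomorphic_on \<bbbD>" for f
    using that by (intro analytic_on_imp_meromorphic_on) (simp add: analytic_on_open)
  show ?thesis
    unfolding S_fun_def A_fun_def B_fun_def kernel_quot_def
    by (intro meromorphic_intros mero kernel_holomorphic green_function_holomorphic
        fuchsian convergence characters_mult assms green_character) auto
qed

lemma zz_denominator:
  assumes "z \<in> upper_domain \<zz>" "w \<in> upper_domain \<zz>" shows "\<zz> z - cnj (\<zz> w) \<noteq> 0"
proof -
  have "0 < Im (\<zz> z - cnj (\<zz> w))" using assms by (simp add: upper_domain_def)
  then show ?thesis by (metis less_irrefl zero_complex.simps(2))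
qed

lemma kernel_AB:
  assumes \<alpha>: "\<alpha> \<in> characters \<Gamma>" and z: "z \<in> upper_domain \<zz>" and w: "w \<in> upper_domain \<zz>"
  shows "k \<alpha> z w * (- \<i> * (\<zz> z - cnj (\<zz> w))) =
    A_fun \<Gamma> \<mu> \<zz> k \<alpha> z * cnj (A_fun \<Gamma> \<mu> \<zz> k \<alpha> w) - B_fun \<Gamma> \<mu> \<zz> k \<alpha> z * cnj (B_fun \<Gamma> \<mu> \<zz> k \<alpha> w)"
proof -
  define c where "c = kernel_const \<Gamma> \<mu> \<zz> k \<alpha>"
  define p q where "p x = kernel_quot \<Gamma> \<mu> k \<alpha> x" and "q x = k \<alpha> x 0" for x
  have root: "complex_of_real (sqrt (c / 2)) * of_real (sqrt (c / 2)) = of_real c / 2"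
    using kernel_const_pos[OF \<alpha>] by (simp add: c_def flip: of_real_mult)
  have "k \<alpha> z w = of_real c * (p z * cnj (q w) - cnj (p w) * q z) / (\<zz> z - cnj (\<zz> w))"
    unfolding c_def p_def q_def using z w zz_denominator[OF z w] green_function_nonzero
    by (intro kernel_formula \<alpha>) (auto simp: upper_domain_def)
  then have "k \<alpha> z w * (- \<i> * (\<zz> z - cnj (\<zz> w))) = - \<i> * of_real c * (p z * cnj (q w) - cnj (p w) * q z)"
    using zz_denominator[OF z w] by simp
  also have "\<dots> = (complex_of_real (sqrt (c / 2)) * of_real (sqrt (c / 2))) *
      ((p z + \<i> * q z) * (cnj (p w) - \<i> * cnj (q w)) - (p z - \<i> * q z) * (cnj (p w) + \<i> * cnj (q w)))"
    unfolding root by (simp add: algebra_simps)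
  also have "\<dots> = A_fun \<Gamma> \<mu> \<zz> k \<alpha> z * cnj (A_fun \<Gamma> \<mu> \<zz> k \<alpha> w) - B_fun \<Gamma> \<mu> \<zz> k \<alpha> z * cnj (B_fun \<Gamma> \<mu> \<zz> k \<alpha> w)"
    by (simp add: A_fun_def B_fun_def c_def p_def q_def algebra_simps)
  finally show ?thesis .
qed

text \<open>
  The value of the kernel at \<open>(z, z)\<close> is positive, and so is \<open>Im (\<zz> z)\<close>.
\<close>

lemma B_less_A:
  assumes \<alpha>: "\<alpha> \<in> characters \<Gamma>" and z: "z \<in> upper_domain \<zz>"
  shows "cmod (B_fun \<Gamma> \<mu> \<zz> k \<alpha> z) < cmod (A_fun \<Gamma> \<mu> \<zz> k \<alpha> z)"
proof -
  have zD: "z \<in> \<bbbD>" and im: "0 < Im (\<zz> z)" using z by (auto simp: upper_domain_def)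
  have "k \<alpha> z z \<in> \<real>" "0 < Re (k \<alpha> z z)" using kernel_positive[OF \<alpha> zD] by auto
  then obtain x where x: "k \<alpha> z z = of_real x" "0 < x" by (auto elim!: Reals_cases)
  have "- \<i> * (\<zz> z - cnj (\<zz> z)) = of_real (2 * Im (\<zz> z))"
    by (rule complex_eqI) simp_all
  then have "complex_of_real (x * (2 * Im (\<zz> z))) = k \<alpha> z z * (- \<i> * (\<zz> z - cnj (\<zz> z)))"
    by (simp only: x(1) of_real_mult)
  then have "complex_of_real (x * (2 * Im (\<zz> z))) =
      of_real ((cmod (A_fun \<Gamma> \<mu> \<zz> k \<alpha> z))\<^sup>2 - (cmod (B_fun \<Gamma> \<mu> \<zz> k \<alpha> z))\<^sup>2)"
    unfolding kernel_AB[OF \<alpha> z z] by (simp only: complex_norm_square of_real_diff)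
  then have "x * (2 * Im (\<zz> z)) = (cmod (A_fun \<Gamma> \<mu> \<zz> k \<alpha> z))\<^sup>2 - (cmod (B_fun \<Gamma> \<mu> \<zz> k \<alpha> z))\<^sup>2"
    by (simp only: of_real_eq_iff)
  moreover have "0 < x * (2 * Im (\<zz> z))" using x(2) im by simp
  ultimately have "(cmod (B_fun \<Gamma> \<mu> \<zz> k \<alpha> z))\<^sup>2 < (cmod (A_fun \<Gamma> \<mu> \<zz> k \<alpha> z))\<^sup>2" by linarith
  then show ?thesis by (rule power_less_imp_less_base) simp
qed

lemma A_nonzero: "\<alpha> \<in> characters \<Gamma> \<Longrightarrow> z \<in> upper_domain \<zz> \<Longrightarrow> A_fun \<Gamma> \<mu> \<zz> k \<alpha> z \<noteq> 0"
  using B_less_A by fastforce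

lemma S_less_1: "\<alpha> \<in> characters \<Gamma> \<Longrightarrow> z \<in> upper_domain \<zz> \<Longrightarrow> cmod (S_fun \<Gamma> \<mu> \<zz> k \<alpha> z) < 1"
  using B_less_A[of \<alpha> z] A_nonzero[of \<alpha> z] by (simp add: S_fun_def norm_divide)

lemma S_holomorphic:
  assumes "\<alpha> \<in> characters \<Gamma>" shows "S_fun \<Gamma> \<mu> \<zz> k \<alpha> holomorphic_on upper_domain \<zz>"
  unfolding S_fun_def using A_nonzero assms by (intro holomorphic_intros A_holomorphic B_holomorphic) auto

lemma cayley_denominator: "z \<in> upper_domain \<zz> \<Longrightarrow> 1 - \<i> * \<zz> z \<noteq> 0"
proof
  assume "z \<in> upper_domain \<zz>" "1 - \<i> * \<zz> z = 0"
  then have "Re (1 - \<i> * \<zz> z) = 0" "0 < Im (\<zz> z)" by (auto simp: upper_domain_def)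
  then show False by simp
qed

lemma cayley_kernel:
  assumes "z \<in> upper_domain \<zz>" "w \<in> upper_domain \<zz>"
  shows "(1 - cayley \<zz> z * cnj (cayley \<zz> w)) * ((1 - \<i> * \<zz> z) * cnj (1 - \<i> * \<zz> w)) =
           2 * (- \<i> * (\<zz> z - cnj (\<zz> w)))"
proof -
  have ne: "1 - \<i> * \<zz> z \<noteq> 0" "cnj (1 - \<i> * \<zz> w) \<noteq> 0"
    using cayley_denominator assms by (auto simp only: complex_cnj_zero_iff)
  have "cayley \<zz> z * cnj (cayley \<zz> w) * ((1 - \<i> * \<zz> z) * cnj (1 - \<i> * \<zz> w)) =
      (1 + \<i> * \<zz> z) * cnj (1 + \<i> * \<zz> w)"
    using ne by (simp add: cayley_def)
  then show ?thesis by (simp add: algebra_simps)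
qed

lemma cayley_in_disc: "z \<in> upper_domain \<zz> \<Longrightarrow> cayley \<zz> z \<in> \<bbbD>"
proof -
  assume z: "z \<in> upper_domain \<zz>"
  let ?x = "\<zz> z"
  have im: "0 < Im ?x" using z by (simp add: upper_domain_def)
  have "(cmod (1 + \<i> * ?x))\<^sup>2 < (cmod (1 - \<i> * ?x))\<^sup>2"
    using im unfolding cmod_power2 by (simp add: power2_eq_square algebra_simps)
  then have "cmod (1 + \<i> * ?x) < cmod (1 - \<i> * ?x)" by (rule power_less_imp_less_base) simp
  then show ?thesis using cayley_denominator[OF z] by (simp add: cayley_def norm_divide)
qed

lemma cayley_holomorphic: "cayley \<zz> holomorphic_on upper_domain \<zz>"
  unfolding cayley_def using cayley_denominator by (intro holomorphic_intros zz_holomorphic) auto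

text \<open>
  The kernel formula in terms of \<open>S\<close> and \<open>\<sigma>\<close>: up to nonvanishing outer factors, \<open>k \<alpha>\<close> is
  \<open>(1 - S(z) S(w)*) / (1 - \<sigma>(z) \<sigma>(w)*)\<close>.
\<close>

lemma kernel_S:
  assumes \<alpha>: "\<alpha> \<in> characters \<Gamma>" and z: "z \<in> upper_domain \<zz>" and w: "w \<in> upper_domain \<zz>"
  shows "2 * (A_fun \<Gamma> \<mu> \<zz> k \<alpha> z * cnj (A_fun \<Gamma> \<mu> \<zz> k \<alpha> w)) *
           (1 - S_fun \<Gamma> \<mu> \<zz> k \<alpha> z * cnj (S_fun \<Gamma> \<mu> \<zz> k \<alpha> w)) =
         k \<alpha> z w * (1 - cayley \<zz> z * cnj (cayley \<zz> w)) * ((1 - \<i> * \<zz> z) * cnj (1 - \<i> * \<zz> w))"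
proof -
  have "A_fun \<Gamma> \<mu> \<zz> k \<alpha> x * S_fun \<Gamma> \<mu> \<zz> k \<alpha> x = B_fun \<Gamma> \<mu> \<zz> k \<alpha> x" if "x \<in> upper_domain \<zz>" for x
    using A_nonzero[OF \<alpha> that] by (simp add: S_fun_def)
  note this[OF z, symmetric] this[OF w, symmetric]
  then have "2 * (A_fun \<Gamma> \<mu> \<zz> k \<alpha> z * cnj (A_fun \<Gamma> \<mu> \<zz> k \<alpha> w)) *
           (1 - S_fun \<Gamma> \<mu> \<zz> k \<alpha> z * cnj (S_fun \<Gamma> \<mu> \<zz> k \<alpha> w)) =
      2 * (A_fun \<Gamma> \<mu> \<zz> k \<alpha> z * cnj (A_fun \<Gamma> \<mu> \<zz> k \<alpha> w) - B_fun \<Gamma> \<mu> \<zz> k \<alpha> z * cnj (B_fun \<Gamma> \<mu> \<zz> k \<alpha> w))"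
    by (simp add: algebra_simps)
  also have "\<dots> = k \<alpha> z w * (2 * (- \<i> * (\<zz> z - cnj (\<zz> w))))"
    unfolding kernel_AB[OF \<alpha> z w, symmetric] by (simp only: mult_ac)
  finally show ?thesis unfolding cayley_kernel[OF z w, symmetric] by (simp only: mult_ac)
qed

end

section \<open>Multipliers as linear fractional transformations\<close>

text \<open>
  The function \<open>f\<close> itself serves as the meromorphic extension.
\<close>

lemma extended_eq_iff:
  assumes "f meromorphic_on \<bbbD>" shows "extended_eq \<Omega> f g \<longleftrightarrow> (\<forall>z\<in>\<Omega>. f z = g z)"
proof
  show "\<forall>z\<in>\<Omega>. f z = g z" if "extended_eq \<Omega> f g" using that unfolding extended_eq_def by blast
  show "extended_eq \<Omega> f g" if "\<forall>z\<in>\<Omega>. f z = g z"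
    unfolding extended_eq_def using that assms by (intro conjI exI[of _ f]) auto
qed

context widom_covering
begin

text \<open>
  With \<open>\<phi> = s A\<^sub>\<delta> / A\<^sub>\<alpha>\<close>, these are the rows \<open>(1, \<phi> S\<^sub>\<delta>)\<close> and \<open>(S\<^sub>\<alpha>, \<phi>)\<close> of the interpolation problem
  that \<open>\<Sigma>\<close> has to solve.
\<close>

definition tangent_direction :: "((complex \<Rightarrow> complex) \<Rightarrow> complex) \<Rightarrow> ((complex \<Rightarrow> complex) \<Rightarrow> complex) \<Rightarrow> (complex \<Rightarrow> complex) \<Rightarrow> complex \<Rightarrow> complex^2"
  where "tangent_direction \<alpha> \<delta> s z = vector [1, s z * A_fun \<Gamma> \<mu> \<zz> k \<delta> z / A_fun \<Gamma> \<mu> \<zz> k \<alpha> z * S_fun \<Gamma> \<mu> \<zz> k \<delta> z]"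

definition tangent_value :: "((complex \<Rightarrow> complex) \<Rightarrow> complex) \<Rightarrow> ((complex \<Rightarrow> complex) \<Rightarrow> complex) \<Rightarrow> (complex \<Rightarrow> complex) \<Rightarrow> complex \<Rightarrow> complex^2"
  where "tangent_value \<alpha> \<delta> s z = vector [S_fun \<Gamma> \<mu> \<zz> k \<alpha> z, s z * A_fun \<Gamma> \<mu> \<zz> k \<delta> z / A_fun \<Gamma> \<mu> \<zz> k \<alpha> z]"

text \<open>
  Substitute the formula for both kernels and divide by the outer factors of \<open>k \<alpha>\<close>. What remains is
  \<open>1 - S\<^sub>\<alpha> S\<^sub>\<alpha>* - \<phi> \<phi>* (1 - S\<^sub>\<delta> S\<^sub>\<delta>*)\<close>, and moving the term \<open>\<phi> S\<^sub>\<delta>\<close> into the first row turns this into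
  \<open>u u* - v v*\<close>. The factor \<open>sqrt 2\<close> absorbs the constant in the kernel formula.
\<close>

lemma multiplier_kernel_factorization:
  assumes \<alpha>: "\<alpha> \<in> characters \<Gamma>" and \<delta>: "\<delta> \<in> characters \<Gamma>"
    and z: "z \<in> upper_domain \<zz>" and w: "w \<in> upper_domain \<zz>"
  defines "g \<equiv> \<lambda>x. (1 - \<i> * \<zz> x) / (of_real (sqrt 2) * A_fun \<Gamma> \<mu> \<zz> k \<alpha> x)"
  shows "pick_kernel (cayley \<zz>) (tangent_direction \<alpha> \<delta> s) (tangent_value \<alpha> \<delta> s) z w =
         g z * cnj (g w) * (k \<alpha> z w - s z * cnj (s w) * k \<delta> z w)"
proof -
  define a a' d d' where "a = A_fun \<Gamma> \<mu> \<zz> k \<alpha> z" and "a' = cnj (A_fun \<Gamma> \<mu> \<zz> k \<alpha> w)"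
    and "d = A_fun \<Gamma> \<mu> \<zz> k \<delta> z" and "d' = cnj (A_fun \<Gamma> \<mu> \<zz> k \<delta> w)"
  define x x' y y' where "x = S_fun \<Gamma> \<mu> \<zz> k \<alpha> z" and "x' = cnj (S_fun \<Gamma> \<mu> \<zz> k \<alpha> w)"
    and "y = S_fun \<Gamma> \<mu> \<zz> k \<delta> z" and "y' = cnj (S_fun \<Gamma> \<mu> \<zz> k \<delta> w)"
  define t t' where "t = s z" and "t' = cnj (s w)"
  define e where "e = (1 - \<i> * \<zz> z) * cnj (1 - \<i> * \<zz> w)"
  define m where "m = 1 - cayley \<zz> z * cnj (cayley \<zz> w)"
  have ne: "a \<noteq> 0" "a' \<noteq> 0" using A_nonzero[OF \<alpha> z] A_nonzero[OF \<alpha> w] by (auto simp: a_def a'_def)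
  have m: "m \<noteq> 0"
  proof -
    have "cmod (cayley \<zz> z * cnj (cayley \<zz> w)) < 1 * 1"
      unfolding norm_mult complex_mod_cnj using cayley_in_disc[OF z] cayley_in_disc[OF w]
      by (intro mult_strict_mono') auto
    then show ?thesis by (auto simp: m_def)
  qed
  have k\<alpha>: "k \<alpha> z w * e = 2 * (a * a') * (1 - x * x') / m"
    using kernel_S[OF \<alpha> z w] m unfolding a_def a'_def x_def x'_def e_def m_def by (simp add: mult_ac)
  have k\<delta>: "k \<delta> z w * e = 2 * (d * d') * (1 - y * y') / m"
    using kernel_S[OF \<delta> z w] m unfolding d_def d'_def y_def y'_def e_def m_def by (simp add: mult_ac)
  have g: "g z * cnj (g w) = e / (2 * (a * a'))"
  proof -
    have "complex_of_real (sqrt 2) * of_real (sqrt 2) = 2" by (simp flip: of_real_mult)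
    then show ?thesis unfolding g_def e_def a_def a'_def
      by (simp add: mult_ac flip: mult.assoc[of "complex_of_real (sqrt 2)" "complex_of_real (sqrt 2)"])
  qed
  have "((\<Sum>l\<in>UNIV. tangent_direction \<alpha> \<delta> s z $ l * cnj (tangent_direction \<alpha> \<delta> s w $ l)) -
          (\<Sum>l\<in>UNIV. tangent_value \<alpha> \<delta> s z $ l * cnj (tangent_value \<alpha> \<delta> s w $ l))) =
      1 + (t * d / a * y) * (t' * d' / a' * y') - (x * x' + (t * d / a) * (t' * d' / a'))"
    unfolding tangent_direction_def tangent_value_def sum_2 vector_2 a_def a'_def d_def d'_def x_def x'_def y_def y'_def t_def t'_def
    by simp
  also have "\<dots> = (1 - x * x') - (t * t') * ((d * d') * (1 - y * y')) / (a * a')"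
    using ne by (simp add: field_simps)
  also have "\<dots> / m = ((k \<alpha> z w * e) - (t * t') * (k \<delta> z w * e)) / (2 * (a * a'))"
    unfolding k\<alpha> k\<delta> using ne m by (simp add: field_simps)
  also have "\<dots> = g z * cnj (g w) * (k \<alpha> z w - t * t' * k \<delta> z w)"
    unfolding g by (simp add: algebra_simps diff_divide_distrib)
  finally show ?thesis unfolding pick_kernel_def m_def t_def t'_def .
qed

lemma tangent_positive_iff:
  assumes \<alpha>: "\<alpha> \<in> characters \<Gamma>" and \<delta>: "\<delta> \<in> characters \<Gamma>"
  shows "positive_kernel (upper_domain \<zz>) (pick_kernel (cayley \<zz>) (tangent_direction \<alpha> \<delta> s) (tangent_value \<alpha> \<delta> s)) \<longleftrightarrow>
         positive_kernel (upper_domain \<zz>) (\<lambda>z w. k \<alpha> z w - s z * cnj (s w) * k \<delta> z w)"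
    (is "positive_kernel _ ?P \<longleftrightarrow> positive_kernel _ ?K")
proof
  define g where "g x = (1 - \<i> * \<zz> x) / (of_real (sqrt 2) * A_fun \<Gamma> \<mu> \<zz> k \<alpha> x)" for x
  have fac: "?P z w = g z * cnj (g w) * ?K z w" if "z \<in> upper_domain \<zz>" "w \<in> upper_domain \<zz>" for z w
    unfolding g_def by (rule multiplier_kernel_factorization[OF \<alpha> \<delta> that])
  have g: "g x \<noteq> 0" if "x \<in> upper_domain \<zz>" for x
    using cayley_denominator[OF that] A_nonzero[OF \<alpha> that] by (simp add: g_def)
  show "positive_kernel (upper_domain \<zz>) ?P" if "positive_kernel (upper_domain \<zz>) ?K"
    by (rule positive_kernel_congruence[OF that fac])
  show "positive_kernel (upper_domain \<zz>) ?K" if "positive_kernel (upper_domain \<zz>) ?P"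
  proof (rule positive_kernel_congruence[OF that])
    fix z w assume zw: "z \<in> upper_domain \<zz>" "w \<in> upper_domain \<zz>"
    show "?K z w = inverse (g z) * cnj (inverse (g w)) * ?P z w"
      unfolding fac[OF zw] using g[OF zw(1)] g[OF zw(2)] by (simp add: field_simps)
  qed
qed

lemma contractive_multiplier_iff_positive:
  assumes \<alpha>: "\<alpha> \<in> characters \<Gamma>" and \<beta>: "\<beta> \<in> characters \<Gamma>"
    and s: "s holomorphic_on \<bbbD>" "character_automorphic \<Gamma> \<beta> s"
  defines "\<delta> \<equiv> \<lambda>\<gamma>. cnj (\<beta> \<gamma>) * \<alpha> \<gamma>"
  shows "contractive_multiplier s (automorphic_hardy2 \<Gamma> \<delta>) (automorphic_hardy2 \<Gamma> \<alpha>) \<longleftrightarrow>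
         positive_kernel (upper_domain \<zz>) (\<lambda>z w. k \<alpha> z w - s z * cnj (s w) * k \<delta> z w)"
proof
  have \<delta>: "\<delta> \<in> characters \<Gamma>" unfolding \<delta>_def by (intro characters_mult characters_cnj \<alpha> \<beta>)
  assume "contractive_multiplier s (automorphic_hardy2 \<Gamma> \<delta>) (automorphic_hardy2 \<Gamma> \<alpha>)"
  then have "positive_kernel \<bbbD> (\<lambda>z w. k \<alpha> z w - s z * cnj (s w) * k \<delta> z w)"
  proof (rule contractive_multiplier_imp_positive_kernel[OF kernel[OF \<delta>] automorphic_hardy2_subset
        kernel[OF \<alpha>] automorphic_hardy2_subset, rotated])
    fix F :: "complex set" and c :: "complex \<Rightarrow> complex" assume F: "finite F" "F \<subseteq> \<bbbD>"
    show "(\<lambda>z. \<Sum>w\<in>F. c w * k \<delta> z w) \<in> automorphic_hardy2 \<Gamma> \<delta>"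
      using kernel[OF \<delta>] F(2)
      by (intro automorphic_hardy2_sum[of F "\<lambda>w z. k \<delta> z w"] F(1)) (auto simp: reproducing_kernel_def)
  qed
  then show "positive_kernel (upper_domain \<zz>) (\<lambda>z w. k \<alpha> z w - s z * cnj (s w) * k \<delta> z w)"
    using upper_domain_subset by (rule positive_kernel_subset)
next
  have \<delta>: "\<delta> \<in> characters \<Gamma>" unfolding \<delta>_def by (intro characters_mult characters_cnj \<alpha> \<beta>)
  assume pos: "positive_kernel (upper_domain \<zz>) (\<lambda>z w. k \<alpha> z w - s z * cnj (s w) * k \<delta> z w)"
  show "contractive_multiplier s (automorphic_hardy2 \<Gamma> \<delta>) (automorphic_hardy2 \<Gamma> \<alpha>)"
    unfolding contractive_multiplier_def
  proof
    fix f assume f: "f \<in> automorphic_hardy2 \<Gamma> \<delta>"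
    note * = positive_kernel_imp_multiplier[OF kernel[OF \<delta>] automorphic_hardy2_subset kernel[OF \<alpha>]
        automorphic_hardy2_subset upper_domain_subset upper_domain_open upper_domain_nonempty pos s(1) f]
    show "(\<lambda>z. s z * f z) \<in> automorphic_hardy2 \<Gamma> \<alpha> \<and> hardy2_norm (\<lambda>z. s z * f z) \<le> hardy2_norm f"
      using automorphic_hardy2_multiplier[OF \<beta> s(2) f[unfolded \<delta>_def] *(1)] *(2) by simp
  qed
qed

lemma tangent_continuous:
  assumes \<alpha>: "\<alpha> \<in> characters \<Gamma>" and \<delta>: "\<delta> \<in> characters \<Gamma>" and s: "s holomorphic_on \<bbbD>"
  shows "continuous_on (upper_domain \<zz>) (tangent_direction \<alpha> \<delta> s)" "continuous_on (upper_domain \<zz>) (tangent_value \<alpha> \<delta> s)"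
proof -
  have vec: "continuous_on X (\<lambda>z. vector [f z, g z] :: complex^2)"
    if "continuous_on X f" "continuous_on X g" for X and f g :: "complex \<Rightarrow> complex"
  proof -
    have eq: "(\<lambda>z. vector [f z, g z] :: complex^2) = (\<lambda>z. \<chi> i. if i = 1 then f z else g z)"
      by (rule ext) (simp add: vec_eq_iff forall_2)
    have "continuous_on X (\<lambda>z. if i = 1 then f z else g z)" for i :: 2
      using that by (cases "i = 1") auto
    then show ?thesis unfolding eq by (rule continuous_on_vec_lambda)
  qed
  have A: "continuous_on (upper_domain \<zz>) (A_fun \<Gamma> \<mu> \<zz> k \<eta>)"
    and S: "continuous_on (upper_domain \<zz>) (S_fun \<Gamma> \<mu> \<zz> k \<eta>)" if "\<eta> \<in> characters \<Gamma>" for \<eta>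
    using that by (auto intro: holomorphic_on_imp_continuous_on A_holomorphic S_holomorphic)
  have "continuous_on (upper_domain \<zz>) s"
    by (rule continuous_on_subset[OF holomorphic_on_imp_continuous_on[OF s] upper_domain_subset])
  then show "continuous_on (upper_domain \<zz>) (tangent_direction \<alpha> \<delta> s)" "continuous_on (upper_domain \<zz>) (tangent_value \<alpha> \<delta> s)"
    unfolding tangent_direction_def tangent_value_def using A_nonzero[OF \<alpha>]
    by (intro vec continuous_on_mult continuous_on_divide continuous_on_const A S \<alpha> \<delta>; blast)+
qed

text \<open>
  Eliminate \<open>\<phi>\<close>; the denominator does not vanish because \<open>|S\<^sub>\<delta>| < 1\<close> and \<open>|\<Sigma>\<^sub>2\<^sub>2| \<le> 1\<close>.
\<close>

lemma tangent_equation_iff: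
  fixes M :: "complex^2^2"
  assumes \<alpha>: "\<alpha> \<in> characters \<Gamma>" and \<delta>: "\<delta> \<in> characters \<Gamma>" and z: "z \<in> upper_domain \<zz>"
    and M: "cmod (M $ 2 $ 2) \<le> 1"
  shows "tangent_direction \<alpha> \<delta> s z v* M = tangent_value \<alpha> \<delta> s z \<longleftrightarrow>
    s z = A_fun \<Gamma> \<mu> \<zz> k \<alpha> z / A_fun \<Gamma> \<mu> \<zz> k \<delta> z * (M $ 1 $ 2 / (1 - S_fun \<Gamma> \<mu> \<zz> k \<delta> z * M $ 2 $ 2)) \<and>
    S_fun \<Gamma> \<mu> \<zz> k \<alpha> z = M $ 1 $ 1 +
      M $ 1 $ 2 * S_fun \<Gamma> \<mu> \<zz> k \<delta> z * M $ 2 $ 1 / (1 - S_fun \<Gamma> \<mu> \<zz> k \<delta> z * M $ 2 $ 2)"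
proof -
  define a d x y where "a = A_fun \<Gamma> \<mu> \<zz> k \<alpha> z" and "d = A_fun \<Gamma> \<mu> \<zz> k \<delta> z"
    and "x = S_fun \<Gamma> \<mu> \<zz> k \<alpha> z" and "y = S_fun \<Gamma> \<mu> \<zz> k \<delta> z"
  define n p q r where "n = M $ 1 $ 1" and "p = M $ 1 $ 2" and "q = M $ 2 $ 1" and "r = M $ 2 $ 2"
  define \<phi> where "\<phi> = s z * d / a"
  have ad: "a \<noteq> 0" "d \<noteq> 0" using A_nonzero \<alpha> \<delta> z by (auto simp: a_def d_def)
  have "cmod (y * r) < 1"
    using S_less_1[OF \<delta> z] M mult_right_le_one_le[of "cmod y" "cmod r"] unfolding norm_mult y_def r_def
    by simp
  then have yr: "1 - y * r \<noteq> 0" by auto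
  have "tangent_direction \<alpha> \<delta> s z v* M = tangent_value \<alpha> \<delta> s z \<longleftrightarrow> n + q * (\<phi> * y) = x \<and> p + r * (\<phi> * y) = \<phi>"
    unfolding tangent_direction_def tangent_value_def \<phi>_def n_def p_def q_def r_def a_def d_def x_def y_def
    by (simp add: vec_eq_iff forall_2 vector_matrix_mult_def sum_2 mult_ac)
  also have "\<dots> \<longleftrightarrow> \<phi> = p / (1 - y * r) \<and> x = n + p * y * q / (1 - y * r)"
  proof -
    have "p + r * (\<phi> * y) = \<phi> \<longleftrightarrow> \<phi> = p / (1 - y * r)"
    proof -
      have "p + r * (\<phi> * y) = \<phi> \<longleftrightarrow> \<phi> * (1 - y * r) = p" by (auto simp: algebra_simps)
      then show ?thesis using yr by (simp add: eq_divide_eq)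
    qed
    moreover have "n + q * (\<phi> * y) = x \<longleftrightarrow> x = n + p * y * q / (1 - y * r)" if "\<phi> = p / (1 - y * r)"
      unfolding that by (auto simp: mult_ac)
    ultimately show ?thesis by blast
  qed
  also have "\<phi> = p / (1 - y * r) \<longleftrightarrow> s z = a / d * (p / (1 - y * r))"
  proof -
    have sz: "s z = a / d * \<phi>" using ad by (simp add: \<phi>_def)
    have "a / d \<noteq> 0" using ad by simp
    from mult_left_cancel[OF this] show ?thesis unfolding sz by blast
  qed
  finally show ?thesis unfolding n_def p_def q_def r_def a_def d_def x_def y_def .
qed

end

theorem theorem4p2:
  fixes \<Gamma> :: "(complex \<Rightarrow> complex) set"
    and \<mu> \<alpha> \<beta> :: "(complex \<Rightarrow> complex) \<Rightarrow> complex"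
    and E :: "complex set"
    and \<zz> s :: "complex \<Rightarrow> complex"
    and k :: char_kernel
  defines "A \<equiv> A_fun \<Gamma> \<mu> \<zz> k"
    and "S \<equiv> S_fun \<Gamma> \<mu> \<zz> k"
    and "\<sigma> \<equiv> cayley \<zz>"
    and "\<Omega> \<equiv> upper_domain \<zz>"
    and "\<beta>\<alpha> \<equiv> (\<lambda>\<gamma>. cnj (\<beta> \<gamma>) * \<alpha> \<gamma>)"
  assumes "widom_covering \<Gamma> \<mu> E \<zz> k"
    and "\<alpha> \<in> characters \<Gamma>" and "\<beta> \<in> characters \<Gamma>"
    and "s holomorphic_on \<bbbD>" and "character_automorphic \<Gamma> \<beta> s"
  shows "contractive_multiplier s (automorphic_hardy2 \<Gamma> \<beta>\<alpha>) (automorphic_hardy2 \<Gamma> \<alpha>) \<longleftrightarrow>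
    (\<exists>\<Sigma> :: complex \<Rightarrow> complex^2^2. matrix_schur_function \<Sigma> \<and>
       extended_eq \<Omega> s
         (\<lambda>z. A \<alpha> z / A \<beta>\<alpha> z * (\<Sigma> (\<sigma> z) $ 1 $ 2 / (1 - S \<beta>\<alpha> z * \<Sigma> (\<sigma> z) $ 2 $ 2))) \<and>
       extended_eq \<Omega> (S \<alpha>)
         (\<lambda>z. \<Sigma> (\<sigma> z) $ 1 $ 1 +
              \<Sigma> (\<sigma> z) $ 1 $ 2 * S \<beta>\<alpha> z * \<Sigma> (\<sigma> z) $ 2 $ 1 / (1 - S \<beta>\<alpha> z * \<Sigma> (\<sigma> z) $ 2 $ 2)))"
proof -
  interpret widom_covering \<Gamma> \<mu> E \<zz> k by fact
  note \<alpha> = \<open>\<alpha> \<in> characters \<Gamma>\<close> and \<beta> = \<open>\<beta> \<in> characters \<Gamma>\<close>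
    and s = \<open>s holomorphic_on \<bbbD>\<close> \<open>character_automorphic \<Gamma> \<beta> s\<close>
  have \<beta>\<alpha>: "\<beta>\<alpha> \<in> characters \<Gamma>" unfolding \<beta>\<alpha>_def by (intro characters_mult characters_cnj \<alpha> \<beta>)
  have s_mero: "s meromorphic_on \<bbbD>"
    using s(1) by (intro analytic_on_imp_meromorphic_on) (simp add: analytic_on_open)
  let ?u = "tangent_direction \<alpha> \<beta>\<alpha> s" and ?v = "tangent_value \<alpha> \<beta>\<alpha> s"
  let ?P = "pick_kernel \<sigma> ?u ?v"
  have \<sigma>: "\<sigma> ` \<Omega> \<subseteq> \<bbbD>" "continuous_on \<Omega> \<sigma>"
    unfolding \<sigma>_def \<Omega>_def using cayley_in_disc holomorphic_on_imp_continuous_on[OF cayley_holomorphic] by auto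
  have "contractive_multiplier s (automorphic_hardy2 \<Gamma> \<beta>\<alpha>) (automorphic_hardy2 \<Gamma> \<alpha>) \<longleftrightarrow> positive_kernel \<Omega> ?P"
    unfolding \<sigma>_def \<Omega>_def tangent_positive_iff[OF \<alpha> \<beta>\<alpha>] unfolding \<beta>\<alpha>_def
    by (rule contractive_multiplier_iff_positive[OF \<alpha> \<beta> s])
  also have "\<dots> \<longleftrightarrow> (\<exists>\<Sigma>. matrix_schur_function \<Sigma> \<and> (\<forall>z\<in>\<Omega>. ?u z v* \<Sigma> (\<sigma> z) = ?v z))"
  proof
    assume "positive_kernel \<Omega> ?P"
    then show "\<exists>\<Sigma>. matrix_schur_function \<Sigma> \<and> (\<forall>z\<in>\<Omega>. ?u z v* \<Sigma> (\<sigma> z) = ?v z)"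
      by (rule tangential_interpolation[OF \<sigma>(2,1) tangent_continuous[OF \<alpha> \<beta>\<alpha> s(1), folded \<Omega>_def]]) blast
  next
    assume "\<exists>\<Sigma>. matrix_schur_function \<Sigma> \<and> (\<forall>z\<in>\<Omega>. ?u z v* \<Sigma> (\<sigma> z) = ?v z)"
    then obtain \<Sigma> where \<Sigma>: "matrix_schur_function \<Sigma>" "\<And>z. z \<in> \<Omega> \<Longrightarrow> ?u z v* \<Sigma> (\<sigma> z) = ?v z"
      by metis
    show "positive_kernel \<Omega> ?P" by (rule tangential_interpolation_necessary[OF \<Sigma>(1) \<sigma>(1) \<Sigma>(2)])
  qed
  also have "\<dots> \<longleftrightarrow> (\<exists>\<Sigma> :: complex \<Rightarrow> complex^2^2. matrix_schur_function \<Sigma> \<and>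
       extended_eq \<Omega> s
         (\<lambda>z. A \<alpha> z / A \<beta>\<alpha> z * (\<Sigma> (\<sigma> z) $ 1 $ 2 / (1 - S \<beta>\<alpha> z * \<Sigma> (\<sigma> z) $ 2 $ 2))) \<and>
       extended_eq \<Omega> (S \<alpha>)
         (\<lambda>z. \<Sigma> (\<sigma> z) $ 1 $ 1 +
              \<Sigma> (\<sigma> z) $ 1 $ 2 * S \<beta>\<alpha> z * \<Sigma> (\<sigma> z) $ 2 $ 1 / (1 - S \<beta>\<alpha> z * \<Sigma> (\<sigma> z) $ 2 $ 2)))"
  proof (intro ex_cong1 conj_cong refl)
    fix \<Sigma> :: "complex \<Rightarrow> complex^2^2" assume \<Sigma>: "matrix_schur_function \<Sigma>"
    have "?u z v* \<Sigma> (\<sigma> z) = ?v z \<longleftrightarrow>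
        s z = A \<alpha> z / A \<beta>\<alpha> z * (\<Sigma> (\<sigma> z) $ 1 $ 2 / (1 - S \<beta>\<alpha> z * \<Sigma> (\<sigma> z) $ 2 $ 2)) \<and>
        S \<alpha> z = \<Sigma> (\<sigma> z) $ 1 $ 1 +
              \<Sigma> (\<sigma> z) $ 1 $ 2 * S \<beta>\<alpha> z * \<Sigma> (\<sigma> z) $ 2 $ 1 / (1 - S \<beta>\<alpha> z * \<Sigma> (\<sigma> z) $ 2 $ 2)"
      if z: "z \<in> \<Omega>" for z
    proof -
      have "\<sigma> z \<in> \<bbbD>" using \<sigma>(1) z by blast
      from tangent_equation_iff[OF \<alpha> \<beta>\<alpha> z[unfolded \<Omega>_def] matrix_schur_function_entry_le_1[OF \<Sigma> this]]
      show ?thesis unfolding A_def S_def .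
    qed
    then show "(\<forall>z\<in>\<Omega>. ?u z v* \<Sigma> (\<sigma> z) = ?v z) \<longleftrightarrow>
       extended_eq \<Omega> s
         (\<lambda>z. A \<alpha> z / A \<beta>\<alpha> z * (\<Sigma> (\<sigma> z) $ 1 $ 2 / (1 - S \<beta>\<alpha> z * \<Sigma> (\<sigma> z) $ 2 $ 2))) \<and>
       extended_eq \<Omega> (S \<alpha>)
         (\<lambda>z. \<Sigma> (\<sigma> z) $ 1 $ 1 +
              \<Sigma> (\<sigma> z) $ 1 $ 2 * S \<beta>\<alpha> z * \<Sigma> (\<sigma> z) $ 2 $ 1 / (1 - S \<beta>\<alpha> z * \<Sigma> (\<sigma> z) $ 2 $ 2))"
      unfolding extended_eq_iff[OF s_mero] extended_eq_iff[OF S_meromorphic[OF \<alpha>, folded S_def]]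
        ball_conj_distrib[symmetric] by (rule ball_cong[OF refl])
  qed
  finally show ?thesis .
qed

end
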